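(* Let SEA-BREW be the versioned ciphertext-policy attribute-based encryption scheme given by the primitives $\mathrm{Setup}$, $\mathrm{Encrypt}$, $\mathrm{KeyGen}$, $\mathrm{UpdateMK}$, $\mathrm{UpdateEK}$, $\mathrm{UpdateDK}$, $\mathrm{UpdateCP}$ defined in the context. In the generic bilinear group model, with the hash function $H$ modeled as a random oracle, SEA-BREW is secure against an adaptive chosen plaintext attack (IND-CPA) by a set of colluding consumers; that is, for every probabilistic polynomial-time adversary $\mathcal{A}$, the advantage $\Pr[b'=b]-\frac12$ of $\mathcal{A}$ in Game 1 (defined in the context) against SEA-BREW is not non-negligible in the security parameter $\kappa$.
   Context: **Groups.** $\mathbb{G}_0$ is a multiplicative cyclic group of prime order $p$ of size (bit length) $\kappa$ with generator $g$, and $e:\mathbb{G}_0\times\mathbb{G}_0\to\mathbb{G}_1$ is an efficiently computable, bilinear, non-degenerate map. $H:\{0,1\}^*\to\mathbb{G}_0$ is a hash function modeled as a random oracle. Attributes are strings; messages are elements of $\mathbb{G}_1$. **Generic bilinear group model.** Elements of $\mathbb{G}_0$ and $\mathbb{G}_1$ are represented by independent random injective encodings $\psi_0,\psi_1:\mathbb{Z}_p\to\{0,1\}^m$ (with $m>3\log_2 p$), $\psi_0(x)$ representing $g^x$ and $\psi_1(x)$ representing $e(g,g)^x$. All parties manipulate group elements only through oracles for the group operations in $\mathbb{G}_0$ and $\mathbb{G}_1$ and for the bilinear map $e$; the adversary also has oracle access to $H$. **Policies.** An access policy $\mathcal{P}$ is a tree. Each non-leaf node $x$ is a threshold gate with threshold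 value $k_x$ ($1\le k_x\le$ number of children), true iff at least $k_x$ of its children are true. Each leaf $y$ carries an attribute $\operatorname{att}(y)$ and has $k_y=1$. An attribute set $\gamma$ satisfies $\mathcal{P}$ if the root evaluates to true when exactly the leaves $y$ with $\operatorname{att}(y)\in\gamma$ are set to true. The nodes are assigned distinct indices $\operatorname{index}(x)\in\{1,\dots,num\}$, where $num$ is the number of nodes. **Scheme.** A superscript $(i)$ denotes a version number. The scalars $\beta^{(i)}$ are understood to be nonzero. - $\mathrm{Setup}(\kappa)$: choose $\alpha,\beta^{(0)}\in\mathbb{Z}_p$ at random. Output the encryption key $EK^{(0)}=\{\mathbb{G}_0,g,h=g^{\beta^{(0)}},l=e(g,g)^\alpha,v_{EK}=0\}$ and the master key $MK^{(0)}=\{\beta^{(0)},g^\alpha,v_{MK}=0\}$. - $\mathrm{Encrypt}(M,\mathcal{P},EK)$: for each node $x$ choose a polynomial $q_x$ over $\mathbb{Z}_p$ of degree $d_x=k_x-1$, top-down. For the root $R$ choose random $s\in\mathbb{Z}_p$ and set $q_R(0)=s$; for any other node $x$ set $q_x(0)=q_{\operatorname{parent}(x)}(\operatorname{index}(x))$; in each case choose $d_x$ other points of $q_x$ at random. With $Y$ the set of leaves, output $$CP=\{\mathcal{P},\ \tilde C=M\,e(g,g)^{\alpha s},\ C=h^s,\ v_{CP}=v_{EK},\ \forall y\in Y:\ C_y=g^{q_y(0)},\ C'_y=H(\operatorname{att}(y))^{q_y(0)}\}.$$ - $\mathrm{KeyGen}(MK,\gamma)$, with $\beta$ the current component of $MK$: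 choose random $r\in\mathbb{Z}_p$ and $r_j\in\mathbb{Z}_p$ for each $j\in\gamma$. Output $$DK=\{D=g^{(\alpha+r)/\beta},\ v_{DK}=v_{MK},\ \forall j\in\gamma:\ D_j=g^r H(j)^{r_j},\ D'_j=g^{r_j}\}.$$ - $\mathrm{UpdateMK}(MK)$: increment $v_{MK}$ by one; choose a new $\beta^{(v_{MK})}\in\mathbb{Z}_p$ at random; set $U_{CP}^{(v_{MK})}=\beta^{(v_{MK})}/\beta^{(v_{MK}-1)}$, $U_{EK}^{(v_{MK})}=g^{\beta^{(v_{MK})}}$, $U_{DK}^{(v_{MK})}=\beta^{(v_{MK}-1)}/\beta^{(v_{MK})}$. The new master key is $\{\beta^{(v_{MK})},g^\alpha,v_{MK}\}$. - $\mathrm{UpdateEK}$: replace $h$ in the encryption key by $U_{EK}^{(v_{MK})}$ and set $v_{EK}=v_{MK}$. - $\mathrm{UpdateDK}$: for a decryption key of version $v_{DK}<v_{MK}$, replace $D$ by $D^{U'}$ with $U'=\prod_{i=v_{DK}+1}^{v_{MK}}U_{DK}^{(i)}$; the version becomes $v_{MK}$ and all other components are unchanged. - $\mathrm{UpdateCP}$: for a ciphertext of version $v_{CP}<v_{MK}$, replace $C$ by $C^{U'}$ with $U'=\prod_{i=v_{CP}+1}^{v_{MK}}U_{CP}^{(i)}$; the version becomes $v_{MK}$ and all other components are unchanged. **Game 1** (between a challenger and an adversary $\mathcal{A}$). *Setup.* The challenger runs $\mathrm{Setup}$ and sends $EK^{(0)}$ to $\mathcal{A}$. *Phase 1.* $\mathcal{A}$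 may adaptively issue queries of the following types. - encryption key update: the challenger runs $\mathrm{UpdateMK}$ and sends the updated encryption key to $\mathcal{A}$. - generate decryption key: $\mathcal{A}$ provides an attribute set $\gamma$; the challenger runs $\mathrm{KeyGen}$ on $\gamma$ with the current master key and sends the resulting decryption key to $\mathcal{A}$. - decryption key update: $\mathcal{A}$ provides a decryption key; the challenger runs $\mathrm{UpdateDK}$ on it and returns the key updated to the latest version. - ciphertext update: $\mathcal{A}$ provides a ciphertext; the challenger runs $\mathrm{UpdateCP}$ on it and returns the ciphertext updated to the latest version. *Challenge.* $\mathcal{A}$ submits two equal-length messages $m_0,m_1$ and a challenge policy $\mathcal{P}^*$ not satisfied by any attribute set queried in a generate decryption key query in Phase 1. The challenger picks a uniform bit $b\in\{0,1\}$ and sends $CP^*=\mathrm{Encrypt}(m_b,\mathcal{P}^*,EK^{(n)})$ to $\mathcal{A}$, where $n$ is the current version, i.e. the number of encryption key update queries made so far. *Phase 2.* As Phase 1, except that $\mathcal{A}$ may not issue generate decryption key queries for attribute sets satisfying $\mathcal{P}^*$. *Guess.* $\mathcal{A}$ outputs a bit $b'$. Its advantage is $\Pr[b'=b]-\frac12$. *)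

theory Defs
  imports
    "HOL-Probability.Probability"
    "HOL-Computational_Algebra.Polynomial"
    "HOL-Number_Theory.Modular_Inverse"
begin

type_synonym bits = "bool list"

section \<open>Generic bilinear groups\<close>

text \<open>
  A cyclic group of order \<open>p\<close> is seen only through an encoding \<open>\<psi>\<close> of the exponents \<open>0, ..., p - 1\<close>:
  the bit string \<open>\<psi> x\<close> is the group element \<open>g ^ x\<close>.  Scalars, that is elements of the field with
  \<open>p\<close> elements, are integers reduced modulo \<open>p\<close>.
\<close>

record generic_group =
  gorder :: nat
  genc :: "int \<Rightarrow> bits"

definition gcarrier :: "generic_group \<Rightarrow> bits set" where
  "gcarrier G = genc G ` {0..<int (gorder G)}"

definition glog :: "generic_group \<Rightarrow> bits \<Rightarrow> int" where
  "glog G a = inv_into {0..<int (gorder G)} (genc G) a"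

definition ggen :: "generic_group \<Rightarrow> bits" where
  "ggen G = genc G 1"

definition gmul :: "generic_group \<Rightarrow> bits \<Rightarrow> bits \<Rightarrow> bits" where
  "gmul G a b = genc G ((glog G a + glog G b) mod int (gorder G))"

definition ginv :: "generic_group \<Rightarrow> bits \<Rightarrow> bits" where
  "ginv G a = genc G ((- glog G a) mod int (gorder G))"

definition gpow :: "generic_group \<Rightarrow> bits \<Rightarrow> int \<Rightarrow> bits" where
  "gpow G a x = genc G ((glog G a * x) mod int (gorder G))"

definition pairing :: "generic_group \<Rightarrow> generic_group \<Rightarrow> bits \<Rightarrow> bits \<Rightarrow> bits" where
  "pairing G0 G1 a b = genc G1 ((glog G0 a * glog G0 b) mod int (gorder G0))"

definition random_encoding :: "nat \<Rightarrow> nat \<Rightarrow> (int \<Rightarrow> bits) pmf" where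
  "random_encoding p m =
     pmf_of_set {\<psi> \<in> {0..<int p} \<rightarrow>\<^sub>E {w. length w = m}. inj_on \<psi> {0..<int p}}"

definition random_group :: "nat \<Rightarrow> nat \<Rightarrow> generic_group pmf" where
  "random_group p m = map_pmf (\<lambda>\<psi>. \<lparr>gorder = p, genc = \<psi>\<rparr>) (random_encoding p m)"

definition scalar :: "nat \<Rightarrow> int pmf" where
  "scalar p = pmf_of_set {0..<int p}"

definition nonzero_scalar :: "nat \<Rightarrow> int pmf" where
  "nonzero_scalar p = pmf_of_set {1..<int p}"


section \<open>Access policies\<close>

text \<open>
  The first argument of both constructors is the index of the node, the second one of a gate is its
  threshold.  A leaf has threshold 1.
\<close>

datatype policy =
    Leaf (node_index: nat) bits
  | Gate (node_index: nat) nat "policy list"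

fun satisfies :: "bits set \<Rightarrow> policy \<Rightarrow> bool" where
  "satisfies \<gamma> (Leaf i a) \<longleftrightarrow> a \<in> \<gamma>"
| "satisfies \<gamma> (Gate i k cs) \<longleftrightarrow> k \<le> length (filter (satisfies \<gamma>) cs)"

fun node_indices :: "policy \<Rightarrow> nat list" where
  "node_indices (Leaf i a) = [i]"
| "node_indices (Gate i k cs) = i # concat (map node_indices cs)"

fun leaf_attrs :: "policy \<Rightarrow> bits list" where
  "leaf_attrs (Leaf i a) = [a]"
| "leaf_attrs (Gate i k cs) = concat (map leaf_attrs cs)"

fun valid_thresholds :: "policy \<Rightarrow> bool" where
  "valid_thresholds (Leaf i a) \<longleftrightarrow> True"
| "valid_thresholds (Gate i k cs) \<longleftrightarrow> 1 \<le> k \<and> k \<le> length cs \<and> (\<forall>c\<in>set cs. valid_thresholds c)"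

definition wf_policy :: "policy \<Rightarrow> bool" where
  "wf_policy P \<longleftrightarrow> valid_thresholds P \<and> distinct (node_indices P) \<and>
     set (node_indices P) \<subseteq> {1..length (node_indices P)}"


section \<open>The scheme\<close>

datatype enc_key =
  EncKey (ek_order: nat) (ek_g: bits) (ek_h: bits) (ek_l: bits) (ek_ver: nat)

datatype master_key =
  MasterKey (mk_beta: int) (mk_galpha: bits) (mk_ver: nat)

text \<open>The list of a decryption key holds the triples \<open>(j, D_j, D'_j)\<close>.\<close>

datatype dec_key =
  DecKey (dk_D: bits) (dk_ver: nat) (dk_attrs: "(bits \<times> bits \<times> bits) list")

text \<open>
  The list of a ciphertext holds the pairs \<open>(C_y, C'_y)\<close>, with the leaves \<open>y\<close> of the policy taken from
  left to right.
\<close>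

datatype ciphertext =
  Ciphertext (ct_policy: policy) (ct_Ctilde: bits) (ct_C: bits) (ct_ver: nat)
    (ct_leaves: "(bits \<times> bits) list")

definition scheme_setup :: "generic_group \<Rightarrow> generic_group \<Rightarrow> (enc_key \<times> master_key) pmf" where
  "scheme_setup G0 G1 = do {
     let p = gorder G0;
     let g = ggen G0;
     \<alpha> \<leftarrow> scalar p;
     \<beta> \<leftarrow> nonzero_scalar p;
     return_pmf
       (EncKey p g (gpow G0 g \<beta>) (gpow G1 (pairing G0 G1 g g) \<alpha>) 0,
        MasterKey \<beta> (gpow G0 g \<alpha>) 0)
   }"

text \<open>
  Drawing the values at \<open>d\<close> further points at random amounts to drawing uniformly among the
  polynomials of degree at most \<open>d\<close> with the prescribed value at 0.
\<close>

definition random_poly :: "nat \<Rightarrow> nat \<Rightarrow> int \<Rightarrow> int poly pmf" where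
  "random_poly p d c =
     pmf_of_set {q. degree q \<le> d \<and> (\<forall>i. coeff q i \<in> {0..<int p}) \<and> poly q 0 = c}"

text \<open>
  \<open>share p x c\<close> chooses the polynomials of the subtree \<open>x\<close> top-down, the one of its root taking the
  value \<open>c\<close> at 0, and returns \<open>(att(y), q_y(0))\<close> for the leaves \<open>y\<close> from left to right.
\<close>

fun share :: "nat \<Rightarrow> policy \<Rightarrow> int \<Rightarrow> (bits \<times> int) list pmf"
  and share_children :: "nat \<Rightarrow> int poly \<Rightarrow> policy list \<Rightarrow> (bits \<times> int) list pmf" where
  "share p (Leaf i a) c = do {
     q \<leftarrow> random_poly p 0 c;
     return_pmf [(a, poly q 0)]
   }"
| "share p (Gate i k cs) c = do {
     q \<leftarrow> random_poly p (k - 1) c;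
     share_children p q cs
   }"
| "share_children p q [] = return_pmf []"
| "share_children p q (x # xs) = do {
     ys \<leftarrow> share p x (poly q (int (node_index x)) mod int p);
     zs \<leftarrow> share_children p q xs;
     return_pmf (ys @ zs)
   }"

definition encrypt ::
    "generic_group \<Rightarrow> generic_group \<Rightarrow> (bits \<Rightarrow> bits) \<Rightarrow> bits \<Rightarrow> policy \<Rightarrow> enc_key \<Rightarrow> ciphertext pmf" where
  "encrypt G0 G1 H M P ek = do {
     s \<leftarrow> scalar (gorder G0);
     ys \<leftarrow> share (gorder G0) P s;
     return_pmf
       (Ciphertext P (gmul G1 M (gpow G1 (ek_l ek) s)) (gpow G0 (ek_h ek) s) (ek_ver ek)
          (map (\<lambda>(a, c). (gpow G0 (ek_g ek) c, gpow G0 (H a) c)) ys))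
   }"

primrec keygen_attrs ::
    "generic_group \<Rightarrow> (bits \<Rightarrow> bits) \<Rightarrow> int \<Rightarrow> bits list \<Rightarrow> (bits \<times> bits \<times> bits) list pmf" where
  "keygen_attrs G0 H r [] = return_pmf []"
| "keygen_attrs G0 H r (j # js) = do {
     rj \<leftarrow> scalar (gorder G0);
     ds \<leftarrow> keygen_attrs G0 H r js;
     return_pmf
       ((j, gmul G0 (gpow G0 (ggen G0) r) (gpow G0 (H j) rj), gpow G0 (ggen G0) rj) # ds)
   }"

text \<open>The attribute set is given by a list without repetitions.\<close>

definition keygen ::
    "generic_group \<Rightarrow> (bits \<Rightarrow> bits) \<Rightarrow> master_key \<Rightarrow> bits list \<Rightarrow> dec_key pmf" where
  "keygen G0 H mk js = do {
     r \<leftarrow> scalar (gorder G0);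
     ds \<leftarrow> keygen_attrs G0 H r js;
     return_pmf
       (DecKey
          (gpow G0 (gmul G0 (mk_galpha mk) (gpow G0 (ggen G0) r))
             (modular_inverse (int (gorder G0)) (mk_beta mk)))
          (mk_ver mk) ds)
   }"

text \<open>The result consists of the new master key and of \<open>U_CP\<close>, \<open>U_EK\<close> and \<open>U_DK\<close>.\<close>

definition update_mk ::
    "generic_group \<Rightarrow> master_key \<Rightarrow> (master_key \<times> int \<times> bits \<times> int) pmf" where
  "update_mk G0 mk = do {
     let p = int (gorder G0);
     let \<beta> = mk_beta mk;
     \<beta>' \<leftarrow> nonzero_scalar (gorder G0);
     return_pmf
       (MasterKey \<beta>' (mk_galpha mk) (Suc (mk_ver mk)),
        \<beta>' * modular_inverse p \<beta> mod p,
        gpow G0 (ggen G0) \<beta>',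
        \<beta> * modular_inverse p \<beta>' mod p)
   }"

definition update_ek :: "bits \<Rightarrow> nat \<Rightarrow> enc_key \<Rightarrow> enc_key" where
  "update_ek uek v ek = EncKey (ek_order ek) (ek_g ek) uek (ek_l ek) v"

text \<open>
  In the next two functions \<open>v\<close> is the version of the master key, and \<open>u i\<close> is the update quantity
  of version \<open>i\<close>.
\<close>

definition update_dk :: "generic_group \<Rightarrow> (nat \<Rightarrow> int) \<Rightarrow> nat \<Rightarrow> dec_key \<Rightarrow> dec_key" where
  "update_dk G0 u v dk =
     (if dk_ver dk < v
      then DecKey (gpow G0 (dk_D dk) (\<Prod>i\<in>{dk_ver dk + 1..v}. u i)) v (dk_attrs dk)
      else dk)"

definition update_cp :: "generic_group \<Rightarrow> (nat \<Rightarrow> int) \<Rightarrow> nat \<Rightarrow> ciphertext \<Rightarrow> ciphertext" where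
  "update_cp G0 u v ct =
     (if ct_ver ct < v
      then Ciphertext (ct_policy ct) (ct_Ctilde ct)
             (gpow G0 (ct_C ct) (\<Prod>i\<in>{ct_ver ct + 1..v}. u i)) v (ct_leaves ct)
      else ct)"


section \<open>The challenger\<close>

datatype query =
    Mul0 bits bits
  | Inv0 bits
  | Mul1 bits bits
  | Inv1 bits
  | Pairing bits bits
  | Hash bits
  | Update_EK
  | Gen_DK "bits list"
  | Update_DK dec_key
  | Update_CP ciphertext
  | Challenge bits bits policy

datatype answer =
    Refused
  | Elem bits
  | Answer_EK enc_key
  | Answer_DK dec_key
  | Answer_CP ciphertext

text \<open>
  \<open>ch_H\<close> is the lazily sampled random oracle, \<open>ch_asked\<close> collects the attribute sets of the generate
  decryption key queries, \<open>ch_policy\<close> is the challenge policy once the challenge has been made (so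
  that \<open>None\<close> means Phase 1), and \<open>ch_bit\<close> is the hidden bit.
\<close>

record challenger =
  ch_ek :: enc_key
  ch_mk :: master_key
  ch_ucp :: "nat \<Rightarrow> int"
  ch_udk :: "nat \<Rightarrow> int"
  ch_H :: "bits \<rightharpoonup> bits"
  ch_asked :: "bits set set"
  ch_policy :: "policy option"
  ch_bit :: bool

primrec hash_all ::
    "generic_group \<Rightarrow> (bits \<rightharpoonup> bits) \<Rightarrow> bits list \<Rightarrow> (bits \<rightharpoonup> bits) pmf" where
  "hash_all G0 h [] = return_pmf h"
| "hash_all G0 h (j # js) = do {
     h' \<leftarrow> (if j \<in> dom h then return_pmf h
           else map_pmf (\<lambda>x. h(j \<mapsto> genc G0 x)) (scalar (gorder G0)));
     hash_all G0 h' js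
   }"

text \<open>
  A query which the rules of the game do not admit, or which contains a bit string that does not
  encode an element of the group it is used in, is refused without any further effect.  The keys and
  ciphertexts submitted for an update are arbitrary; only the component to be updated is checked.
\<close>

fun respond ::
    "generic_group \<Rightarrow> generic_group \<Rightarrow> challenger \<Rightarrow> query \<Rightarrow> (answer \<times> challenger) pmf" where
  "respond G0 G1 ch (Mul0 a b) =
     return_pmf (if a \<in> gcarrier G0 \<and> b \<in> gcarrier G0 then Elem (gmul G0 a b) else Refused, ch)"
| "respond G0 G1 ch (Inv0 a) =
     return_pmf (if a \<in> gcarrier G0 then Elem (ginv G0 a) else Refused, ch)"
| "respond G0 G1 ch (Mul1 a b) =
     return_pmf (if a \<in> gcarrier G1 \<and> b \<in> gcarrier G1 then Elem (gmul G1 a b) else Refused, ch)"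
| "respond G0 G1 ch (Inv1 a) =
     return_pmf (if a \<in> gcarrier G1 then Elem (ginv G1 a) else Refused, ch)"
| "respond G0 G1 ch (Pairing a b) =
     return_pmf
       (if a \<in> gcarrier G0 \<and> b \<in> gcarrier G0 then Elem (pairing G0 G1 a b) else Refused, ch)"
| "respond G0 G1 ch (Hash j) = do {
     h \<leftarrow> hash_all G0 (ch_H ch) [j];
     return_pmf (Elem (the (h j)), ch\<lparr>ch_H := h\<rparr>)
   }"
| "respond G0 G1 ch Update_EK = do {
     (mk, ucp, uek, udk) \<leftarrow> update_mk G0 (ch_mk ch);
     let v = mk_ver mk;
     let ek = update_ek uek v (ch_ek ch);
     return_pmf
       (Answer_EK ek,
        ch\<lparr>ch_ek := ek, ch_mk := mk, ch_ucp := (ch_ucp ch)(v := ucp), ch_udk := (ch_udk ch)(v := udk)\<rparr>)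
   }"
| "respond G0 G1 ch (Gen_DK js) =
     (if distinct js \<and> (\<forall>P. ch_policy ch = Some P \<longrightarrow> \<not> satisfies (set js) P)
      then do {
        h \<leftarrow> hash_all G0 (ch_H ch) js;
        dk \<leftarrow> keygen G0 (the \<circ> h) (ch_mk ch) js;
        return_pmf (Answer_DK dk, ch\<lparr>ch_H := h, ch_asked := insert (set js) (ch_asked ch)\<rparr>)
      }
      else return_pmf (Refused, ch))"
| "respond G0 G1 ch (Update_DK dk) =
     return_pmf
       (if dk_D dk \<in> gcarrier G0
        then Answer_DK (update_dk G0 (ch_udk ch) (mk_ver (ch_mk ch)) dk) else Refused, ch)"
| "respond G0 G1 ch (Update_CP ct) =
     return_pmf
       (if ct_C ct \<in> gcarrier G0
        then Answer_CP (update_cp G0 (ch_ucp ch) (mk_ver (ch_mk ch)) ct) else Refused, ch)"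
| "respond G0 G1 ch (Challenge m0 m1 P) =
     (if ch_policy ch = None \<and> wf_policy P \<and> (\<forall>\<gamma>\<in>ch_asked ch. \<not> satisfies \<gamma> P) \<and>
         m0 \<in> gcarrier G1 \<and> m1 \<in> gcarrier G1 \<and> length m0 = length m1
      then do {
        h \<leftarrow> hash_all G0 (ch_H ch) (leaf_attrs P);
        ct \<leftarrow> encrypt G0 G1 (the \<circ> h) (if ch_bit ch then m1 else m0) P (ch_ek ch);
        return_pmf (Answer_CP ct, ch\<lparr>ch_H := h, ch_policy := Some P\<rparr>)
      }
      else return_pmf (Refused, ch))"


section \<open>Queries and answers as words over the tape alphabet\<close>

datatype sym = Blank | Bit bool | Sep | LPar | RPar

datatype sexp = Atom bits | SList "sexp list"

fun write_sexp :: "sexp \<Rightarrow> sym list" where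
  "write_sexp (Atom bs) = Sep # map Bit bs"
| "write_sexp (SList ts) = LPar # concat (map write_sexp ts) @ [RPar]"

fun nat_bits :: "nat \<Rightarrow> bits" where
  "nat_bits n = (if n = 0 then [] else odd n # nat_bits (n div 2))"

declare nat_bits.simps [simp del]

abbreviation num_sexp :: "nat \<Rightarrow> sexp" where
  "num_sexp n \<equiv> Atom (nat_bits n)"

fun policy_sexp :: "policy \<Rightarrow> sexp" where
  "policy_sexp (Leaf i a) = SList [num_sexp i, Atom a]"
| "policy_sexp (Gate i k cs) = SList [num_sexp i, num_sexp k, SList (map policy_sexp cs)]"

fun enc_key_sexp :: "enc_key \<Rightarrow> sexp" where
  "enc_key_sexp (EncKey p g h l v) = SList [num_sexp p, Atom g, Atom h, Atom l, num_sexp v]"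

fun dec_key_sexp :: "dec_key \<Rightarrow> sexp" where
  "dec_key_sexp (DecKey D v ds) =
     SList [Atom D, num_sexp v, SList (map (\<lambda>(j, d, d'). SList [Atom j, Atom d, Atom d']) ds)]"

fun ciphertext_sexp :: "ciphertext \<Rightarrow> sexp" where
  "ciphertext_sexp (Ciphertext P Ct C v ls) =
     SList [policy_sexp P, Atom Ct, Atom C, num_sexp v, SList (map (\<lambda>(c, c'). SList [Atom c, Atom c']) ls)]"

fun query_sexp :: "query \<Rightarrow> sexp" where
  "query_sexp (Mul0 a b) = SList [num_sexp 0, Atom a, Atom b]"
| "query_sexp (Inv0 a) = SList [num_sexp 1, Atom a]"
| "query_sexp (Mul1 a b) = SList [num_sexp 2, Atom a, Atom b]"
| "query_sexp (Inv1 a) = SList [num_sexp 3, Atom a]"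
| "query_sexp (Pairing a b) = SList [num_sexp 4, Atom a, Atom b]"
| "query_sexp (Hash j) = SList [num_sexp 5, Atom j]"
| "query_sexp Update_EK = SList [num_sexp 6]"
| "query_sexp (Gen_DK js) = SList [num_sexp 7, SList (map Atom js)]"
| "query_sexp (Update_DK dk) = SList [num_sexp 8, dec_key_sexp dk]"
| "query_sexp (Update_CP ct) = SList [num_sexp 9, ciphertext_sexp ct]"
| "query_sexp (Challenge m0 m1 P) = SList [num_sexp 10, Atom m0, Atom m1, policy_sexp P]"

fun answer_sexp :: "answer \<Rightarrow> sexp" where
  "answer_sexp Refused = SList []"
| "answer_sexp (Elem a) = Atom a"
| "answer_sexp (Answer_EK ek) = enc_key_sexp ek"
| "answer_sexp (Answer_DK dk) = dec_key_sexp dk"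
| "answer_sexp (Answer_CP ct) = ciphertext_sexp ct"

definition write_query :: "query \<Rightarrow> sym list" where
  "write_query q = write_sexp (query_sexp q)"

definition write_answer :: "answer \<Rightarrow> sym list" where
  "write_answer a = write_sexp (answer_sexp a)"

lemma write_sexp_append_inj:
  assumes "write_sexp t @ u = write_sexp t' @ u'"
    and "\<forall>b. u = [] \<or> hd u \<noteq> Bit b" and "\<forall>b. u' = [] \<or> hd u' \<noteq> Bit b"
  shows "t = t' \<and> u = u'"
  using assms
proof (induction t arbitrary: t' u u')
  case (Atom bs)
  then obtain bs' where t': "t' = Atom bs'"
    by (cases t') auto
  have "bs = bs' \<and> u = u'"
    if "map Bit bs @ u = map Bit bs' @ u'" for bs bs'
    using that Atom.prems(2,3)
  proof (induction bs arbitrary: bs')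
    case Nil
    then show ?case by (cases bs') auto
  next
    case (Cons b bs)
    then show ?case by (cases bs') auto
  qed
  with Atom.prems(1) t' show ?case by simp
next
  case (SList ts)
  then obtain ts' where t': "t' = SList ts'"
    by (cases t') auto
  have start: "\<forall>b. hd (write_sexp t @ w) \<noteq> Bit b" for t w
    by (cases t) auto
  have rest: "\<forall>b. concat (map write_sexp xs) @ RPar # w = [] \<or>
      hd (concat (map write_sexp xs) @ RPar # w) \<noteq> Bit b" for xs w
    using start by (cases xs) auto
  have "ts = ts' \<and> u = u'"
    if "concat (map write_sexp ts) @ RPar # u = concat (map write_sexp ts') @ RPar # u'"
    for ts'
    using that SList.IH
  proof (induction ts arbitrary: ts')
    case Nil
    then show ?case
    proof (cases ts')
      case (Cons x xs)
      with Nil show ?thesis by (cases x) auto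
    qed auto
  next
    case (Cons y ys)
    show ?case
    proof (cases ts')
      case Nil
      with Cons.prems(1) show ?thesis by (cases y) auto
    next
      case (Cons x xs)
      have "write_sexp y @ (concat (map write_sexp ys) @ RPar # u) =
          write_sexp x @ (concat (map write_sexp xs) @ RPar # u')"
        using Cons.prems(1) Cons by simp
      then have "y = x \<and> concat (map write_sexp ys) @ RPar # u = concat (map write_sexp xs) @ RPar # u'"
        using Cons.prems(2) rest by (meson list.set_intros(1))
      moreover from this have "ys = xs \<and> u = u'"
        using Cons.prems(2) by (intro Cons.IH) auto
      ultimately show ?thesis using Cons by simp
    qed
  qed
  with SList.prems(1) t' show ?case by simp
qed

lemma write_sexp_inj: "write_sexp t = write_sexp t' \<longleftrightarrow> t = t'"
  using write_sexp_append_inj[of t "[]" t' "[]"] by auto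

lemma nat_bits_inj [simp]: "nat_bits m = nat_bits n \<longleftrightarrow> m = n"
proof (induction m arbitrary: n rule: less_induct)
  case (less m)
  show ?case
  proof (cases "m = 0 \<or> n = 0")
    case True
    then show ?thesis by (auto simp: nat_bits.simps[of m] nat_bits.simps[of n])
  next
    case False
    then have "nat_bits (m div 2) = nat_bits (n div 2) \<longleftrightarrow> m div 2 = n div 2"
      by (intro less.IH) auto
    with False have "nat_bits m = nat_bits n \<longleftrightarrow> odd m = odd n \<and> m div 2 = n div 2"
      by (simp add: nat_bits.simps[of m] nat_bits.simps[of n])
    also have "\<dots> \<longleftrightarrow> m = n"
      by (metis odd_two_times_div_two_succ dvd_mult_div_cancel)
    finally show ?thesis .
  qed
qed

lemma policy_sexp_inj [simp]: "policy_sexp P = policy_sexp P' \<longleftrightarrow> P = P'"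
proof (induction P arbitrary: P')
  case (Leaf i a)
  then show ?case by (cases P') auto
next
  case (Gate i k cs)
  have "map policy_sexp cs = map policy_sexp cs' \<longleftrightarrow> cs = cs'" for cs'
    using Gate.IH
  proof (induction cs arbitrary: cs')
    case (Cons c cs)
    then show ?case by (cases cs') auto
  qed auto
  then show ?case by (cases P') auto
qed

lemma inj_write_query: "inj write_query"
proof (rule injI)
  fix q q' assume "write_query q = write_query q'"
  then have eq: "query_sexp q = query_sexp q'"
    by (simp add: write_query_def write_sexp_inj)
  have dk: "dk = dk'" if "dec_key_sexp dk = dec_key_sexp dk'" for dk dk'
  proof -
    have "inj (\<lambda>(j, d, d'). SList [Atom j, Atom d, Atom d'])"
      by (auto simp: inj_def)
    with that show ?thesis by (cases dk; cases dk') (auto simp: inj_map_eq_map)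
  qed
  have ct: "ct = ct'" if "ciphertext_sexp ct = ciphertext_sexp ct'" for ct ct'
  proof -
    have "inj (\<lambda>(c, c'). SList [Atom c, Atom c'])"
      by (auto simp: inj_def)
    with that show ?thesis by (cases ct; cases ct') (auto simp: inj_map_eq_map)
  qed
  have at: "js = js'" if "map Atom js = map Atom js'" for js js'
    using that by (simp add: inj_map_eq_map inj_def)
  from eq show "q = q'"
    by (cases q; cases q') (auto dest: dk ct at)
qed

definition read_query :: "sym list \<Rightarrow> query option" where
  "read_query w = (if w \<in> range write_query then Some (inv write_query w) else None)"


section \<open>Adversaries\<close>

text \<open>
  An adversary is a probabilistic Turing machine.  It has a work tape, which initially holds the security
  parameter in unary, a read-only answer tape and a write-only query tape.  In each step it may use one
  fair coin and append one symbol to its query.  It asks the query by entering state 1; the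
  challenger then erases the query tape, writes the answer on the answer tape and puts the machine
  into state 2.  State 0 is initial.  The machine halts in state 3 or 4 in order to guess 0 or 1.
\<close>

datatype move = MLeft | MStay | MRight

record machine =
  num_states :: nat
  delta :: "nat \<Rightarrow> sym \<Rightarrow> sym \<Rightarrow> bool \<Rightarrow> nat \<times> sym \<times> move \<times> move \<times> sym option"

definition wf_machine :: "machine \<Rightarrow> bool" where
  "wf_machine A \<longleftrightarrow> 5 \<le> num_states A \<and>
     (\<forall>s a b c. s < num_states A \<longrightarrow> fst (delta A s a b c) < num_states A)"

text \<open>
  A tape is blank outside the part listed.  The first list is the part left of the head, nearest
  cell first; the head is on the first cell of the second list.
\<close>

datatype tape = Tape "sym list" "sym list"

fun read_tape :: "tape \<Rightarrow> sym" where
  "read_tape (Tape ls []) = Blank"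
| "read_tape (Tape ls (r # rs)) = r"

fun write_tape :: "sym \<Rightarrow> tape \<Rightarrow> tape" where
  "write_tape x (Tape ls rs) = Tape ls (x # tl rs)"

fun move_tape :: "move \<Rightarrow> tape \<Rightarrow> tape" where
  "move_tape MStay t = t"
| "move_tape MLeft (Tape [] rs) = Tape [] (Blank # rs)"
| "move_tape MLeft (Tape (l # ls) rs) = Tape ls (l # rs)"
| "move_tape MRight (Tape ls []) = Tape (Blank # ls) []"
| "move_tape MRight (Tape ls (r # rs)) = Tape (r # ls) rs"

record config =
  c_state :: nat
  c_work :: tape
  c_answer :: tape
  c_query :: "sym list"

definition init_config :: "nat \<Rightarrow> answer \<Rightarrow> config" where
  "init_config \<kappa> a =
     \<lparr>c_state = 0, c_work = Tape [] (replicate \<kappa> (Bit True)), c_answer = Tape [] (write_answer a),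
      c_query = []\<rparr>"

definition halted :: "config \<Rightarrow> bool" where
  "halted c \<longleftrightarrow> c_state c = 3 \<or> c_state c = 4"

definition machine_step :: "machine \<Rightarrow> bool \<Rightarrow> config \<Rightarrow> config" where
  "machine_step A coin c =
     (let (s, x, mw, ma, out) = delta A (c_state c) (read_tape (c_work c)) (read_tape (c_answer c)) coin
      in \<lparr>c_state = s, c_work = move_tape mw (write_tape x (c_work c)),
          c_answer = move_tape ma (c_answer c),
          c_query = c_query c @ (case out of None \<Rightarrow> [] | Some y \<Rightarrow> [y])\<rparr>)"

definition game_step ::
    "machine \<Rightarrow> generic_group \<Rightarrow> generic_group \<Rightarrow> config \<times> challenger \<Rightarrow> (config \<times> challenger) pmf" where
  "game_step A G0 G1 = (\<lambda>(c, ch).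
     if halted c then return_pmf (c, ch)
     else if c_state c = 1 then do {
       (a, ch') \<leftarrow> (case read_query (c_query c) of
           None \<Rightarrow> return_pmf (Refused, ch)
         | Some q \<Rightarrow> respond G0 G1 ch q);
       return_pmf (c\<lparr>c_state := 2, c_answer := Tape [] (write_answer a), c_query := []\<rparr>, ch')
     }
     else do {
       coin \<leftarrow> bernoulli_pmf (1 / 2);
       return_pmf (machine_step A coin c, ch)
     })"

primrec game_steps ::
    "machine \<Rightarrow> generic_group \<Rightarrow> generic_group \<Rightarrow> nat \<Rightarrow> config \<times> challenger \<Rightarrow>
     (config \<times> challenger) pmf" where
  "game_steps A G0 G1 0 z = return_pmf z"
| "game_steps A G0 G1 (Suc t) z = game_step A G0 G1 z \<bind> game_steps A G0 G1 t"


section \<open>The game\<close>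

text \<open>
  The state of the game after \<open>t\<close> steps of the adversary, for groups of order \<open>p\<close> with encodings of
  length \<open>m\<close>.
\<close>

definition game :: "machine \<Rightarrow> nat \<Rightarrow> nat \<Rightarrow> nat \<Rightarrow> nat \<Rightarrow> (config \<times> challenger) pmf" where
  "game A \<kappa> p m t = do {
     G0 \<leftarrow> random_group p m;
     G1 \<leftarrow> random_group p m;
     (ek, mk) \<leftarrow> scheme_setup G0 G1;
     b \<leftarrow> bernoulli_pmf (1 / 2);
     game_steps A G0 G1 t
       (init_config \<kappa> (Answer_EK ek),
        \<lparr>ch_ek = ek, ch_mk = mk, ch_ucp = (\<lambda>_. 1), ch_udk = (\<lambda>_. 1), ch_H = Map.empty,
         ch_asked = {}, ch_policy = None, ch_bit = b\<rparr>)
   }"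

definition correct_guess :: "config \<times> challenger \<Rightarrow> bool" where
  "correct_guess = (\<lambda>(c, ch). c_state c = (if ch_bit ch then 4 else 3))"

text \<open>
  A halted configuration no longer changes, so that the probabilities below increase with \<open>t\<close> to
  the probability that the adversary eventually halts with the correct guess.
\<close>

definition success_prob :: "machine \<Rightarrow> nat \<Rightarrow> nat \<Rightarrow> nat \<Rightarrow> real" where
  "success_prob A \<kappa> p m = (SUP t. measure_pmf.prob (game A \<kappa> p m t) {z. correct_guess z})"

definition advantage :: "machine \<Rightarrow> (nat \<Rightarrow> nat) \<Rightarrow> (nat \<Rightarrow> nat) \<Rightarrow> nat \<Rightarrow> real" where
  "advantage A p m \<kappa> = success_prob A \<kappa> (p \<kappa>) (m \<kappa>) - 1 / 2"

text \<open>
  Group orders and encoding lengths depend on the security parameter.  There is no prime of bit length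
  less than 2.
\<close>

definition bilinear_params :: "(nat \<Rightarrow> nat) \<Rightarrow> (nat \<Rightarrow> nat) \<Rightarrow> bool" where
  "bilinear_params p m \<longleftrightarrow>
     (\<forall>\<kappa>\<ge>2. prime (p \<kappa>) \<and> 2 ^ (\<kappa> - 1) \<le> p \<kappa> \<and> p \<kappa> < 2 ^ \<kappa> \<and>
        real (m \<kappa>) > 3 * log 2 (real (p \<kappa>)))"

definition ppt :: "machine \<Rightarrow> (nat \<Rightarrow> nat) \<Rightarrow> (nat \<Rightarrow> nat) \<Rightarrow> bool" where
  "ppt A p m \<longleftrightarrow> wf_machine A \<and>
     (\<exists>T :: nat poly. \<forall>\<kappa>\<ge>2. \<forall>(c, ch)\<in>set_pmf (game A \<kappa> (p \<kappa>) (m \<kappa>) (poly T \<kappa>)). halted c)"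

definition negligible_fun :: "(nat \<Rightarrow> real) \<Rightarrow> bool" where
  "negligible_fun f \<longleftrightarrow> (\<forall>c :: nat. \<forall>\<^sub>F \<kappa> in sequentially. \<bar>f \<kappa>\<bar> < 1 / real \<kappa> ^ c)"

end

theory Submission
  imports Defs "HOL-Real_Asymp.Real_Asymp"
begin

text \<open>
  Every group element that occurs in the game is a function of the secrets which is a Laurent polynomial
  in each of them.  If two such functions differ, then they take different values at random secrets up to
  a small probability, so that the adversary learns from the encodings only which functions are equal.
  These equalities do not depend on the hidden bit: setting all \<open>\<beta>\<close>'s equal turns the updates into the
  identity, and a signed sum over suitable assignments of the secrets, built for each key from a sharing of
  \<open>1\<close> that vanishes on its attributes, annihilates all products of two elements of the source
  group, but not \<open>\<alpha> s\<close>.  Hence the mask of the challenge message is independent of everything else.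

  The comparison of the real game with the ideal one, in which fresh elements receive fresh random strings,
  is by induction on the number of steps left.  A lower bound \<open>1 - \<epsilon>\<close> on the ratio of probabilities
  suffices, as it holds for both outcomes and both values of the hidden bit.
\<close>

section \<open>Functions that are polynomial in each secret\<close>

text \<open>Because only a lower bound is proved, terms may be dropped at any moment. An accidental
  coincidence of two entries, or an invented string that happens to encode an element, is removed
  from the experiment without being charged when it occurs; all losses are measured once, at the end
  of the run, against the final table. This is why \<open>weight\<close> carries a table
  \<open>T\<close> of revealed strings and a set \<open>R\<close> of strings committed not to be
  encodings. The adversary may have any source element updated, under any claimed version, so
  quotients of two \<beta>'s can be multiplied onto everything it holds. Degrees therefore grow
  during the run, and the independence of the mask cannot be read off from a fixed list of pairings.
  Elements are functions, not formal polynomials: only their restrictions to one variable need a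
  degree bound, which is all that an induction over the variables uses. The loss is of order
  \<open>B ^ 4 / p\<close> for a budget \<open>B\<close> linear in the number of steps:
  \<open>B ^ 2\<close> pairs of entries, \<open>B\<close> variables, degree
  \<open>B\<close>.\<close>

lemma prob_bind_pmf:
  "measure_pmf.prob (bind_pmf M f) A = (\<integral>x. measure_pmf.prob (f x) A \<partial>measure_pmf M)"
proof -
  have "measure_pmf.prob (bind_pmf M f) A = pmf (map_pmf (\<lambda>x. x \<in> A) (bind_pmf M f)) True"
    by (simp add: pmf_map vimage_def)
  also have "\<dots> = (\<integral>x. pmf (map_pmf (\<lambda>x. x \<in> A) (f x)) True \<partial>measure_pmf M)"
    by (simp add: map_bind_pmf pmf_bind)
  finally show ?thesis
    by (simp add: pmf_map vimage_def)
qed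

text \<open>A root \<open>b\<close> modulo \<open>p\<close> is split off with
  \<open>synthetic_div\<close>; the remainder \<open>poly q b\<close> is divisible by
  \<open>p\<close> but need not be 0. Polynomials stay over the integers, so being nonzero is
  expressed by a point \<open>a\<close> that is not a root modulo \<open>p\<close>.\<close>

lemma card_roots_mod_prime:
  fixes q :: "int poly"
  assumes "prime p" and "\<not> int p dvd poly q a"
  shows "card {v \<in> {0..<int p}. int p dvd poly q v} \<le> degree q"
  using assms(2)
proof (induction "degree q" arbitrary: q a)
  case 0
  then obtain c where "q = [:c:]"
    by (metis degree_eq_zeroE)
  with 0 show ?case by simp
next
  case (Suc n)
  show ?case
  proof (cases "\<exists>b\<in>{0..<int p}. int p dvd poly q b")
    case False
    then have "{v \<in> {0..<int p}. int p dvd poly q v} = {}" by auto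
    then show ?thesis by (simp only: card.empty)
  next
    case True
    then obtain b where b: "b \<in> {0..<int p}" "int p dvd poly q b" by blast
    define r where "r = synthetic_div q b"
    have "poly q v + b * poly r v = poly q b + v * poly r v" for v
      using arg_cong[OF synthetic_div_correct[of q b], of "\<lambda>s. poly s v"] by (simp add: r_def)
    then have q: "poly q v = (v - b) * poly r v + poly q b" for v
      by (simp add: algebra_simps eq_diff_eq)
    have deg: "degree r = n"
      using Suc.hyps(2) by (simp add: r_def degree_synthetic_div)
    have "\<not> int p dvd poly r a"
    proof
      assume "int p dvd poly r a"
      then have "int p dvd (a - b) * poly r a + poly q b"
        using b(2) by (intro dvd_add dvd_mult)
      with Suc.prems q[of a] show False by simp
    qed
    then have bound: "card {v \<in> {0..<int p}. int p dvd poly r v} \<le> n"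
      using Suc.hyps(1)[of r a] deg by simp
    have "v = b \<or> int p dvd poly r v" if "v \<in> {0..<int p}" "int p dvd poly q v" for v
    proof -
      have "int p dvd (v - b) * poly r v"
        using that(2) b(2) q[of v] by (simp add: dvd_add_left_iff)
      then have "int p dvd v - b \<or> int p dvd poly r v"
        using assms(1) by (simp add: prime_dvd_mult_iff)
      moreover have "v = b" if "int p dvd v - b"
        using that \<open>v \<in> _\<close> b(1) by (simp add: mod_eq_dvd_iff[symmetric])
      ultimately show ?thesis by blast
    qed
    then have "{v \<in> {0..<int p}. int p dvd poly q v} \<subseteq> insert b {v \<in> {0..<int p}. int p dvd poly r v}"
      by blast
    then have "card {v \<in> {0..<int p}. int p dvd poly q v}
        \<le> card (insert b {v \<in> {0..<int p}. int p dvd poly r v})"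
      by (rule card_mono[rotated]) (rule finite_subset[of _ "insert b {0..<int p}"], auto)
    also have "\<dots> \<le> Suc n"
      using bound by (intro order.trans[OF card_insert_le_m1]) auto
    finally show ?thesis using Suc.hyps(2) by simp
  qed
qed

datatype var = Alpha | Beta nat | Hsh bits | KeyR nat | KeyRJ nat bits | CtS | CtQ nat nat | Theta

text \<open>
  The secrets of the challenger are named by variables, and a group element is represented by its
  exponent as a function of the secrets.  \<open>Theta\<close> stands for the exponent of the component
  \<open>C~\<close> of the challenge ciphertext, treated as if it were independent of everything else.
\<close>

type_synonym asn = "var \<Rightarrow> int"
type_synonym elt = "asn \<Rightarrow> int"

fun denom :: "var \<Rightarrow> int \<Rightarrow> int" where
  "denom (Beta i) y = y"
| "denom _ y = 1"

fun denom_poly :: "var \<Rightarrow> int poly" where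
  "denom_poly (Beta i) = [:0, 1:]"
| "denom_poly _ = 1"

lemma poly_denom_poly [simp]: "poly (denom_poly v) y = denom v y"
  by (cases v) auto

lemma degree_denom_poly: "degree (denom_poly v) \<le> 1"
  by (cases v) auto

text \<open>The last assumption is the integer form of \<open>m > 3 * log 2 p\<close>. The order
  must be odd because the sum that separates the mask from the pairings turns out to be a power of
  two up to sign.\<close>

locale bilinear =
  fixes p m :: nat
  assumes prime_p: "prime p" and p_gt2: "2 < p" and m_large: "p ^ 3 \<le> 2 ^ m"
begin

abbreviation "q \<equiv> int p"

lemma q_pos [simp]: "0 < q" "1 < q" "q \<noteq> 0"
  using p_gt2 by auto

fun var_range :: "var \<Rightarrow> int set" where
  "var_range (Beta i) = {1..<q}"
| "var_range _ = {0..<q}"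

lemma var_range_props: "finite (var_range v)" "1 \<in> var_range v" "var_range v \<subseteq> {0..<q}" "p - 1 \<le> card (var_range v)" "var_range v \<noteq> {}"
  using p_gt2 by (cases v; auto)+

definition asns :: "asn set" where
  "asns = {x. \<forall>v. x v \<in> var_range v}"

definition var_pmf :: "var \<Rightarrow> int pmf" where
  "var_pmf v = pmf_of_set (var_range v)"

lemma set_var_pmf [simp]: "set_pmf (var_pmf v) = var_range v"
  unfolding var_pmf_def by (rule set_pmf_of_set) (auto simp: var_range_props)

text \<open>The default 1 outside \<open>V\<close> lies in the range of every variable, so that all
  samples belong to \<open>asns\<close>.\<close>

definition rand_asn :: "var set \<Rightarrow> asn pmf" where
  "rand_asn V = Pi_pmf V 1 var_pmf"

lemma rand_asn_asns: "finite V \<Longrightarrow> x \<in> set_pmf (rand_asn V) \<Longrightarrow> x \<in> asns"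
  unfolding rand_asn_def asns_def by (subst (asm) set_Pi_pmf) (auto simp: PiE_dflt_def var_range_props(2), metis var_range_props(2))

lemma rand_asn_outside: "finite V \<Longrightarrow> x \<in> set_pmf (rand_asn V) \<Longrightarrow> v \<notin> V \<Longrightarrow> x v = 1"
  unfolding rand_asn_def by (subst (asm) set_Pi_pmf) (auto simp: PiE_dflt_def)

lemma asns_upd: "x \<in> asns \<Longrightarrow> y \<in> var_range v \<Longrightarrow> x(v := y) \<in> asns"
  by (auto simp: asns_def)

lemma asns_override: "x \<in> asns \<Longrightarrow> y \<in> asns \<Longrightarrow> override_on x y V \<in> asns"
  by (auto simp: asns_def override_on_def)

lemma asns_range: "x \<in> asns \<Longrightarrow> 0 \<le> x v \<and> x v < q"
  using var_range_props(3)[of v] unfolding asns_def by force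

lemma rand_asn_union:
  assumes "finite V" "finite V'" "V \<inter> V' = {}"
  shows "rand_asn (V \<union> V') = do {x \<leftarrow> rand_asn V; y \<leftarrow> rand_asn V'; return_pmf (override_on x y V')}"
proof -
  have "rand_asn (V \<union> V') = map_pmf (\<lambda>(f,g) x. if x \<in> V then f x else g x) (pair_pmf (rand_asn V) (rand_asn V'))"
    unfolding rand_asn_def by (rule Pi_pmf_union[OF assms])
  also have "\<dots> = do {x \<leftarrow> rand_asn V; y \<leftarrow> rand_asn V'; return_pmf (\<lambda>v. if v \<in> V then x v else y v)}"
    by (simp add: pair_pmf_def map_bind_pmf)
  also have "\<dots> = do {x \<leftarrow> rand_asn V; y \<leftarrow> rand_asn V'; return_pmf (override_on x y V')}"
  proof (intro bind_pmf_cong refl arg_cong[where f = return_pmf] HOL.ext)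
    fix x y v assume "x \<in> set_pmf (rand_asn V)" "y \<in> set_pmf (rand_asn V')"
    then show "(if v \<in> V then x v else y v) = override_on x y V' v"
      using assms rand_asn_outside[of V x v] rand_asn_outside[of V' y v] by (auto simp: override_on_def)
  qed
  finally show ?thesis .
qed

lemma rand_asn_empty [simp]: "rand_asn {} = return_pmf (\<lambda>_. 1)"
  by (simp add: rand_asn_def)

lemma rand_asn_single: "rand_asn {v} = map_pmf (\<lambda>a. (\<lambda>_. 1)(v := a)) (var_pmf v)"
  by (simp add: rand_asn_def Pi_pmf_singleton fun_upd_def)

text \<open>
  The factor \<open>denom v y ^ d\<close> clears the poles caused by the inverses of the \<open>\<beta>\<close>'s.
\<close>

definition laurent :: "nat \<Rightarrow> elt \<Rightarrow> bool" where
  "laurent d f \<longleftrightarrow> (\<forall>v. \<forall>x\<in>asns. \<exists>r. degree r \<le> 2 * d \<and>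
     (\<forall>y\<in>var_range v. [f (x(v := y)) * denom v y ^ d = poly r y] (mod q)))"

lemma laurent_const: "laurent d (\<lambda>_. c)"
  unfolding laurent_def
proof (intro allI ballI)
  fix v x
  have "degree (smult c (denom_poly v ^ d)) \<le> 2 * d"
    using degree_power_le[of "denom_poly v" d] degree_denom_poly[of v] degree_smult_le[of c "denom_poly v ^ d"] 
    by (meson le_trans mult_le_mono1 order.refl numeral_le_one_iff one_le_numeral)
  then show "\<exists>r. degree r \<le> 2 * d \<and> (\<forall>y\<in>var_range v. [c * denom v y ^ d = poly r y] (mod q))"
    by (intro exI[of _ "smult c (denom_poly v ^ d)"]) auto
qed

lemma laurent_mono:
  assumes "laurent d f" "d \<le> d'"
  shows "laurent d' f"
  unfolding laurent_def
proof (intro allI ballI)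
  fix v x assume "x \<in> asns"
  then obtain r where r: "degree r \<le> 2 * d" "\<forall>y\<in>var_range v. [f (x(v := y)) * denom v y ^ d = poly r y] (mod q)"
    using assms(1) unfolding laurent_def by blast
  define r' where "r' = r * denom_poly v ^ (d' - d)"
  have "degree r' \<le> degree r + degree (denom_poly v ^ (d' - d))"
    unfolding r'_def by (rule degree_mult_le)
  also have "degree (denom_poly v ^ (d' - d)) \<le> 1 * (d' - d)"
    using degree_power_le[of "denom_poly v" "d' - d"] degree_denom_poly[of v] by (meson le_trans mult_le_mono1)
  finally have "degree r' \<le> 2 * d'"
    using r(1) assms(2) by simp
  moreover have "[f (x(v := y)) * denom v y ^ d' = poly r' y] (mod q)" if "y \<in> var_range v" for y
  proof -
    have "denom v y ^ d' = denom v y ^ d * denom v y ^ (d' - d)"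
      using assms(2) by (simp add: power_add[symmetric])
    moreover have "[f (x(v := y)) * denom v y ^ d * denom v y ^ (d' - d) = poly r y * denom v y ^ (d' - d)] (mod q)"
      using r(2) that by (intro cong_mult) auto
    ultimately show ?thesis by (simp add: r'_def mult.assoc)
  qed
  ultimately show "\<exists>r. degree r \<le> 2 * d' \<and> (\<forall>y\<in>var_range v. [f (x(v := y)) * denom v y ^ d' = poly r y] (mod q))"
    by blast
qed

lemma laurent_cong: "laurent d f \<Longrightarrow> (\<And>x. x \<in> asns \<Longrightarrow> [f x = g x] (mod q)) \<Longrightarrow> laurent d g"
  unfolding laurent_def
  by (meson asns_upd cong_mult cong_refl cong_sym cong_trans)

lemma laurent_mod [simp]: "laurent d (\<lambda>x. f x mod q) \<longleftrightarrow> laurent d f"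
  using laurent_cong[of d f "\<lambda>x. f x mod q"] laurent_cong[of d "\<lambda>x. f x mod q" f]
  by (auto simp: Cong.cong_def)

lemma laurent_add:
  assumes "laurent d f" "laurent d g"
  shows "laurent d (\<lambda>x. f x + g x)"
  unfolding laurent_def
proof (intro allI ballI)
  fix v x assume x: "x \<in> asns"
  obtain r where r: "degree r \<le> 2 * d" "\<forall>y\<in>var_range v. [f (x(v := y)) * denom v y ^ d = poly r y] (mod q)"
    using assms(1) x unfolding laurent_def by blast
  obtain s where s: "degree s \<le> 2 * d" "\<forall>y\<in>var_range v. [g (x(v := y)) * denom v y ^ d = poly s y] (mod q)"
    using assms(2) x unfolding laurent_def by blast
  show "\<exists>r. degree r \<le> 2 * d \<and> (\<forall>y\<in>var_range v. [(f (x(v := y)) + g (x(v := y))) * denom v y ^ d = poly r y] (mod q))"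
    using r s degree_add_le[of r "2*d" s]
    by (intro exI[of _ "r + s"]) (auto simp: distrib_right intro: cong_add)
qed

lemma laurent_mult:
  assumes "laurent d f" "laurent d' g"
  shows "laurent (d + d') (\<lambda>x. f x * g x)"
  unfolding laurent_def
proof (intro allI ballI)
  fix v x assume x: "x \<in> asns"
  obtain r where r: "degree r \<le> 2 * d" "\<forall>y\<in>var_range v. [f (x(v := y)) * denom v y ^ d = poly r y] (mod q)"
    using assms(1) x unfolding laurent_def by blast
  obtain s where s: "degree s \<le> 2 * d'" "\<forall>y\<in>var_range v. [g (x(v := y)) * denom v y ^ d' = poly s y] (mod q)"
    using assms(2) x unfolding laurent_def by blast
  have "[f (x(v := y)) * g (x(v := y)) * denom v y ^ (d + d') = poly (r * s) y] (mod q)" if "y \<in> var_range v" for y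
  proof -
    have "[(f (x(v := y)) * denom v y ^ d) * (g (x(v := y)) * denom v y ^ d') = poly r y * poly s y] (mod q)"
      using r s that by (intro cong_mult) auto
    then show ?thesis by (simp add: power_add mult_ac)
  qed
  moreover have "degree (r * s) \<le> 2 * (d + d')"
    using degree_mult_le[of r s] r s by simp
  ultimately show "\<exists>r. degree r \<le> 2 * (d + d') \<and>
      (\<forall>y\<in>var_range v. [f (x(v := y)) * g (x(v := y)) * denom v y ^ (d + d') = poly r y] (mod q))"
    by blast
qed

lemma laurent_cmult: "laurent d f \<Longrightarrow> laurent d (\<lambda>x. c * f x)"
  using laurent_mult[OF laurent_const[of 0 c], of d f] by simp

lemma laurent_uminus: "laurent d f \<Longrightarrow> laurent d (\<lambda>x. - f x)"
  using laurent_cmult[of d f "-1"] by simp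

lemma laurent_diff: "laurent d f \<Longrightarrow> laurent d g \<Longrightarrow> laurent d (\<lambda>x. f x - g x)"
  using laurent_add[of d f "\<lambda>x. - g x"] by (simp add: laurent_uminus)

lemma laurent_sum: "(\<And>i. i \<in> I \<Longrightarrow> laurent d (f i)) \<Longrightarrow> laurent d (\<lambda>x. \<Sum>i\<in>I. f i x)"
  by (induction I rule: infinite_finite_induct) (auto simp: laurent_const laurent_add)

lemma laurent_var: "laurent 1 (\<lambda>x. x w)"
  unfolding laurent_def
proof (intro allI ballI)
  fix v x
  define r where "r = (if v = w then [:0, 1:] else [:x w:]) * denom_poly v"
  have "degree r \<le> 2 * 1"
    using degree_denom_poly[of v] degree_mult_le[of "if v = w then [:0, 1:] else [:x w:]" "denom_poly v"]
    unfolding r_def by (auto split: if_splits)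
  then show "\<exists>r. degree r \<le> 2 * 1 \<and> (\<forall>y\<in>var_range v. [(x(v := y)) w * denom v y ^ 1 = poly r y] (mod q))"
    by (intro exI[of _ r]) (auto simp: r_def)
qed

abbreviation "inv_q \<equiv> modular_inverse q"

lemma coprime_q: "0 < y \<Longrightarrow> y < q \<Longrightarrow> coprime y q"
  using prime_p by (metis coprime_commute prime_imp_coprime prime_nat_int_transfer zdvd_not_zless)

lemma Beta_coprime: "x \<in> asns \<Longrightarrow> coprime (x (Beta i)) q"
proof -
  assume "x \<in> asns"
  then have "x (Beta i) \<in> var_range (Beta i)" unfolding asns_def by blast
  then show ?thesis by (intro coprime_q) auto
qed

lemma inv_q_cong: "x \<in> asns \<Longrightarrow> [x (Beta i) * inv_q (x (Beta i)) = 1] (mod q)"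
  by (intro cong_modular_inverse1 Beta_coprime)

lemma laurent_inv: "laurent 1 (\<lambda>x. inv_q (x (Beta i)))"
  unfolding laurent_def
proof (intro allI ballI)
  fix v x assume x: "x \<in> asns"
  show "\<exists>r. degree r \<le> 2 * 1 \<and> (\<forall>y\<in>var_range v. [inv_q ((x(v := y)) (Beta i)) * denom v y ^ 1 = poly r y] (mod q))"
  proof (cases "v = Beta i")
    case True
    have "[inv_q y * y = 1] (mod q)" if "y \<in> var_range v" for y
      using that True by (intro cong_modular_inverse2 coprime_q) auto
    with True show ?thesis by (intro exI[of _ 1]) auto
  next
    case False
    then show ?thesis using degree_denom_poly[of v]
      by (intro exI[of _ "smult (inv_q (x (Beta i))) (denom_poly v)"]) (auto intro: order.trans[OF degree_smult_le])
  qed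
qed

text \<open>Induction on the set of randomised variables. If \<open>F\<close> is nonzero after
  overriding \<open>V\<close>, then a further variable \<open>v\<close> still has its value from
  \<open>x0\<close>, and this value is a non-root of the univariate polynomial in \<open>v\<close>.
  That polynomial has at most \<open>2 * d\<close> roots among at least \<open>p - 1\<close> values.
  The point \<open>x0\<close> thus replaces the notion of a nonzero polynomial.\<close>

lemma schwartz_zippel:
  assumes "laurent d F" "x0 \<in> asns" "\<not> [F x0 = 0] (mod q)" "finite V"
  shows "measure_pmf.prob (rand_asn V) {y. [F (override_on x0 y V) = 0] (mod q)} \<le> card V * (2 * d) / (p - 1)"
  using assms(4)
proof (induction V rule: finite_induct)
  case empty
  then show ?case using assms(3) by simp
next
  case (insert v V)
  let ?B = "{y. [F (override_on x0 y V) = 0] (mod q)}"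
  let ?f = "\<lambda>y a. [F ((override_on x0 y V)(v := a)) = 0] (mod q)"
  have rand_asn: "rand_asn (insert v V) = do {y \<leftarrow> rand_asn V; a \<leftarrow> var_pmf v; return_pmf (y(v := a))}"
    unfolding rand_asn_def by (subst Pi_pmf_insert'[OF insert.hyps]) (rule bind_commute_pmf)
  have "measure_pmf.prob (rand_asn (insert v V)) {y. [F (override_on x0 y (insert v V)) = 0] (mod q)}
      = (\<integral>y. measure_pmf.prob (var_pmf v) {a. ?f y a} \<partial>measure_pmf (rand_asn V))"
    unfolding rand_asn prob_bind_pmf[of "rand_asn V"]
  proof (intro Bochner_Integration.integral_cong refl)
    fix y
    have "override_on x0 (y(v := a)) (insert v V) = (override_on x0 y V)(v := a)" for a
      using insert.hyps by (auto simp: override_on_def)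
    then show "measure_pmf.prob (var_pmf v \<bind> (\<lambda>a. return_pmf (y(v := a)))) {y. [F (override_on x0 y (insert v V)) = 0] (mod q)} =
        measure_pmf.prob (var_pmf v) {a. ?f y a}"
      by (simp add: map_pmf_def[symmetric] vimage_def)
  qed
  also have "\<dots> \<le> (\<integral>y. indicat_real ?B y + (2 * d) / (p - 1) \<partial>measure_pmf (rand_asn V))"
  proof (intro integral_mono_AE AE_pmfI)
    fix y assume y: "y \<in> set_pmf (rand_asn V)"
    show "measure_pmf.prob (var_pmf v) {a. ?f y a} \<le> indicat_real ?B y + (2 * d) / (p - 1)"
    proof (cases "y \<in> ?B")
      case True
      have "measure_pmf.prob (var_pmf v) {a. ?f y a} \<le> 1" by simp
      then show ?thesis using True by (simp add: add_increasing2)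
    next
      case False
      let ?x = "override_on x0 y V"
      have x: "?x \<in> asns" using y insert.hyps assms(2) rand_asn_asns asns_override by blast
      obtain r where r: "degree r \<le> 2 * d" "\<forall>a\<in>var_range v. [F (?x(v := a)) * denom v a ^ d = poly r a] (mod q)"
        using assms(1) x unfolding laurent_def by blast
      have xv: "?x v \<in> var_range v" using x unfolding asns_def by blast
      \<comment> \<open>Clearing the denominator creates no zero at this point: the values of the
        \<beta>'s lie strictly between 0 and \<open>q\<close>.\<close>
      have "\<not> q dvd denom v (?x v) ^ d"
      proof (cases v)
        case (Beta i)
        with xv have "0 < ?x v" "?x v < q" by auto
        then have "\<not> q dvd ?x v" by (rule zdvd_not_zless)
        then show ?thesis using Beta prime_p prime_dvd_power[of q "?x v" d] by auto
      qed (use p_gt2 in auto)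
      moreover have "\<not> q dvd F ?x" using False by (simp add: cong_0_iff)
      ultimately have "\<not> q dvd F ?x * denom v (?x v) ^ d"
        using prime_p by (simp add: prime_dvd_mult_iff)
      moreover have "[F ?x * denom v (?x v) ^ d = poly r (?x v)] (mod q)"
        using r(2) xv by (metis fun_upd_triv)
      ultimately have nz: "\<not> q dvd poly r (?x v)"
        by (simp add: cong_dvd_iff)
      have fin: "finite {a \<in> {0..<q}. q dvd poly r a}"
        by (rule finite_subset[of _ "{0..<q}"]) auto
      have "var_range v \<inter> {a. ?f y a} \<subseteq> {a \<in> {0..<q}. q dvd poly r a}"
      proof
        fix a assume a: "a \<in> var_range v \<inter> {a. ?f y a}"
        then have "[F (?x(v := a)) * denom v a ^ d = 0 * denom v a ^ d] (mod q)"
          by (intro cong_mult) auto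
        then have "[poly r a = 0] (mod q)"
          using r(2) a by (metis IntD1 cong_sym cong_trans mult_zero_left)
        then show "a \<in> {a \<in> {0..<q}. q dvd poly r a}"
          using a var_range_props(3)[of v] by (auto simp: cong_0_iff)
      qed
      then have "card (var_range v \<inter> {a. ?f y a}) \<le> degree r"
        using card_mono[OF fin] card_roots_mod_prime[OF prime_p nz] by (meson le_trans)
      then have card: "card (var_range v \<inter> {a. ?f y a}) \<le> 2 * d" using r(1) by simp
      have "measure_pmf.prob (var_pmf v) {a. ?f y a} = card (var_range v \<inter> {a. ?f y a}) / card (var_range v)"
        unfolding var_pmf_def by (rule measure_pmf_of_set) (auto simp: var_range_props)
      also have "\<dots> \<le> real (2 * d) / (p - 1)"
        using card var_range_props(4)[of v] p_gt2 by (intro frac_le) (auto simp: of_nat_diff[symmetric] simp del: of_nat_diff of_nat_mult)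
      finally show ?thesis using False by (simp add: of_nat_diff)
    qed
  qed (auto intro!: measure_pmf.integrable_const_bound[where B = 1] Bochner_Integration.integrable_add)
  also have "\<dots> = measure_pmf.prob (rand_asn V) ?B + (2 * d) / (p - 1)"
    by (subst Bochner_Integration.integral_add) (auto intro!: measure_pmf.integrable_const_bound[where B = 1])
  also have "\<dots> \<le> card V * (2 * d) / (p - 1) + (2 * d) / (p - 1)"
    using insert.IH by simp
  also have "\<dots> = card (insert v V) * (2 * d) / (p - 1)"
    using insert.hyps by (simp add: field_simps add_divide_distrib)
  finally show ?case .
qed

end

section \<open>Encodings consistent with a table\<close>

lemma integral_bind_pmf_finite:
  fixes h :: "'b \<Rightarrow> real"
  assumes "finite (set_pmf M)" "\<And>x. x \<in> set_pmf M \<Longrightarrow> finite (set_pmf (f x))"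
  shows "(\<integral>y. h y \<partial>measure_pmf (bind_pmf M f)) = (\<integral>x. (\<integral>y. h y \<partial>measure_pmf (f x)) \<partial>measure_pmf M)"
proof -
  define f' where "f' x = (if x \<in> set_pmf M then f x else return_pmf undefined)" for x
  have "bind_pmf M f = bind_pmf M f'"
    by (intro bind_pmf_cong) (auto simp: f'_def)
  then have "(\<integral>y. h y \<partial>measure_pmf (bind_pmf M f)) = (\<Sum>a\<in>set_pmf M. pmf M a *\<^sub>R (\<integral>y. h y \<partial>measure_pmf (f' a)))"
    using assms by (simp add: pmf_expectation_bind[of "set_pmf M"] f'_def)
  also have "\<dots> = (\<integral>x. (\<integral>y. h y \<partial>measure_pmf (f' x)) \<partial>measure_pmf M)"
    using assms by (subst integral_measure_pmf[of "set_pmf M"]) auto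
  also have "\<dots> = (\<integral>x. (\<integral>y. h y \<partial>measure_pmf (f x)) \<partial>measure_pmf M)"
    by (intro integral_cong_AE AE_pmfI) (auto simp: f'_def)
  finally show ?thesis .
qed

section \<open>Falling factorials\<close>

primrec falling :: "nat \<Rightarrow> nat \<Rightarrow> nat" where
  "falling n 0 = 1"
| "falling n (Suc k) = n * falling (n - 1) k"

lemma falling_add: "falling n (j + k) = falling n j * falling (n - j) k"
  by (induction j arbitrary: n) auto

lemma falling_Suc2: "falling n (Suc k) = falling n k * (n - k)"
  using falling_add[of n k 1] by simp

lemma falling_mono: "n \<le> n' \<Longrightarrow> falling n k \<le> falling n' k"
  by (induction k arbitrary: n n') (auto intro!: mult_le_mono)

lemma falling_pos: "k \<le> n \<Longrightarrow> 0 < falling n k"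
  by (induction k arbitrary: n) auto

text \<open>Each factor satisfies \<open>n - r - i >= (1 - r / (n - K)) * (n - i)\<close>, because
  \<open>n - i >= n - K\<close>; the product of \<open>k\<close> such factors is estimated as in
  Bernoulli's inequality. The fixed \<open>K\<close> keeps the quotient constant during the
  induction on \<open>k\<close>.\<close>

lemma falling_ratio:
  assumes "k \<le> K" "K < n"
  shows "(1 - real k * (real r / real (n - K))) * falling n k \<le> falling (n - r) k"
  using assms(1)
proof (induction k)
  case (Suc k)
  define a where "a = real r / real (n - K)"
  show ?case
  \<comment> \<open>If \<open>Suc k * a\<close> exceeds 1, the left side is negative and there is
    nothing to show; otherwise all factors are nonnegative and the inequalities may be
    multiplied.\<close>
  proof (cases "real (Suc k) * a \<le> 1 \<and> 0 < r")
    case neg: False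
    show ?thesis
    proof (cases "r = 0")
      case False
      with neg have "1 - real (Suc k) * a < 0" by simp
      then have "(1 - real (Suc k) * a) * falling n (Suc k) \<le> 0"
        by (intro mult_nonpos_nonneg) auto
      also have "0 \<le> real (falling (n - r) (Suc k))" by simp
      finally show ?thesis unfolding a_def .
    qed auto
  next
    case True
    have K: "0 < real (n - K)" "real (n - K) \<le> real (n - k)"
      using assms Suc.prems by auto
    have a: "0 \<le> a" by (simp add: a_def)
    have ka: "real k * a \<le> 1" "a \<le> 1"
      using True a by (auto simp: algebra_simps) (smt (verit) mult_nonneg_nonneg of_nat_0_le_iff)
    have r: "real r = a * real (n - K)" using K by (simp add: a_def)
    have "a * real (n - K) \<le> a * real (n - k)" using K a by (intro mult_left_mono) auto
    then have step: "(1 - a) * real (n - k) \<le> real (n - r - k)"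
      using r Suc.prems assms by (auto simp: algebra_simps of_nat_diff)
    have "(1 - real (Suc k) * a) \<le> (1 - real k * a) * (1 - a)"
      using a by (simp add: algebra_simps)
    then have "(1 - real (Suc k) * a) * falling n (Suc k) \<le> (1 - real k * a) * (1 - a) * (falling n k * real (n - k))"
      unfolding falling_Suc2 of_nat_mult by (intro mult_right_mono) auto
    also have "\<dots> = ((1 - real k * a) * falling n k) * ((1 - a) * real (n - k))" by simp
    also have "\<dots> \<le> falling (n - r) k * real (n - r - k)"
      using Suc step ka a by (intro mult_mono) (auto simp: a_def)
    also have "\<dots> = falling (n - r) (Suc k)" unfolding falling_Suc2 by simp
    finally show ?thesis unfolding a_def .
  qed
qed auto

datatype grp = Src | Tgt

lemma UNIV_grp: "UNIV = {Src, Tgt}"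
  using grp.exhaust by auto

instance grp :: finite
  by standard (simp add: UNIV_grp)

type_synonym enc = "int \<Rightarrow> bits"
type_synonym tab = "grp \<Rightarrow> (elt \<times> bits) set"

context bilinear
begin

section \<open>Counting injective encodings\<close>

definition words :: "bits set" where "words = {w. length w = m}"

lemma card_words: "card words = 2 ^ m"
  using card_lists_length_eq[of "UNIV :: bool set" m] by (simp add: words_def)

lemma finite_words [simp]: "finite words"
  using card_words by (metis card.infinite power_not_zero zero_neq_numeral)

definition encs :: "enc set" where
  "encs = {\<psi> \<in> {0..<q} \<rightarrow>\<^sub>E words. inj_on \<psi> {0..<q}}"

lemma finite_encs [simp]: "finite encs"
  unfolding encs_def by (rule finite_subset[of _ "{0..<q} \<rightarrow>\<^sub>E words"]) (auto intro!: finite_PiE)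

text \<open>\<open>D\<close> stands for the values of the encoding revealed so far, \<open>R\<close>
  for strings that were submitted and refused, hence are known to encode nothing.\<close>

definition encs_through :: "(int \<times> bits) set \<Rightarrow> bits set \<Rightarrow> enc set" where
  "encs_through D R = {\<psi> \<in> encs. (\<forall>(v, w)\<in>D. \<psi> v = w) \<and> (\<forall>v\<in>{0..<q}. \<psi> v \<notin> R)}"

text \<open>Induction on the number \<open>j\<close> of undetermined exponents: one of them may
  receive any string outside \<open>R\<close> and outside the strings of \<open>D\<close>. For
  \<open>j = 0\<close> the set \<open>D\<close> is the graph of exactly one encoding.\<close>

lemma card_encs_through:
  assumes "finite D" "inj_on fst D" "inj_on snd D" "fst ` D \<subseteq> {0..<q}" "snd ` D \<subseteq> words - R"
    "R \<subseteq> words" "card D + j = p"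
  shows "card (encs_through D R) = falling (2 ^ m - card R - card D) j"
  using assms
proof (induction j arbitrary: D)
  case 0
  have "card (fst ` D) = card {0..<q}"
    using 0 by (simp add: card_image)
  then have D: "fst ` D = {0..<q}"
    using 0 by (intro card_subset_eq) auto
  define \<psi> where "\<psi> v = (if v \<in> {0..<q} then (SOME w. (v, w) \<in> D) else undefined)" for v
  have psi: "(v, \<psi> v) \<in> D" if "v \<in> {0..<q}" for v
  proof -
    from that obtain z where "z \<in> D" "v = fst z" using D by (metis imageE)
    then have "(v, snd z) \<in> D" by simp
    then have "(v, SOME w. (v, w) \<in> D) \<in> D" by (rule someI)
    then show ?thesis using that by (simp add: \<psi>_def)
  qed
  have uniq: "w = \<psi> v" if "(v, w) \<in> D" for v w
    using psi[of v] that D inj_onD[OF 0(2), of "(v, w)" "(v, \<psi> v)"] by force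
  have "\<psi> \<in> encs_through D R"
    unfolding encs_through_def encs_def
  proof (intro CollectI conjI PiE_I inj_onI)
    show "\<psi> v \<in> words" if "v \<in> {0..<q}" for v using psi[OF that] 0(5) by force
    show "\<psi> v = undefined" if "v \<notin> {0..<q}" for v using that by (auto simp: \<psi>_def)
    show "v = v'" if "v \<in> {0..<q}" "v' \<in> {0..<q}" "\<psi> v = \<psi> v'" for v v'
      using psi[OF that(1)] psi[OF that(2)] that(3) inj_onD[OF 0(3), of "(v, \<psi> v)" "(v', \<psi> v')"]
      by (metis prod.inject snd_conv)
    show "\<forall>(v, w)\<in>D. \<psi> v = w" using uniq by auto
    show "\<forall>v\<in>{0..<q}. \<psi> v \<notin> R" using psi 0(5) by force
  qed
  moreover have "\<phi> = \<psi>" if "\<phi> \<in> encs_through D R" for \<phi>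
  proof
    fix v
    show "\<phi> v = \<psi> v"
    proof (cases "v \<in> {0..<q}")
      case True
      then show ?thesis using that psi[OF True] by (auto simp: encs_through_def)
    next
      case False
      then show ?thesis using that by (auto simp: encs_through_def encs_def \<psi>_def PiE_def extensional_def)
    qed
  qed
  ultimately have "encs_through D R = {\<psi>}" by blast
  then show ?case by simp
next
  case (Suc j)
  have "card (fst ` D) < card {0..<q}"
    using Suc.prems by (simp add: card_image)
  then obtain v where v: "v \<in> {0..<q}" "v \<notin> fst ` D"
    by (meson card_mono finite_imageI leD subsetI Suc.prems(1))
  define W where "W = words - R - snd ` D"
  have encs_through: "encs_through D R = (\<Union>w\<in>W. encs_through (insert (v, w) D) R)"
  proof safe
    fix \<psi> assume psi: "\<psi> \<in> encs_through D R"
    have "\<psi> v \<notin> snd ` D"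
    proof
      assume "\<psi> v \<in> snd ` D"
      then obtain v' where v': "(v', \<psi> v) \<in> D" by force
      then have "\<psi> v' = \<psi> v" using psi by (auto simp: encs_through_def)
      moreover have "v' \<in> {0..<q}" using v' Suc.prems(4) by force
      ultimately have "v' = v" using psi v by (auto simp: encs_through_def encs_def inj_on_def)
      then show False using v v' by force
    qed
    moreover have "\<psi> v \<in> words - R" using psi v by (auto simp: encs_through_def encs_def)
    ultimately show "\<psi> \<in> (\<Union>w\<in>W. encs_through (insert (v, w) D) R)"
      using psi by (intro UN_I[of "\<psi> v"]) (auto simp: encs_through_def W_def)
  qed (auto simp: encs_through_def)
  have finPE: "finite (encs_through E R)" for E
    by (rule finite_subset[OF _ finite_encs]) (auto simp: encs_through_def)
  have "card (encs_through D R) = (\<Sum>w\<in>W. card (encs_through (insert (v, w) D) R))"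
    unfolding encs_through by (rule card_UN_disjoint) (auto simp: W_def finPE, auto simp: encs_through_def)
  also have "\<dots> = (\<Sum>w\<in>W. falling (2 ^ m - card R - Suc (card D)) j)"
  proof (intro sum.cong refl)
    fix w assume w: "w \<in> W"
    have notin: "(v, w) \<notin> D" using v by force
    have "card (encs_through (insert (v, w) D) R) = falling (2 ^ m - card R - card (insert (v, w) D)) j"
      using w v Suc.prems notin by (intro Suc.IH) (auto simp: W_def)
    then show "card (encs_through (insert (v, w) D) R) = falling (2 ^ m - card R - Suc (card D)) j"
      using Suc.prems notin by simp
  qed
  also have "card W = 2 ^ m - card R - card D"
  proof -
    have "card W = card (words - R) - card (snd ` D)"
      unfolding W_def using Suc.prems by (intro card_Diff_subset) auto
    also have "\<dots> = 2 ^ m - card R - card D"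
      using Suc.prems by (simp add: card_Diff_subset finite_subset[OF Suc.prems(6)] card_words card_image)
    finally show ?thesis .
  qed
  ultimately show ?case by simp
qed

text \<open>Equality is tested only on \<open>asns\<close>, where every \<beta> is invertible;
  elsewhere \<open>modular_inverse\<close> need not behave like an inverse.\<close>

definition elt_eq :: "elt \<Rightarrow> elt \<Rightarrow> bool" where
  "elt_eq f f' \<longleftrightarrow> (\<forall>x\<in>asns. f x = f' x)"

lemma elt_eq_refl [simp]: "elt_eq f f"
  by (simp add: elt_eq_def)

lemma elt_eq_sym: "elt_eq f f' \<Longrightarrow> elt_eq f' f"
  by (simp add: elt_eq_def)

definition consistent1 :: "(elt \<times> bits) set \<Rightarrow> bits set \<Rightarrow> asn \<Rightarrow> enc set" where
  "consistent1 T R x = encs_through ((\<lambda>(f, w). (f x, w)) ` T) R"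

definition consistent :: "tab \<Rightarrow> (grp \<Rightarrow> bits set) \<Rightarrow> asn \<Rightarrow> (grp \<Rightarrow> enc) set" where
  "consistent T R x = {\<Psi>. \<forall>g. \<Psi> g \<in> consistent1 (T g) (R g) x}"

lemma card_consistent: "card (consistent T R x) = (\<Prod>g\<in>UNIV. card (consistent1 (T g) (R g) x))"
proof -
  have "consistent T R x = (\<Pi>\<^sub>E g\<in>UNIV. consistent1 (T g) (R g) x)"
    by (auto simp: consistent_def PiE_def Pi_def)
  then show ?thesis by (simp add: card_PiE)
qed

lemma finite_consistent [simp]: "finite (consistent T R x)"
proof -
  have fin: "finite (consistent1 (T g) (R g) x)" for g
    by (rule finite_subset[OF _ finite_encs]) (auto simp: consistent1_def encs_through_def)
  have "consistent T R x = (\<Pi>\<^sub>E g\<in>UNIV. consistent1 (T g) (R g) x)"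
    by (auto simp: consistent_def PiE_def Pi_def)
  then show ?thesis by (simp add: finite_PiE fin)
qed

lemma consistentD:
  assumes "\<Psi> \<in> consistent T R x"
  shows "\<Psi> g \<in> encs" "(f, w) \<in> T g \<Longrightarrow> \<Psi> g (f x) = w" "v \<in> {0..<q} \<Longrightarrow> \<Psi> g v \<notin> R g"
proof -
  have "\<Psi> g \<in> consistent1 (T g) (R g) x" using assms by (simp add: consistent_def)
  then show "\<Psi> g \<in> encs" "(f, w) \<in> T g \<Longrightarrow> \<Psi> g (f x) = w" "v \<in> {0..<q} \<Longrightarrow> \<Psi> g v \<notin> R g"
    by (auto simp: consistent1_def encs_through_def)
qed

lemma consistentI:
  assumes "\<And>g. \<Psi> g \<in> encs" "\<And>g f w. (f, w) \<in> T g \<Longrightarrow> \<Psi> g (f x) = w" "\<And>g v. v \<in> {0..<q} \<Longrightarrow> \<Psi> g v \<notin> R g"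
  shows "\<Psi> \<in> consistent T R x"
proof -
  have "\<Psi> g \<in> consistent1 (T g) (R g) x" for g
    using assms(1)[of g] assms(2)[of _ _ g] assms(3)[of _ g] by (auto simp: consistent1_def encs_through_def)
  then show ?thesis by (simp add: consistent_def)
qed

lemma consistent_antimono:
  assumes "\<And>g. T g \<subseteq> T' g" "\<And>g. R g \<subseteq> R' g"
  shows "consistent T' R' x \<subseteq> consistent T R x"
proof
  fix \<Psi> assume \<Psi>: "\<Psi> \<in> consistent T' R' x"
  show "\<Psi> \<in> consistent T R x"
  proof (rule consistentI)
    show "\<Psi> g \<in> encs" for g by (rule consistentD[OF \<Psi>])
    show "\<Psi> g (f x) = w" if "(f, w) \<in> T g" for g f w
      using consistentD(2)[OF \<Psi>, of f w g] assms(1)[of g] that by blast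
    show "\<Psi> g v \<notin> R g" if "v \<in> {0..<q}" for g v
      using consistentD(3)[OF \<Psi> that, of g] assms(2)[of g] by blast
  qed
qed

definition separated :: "(elt \<times> bits) set \<Rightarrow> bool" where
  "separated S \<longleftrightarrow> (\<forall>f w f' w'. (f, w) \<in> S \<longrightarrow> (f', w') \<in> S \<longrightarrow> elt_eq f f' \<longrightarrow> w = w')"

text \<open>Such a table is what a purely symbolic experiment would show: one string per function,
  distinct strings for distinct functions. Whether two distinct functions coincide at the actual
  secrets is left to \<open>collision\<close>.\<close>

definition table_ok :: "tab \<Rightarrow> (grp \<Rightarrow> bits set) \<Rightarrow> bool" where
  "table_ok T R \<longleftrightarrow> (\<forall>g. finite (T g) \<and> R g \<subseteq> words \<and> snd ` T g \<subseteq> words - R g \<and> inj_on snd (T g) \<and> separated (T g))"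

lemma table_okD:
  assumes "table_ok T R"
  shows "finite (T g)" "R g \<subseteq> words" "snd ` T g \<subseteq> words - R g" "inj_on snd (T g)" "separated (T g)"
  using assms[unfolded table_ok_def, THEN spec[of _ g]] by simp_all

lemma separatedD: "separated S \<Longrightarrow> (f, w) \<in> S \<Longrightarrow> (f', w') \<in> S \<Longrightarrow> elt_eq f f' \<Longrightarrow> w = w'"
  unfolding separated_def by blast

text \<open>
  The product of the sizes \<open>N - r - i\<close>, \<open>i < k\<close>, of the sets from which the \<open>k\<close> strings of the
  table are drawn when \<open>r\<close> strings are excluded.  It is defined with the final \<open>r\<close>, which makes it
  decrease when a string is refused, so that inequalities point in the direction needed below.
\<close>

definition normalizer :: "tab \<Rightarrow> (grp \<Rightarrow> bits set) \<Rightarrow> real" where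
  "normalizer T R = (\<Prod>g\<in>UNIV. real (falling (2 ^ m - card (R g)) (card (T g))) / real (falling (2 ^ m) p))"

text \<open>The real probability of the transcript so far together with outcome \<open>e\<close>,
  divided by the probability that the ideal experiment draws the same strings. The sum over
  encodings times \<open>1 / falling (2 ^ m) p\<close> per group is the former, the remaining part
  of \<open>normalizer\<close> the inverse of the latter.\<close>

definition weight where
  "weight ex V T R \<Phi> e = normalizer T R * (\<integral>x. (\<Sum>\<Psi>\<in>consistent T R (ex x). pmf (\<Phi> x \<Psi>) e) \<partial>measure_pmf (rand_asn V))"

text \<open>
  The real experiment with hidden bit \<open>b\<close>, restricted to the secrets and encodings consistent with
  the table and suitably normalised, outputs \<open>True\<close> and \<open>False\<close> at least as often as some ideal
  experiment, up to the factor \<open>1 - \<epsilon>\<close>.  The point is that \<open>w\<close> does not depend on \<open>b\<close>.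
\<close>

definition simulable :: "real \<Rightarrow> (bool \<Rightarrow> asn \<Rightarrow> asn) \<Rightarrow> var set \<Rightarrow> tab \<Rightarrow> (grp \<Rightarrow> bits set) \<Rightarrow>
    (bool \<Rightarrow> asn \<Rightarrow> (grp \<Rightarrow> enc) \<Rightarrow> bool pmf) \<Rightarrow> bool" where
  "simulable \<epsilon> ex V T R \<Phi> \<longleftrightarrow> (\<exists>w\<in>{0..1}. \<forall>b e. (1 - \<epsilon>) * (if e then w else 1 - w) \<le> weight (ex b) V T R (\<Phi> b) e)"

section \<open>Rules for establishing \<open>simulable\<close>\<close>

lemma normalizer_nonneg: "0 \<le> normalizer T R"
  unfolding normalizer_def by (intro prod_nonneg) auto

lemma finite_rand_asn: "finite V \<Longrightarrow> finite (set_pmf (rand_asn V))"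
  unfolding rand_asn_def by (subst set_Pi_pmf) (auto intro!: finite_PiE_dflt simp: var_range_props)

lemma integrable_rand_asn: "finite V \<Longrightarrow> integrable (measure_pmf (rand_asn V)) (h :: asn \<Rightarrow> real)"
  by (intro integrable_measure_pmf_finite finite_rand_asn)

lemma simulable_cong:
  assumes "\<And>b x \<Psi>. x \<in> set_pmf (rand_asn V) \<Longrightarrow> \<Psi> \<in> consistent T R (ex b x) \<Longrightarrow> \<Phi> b x \<Psi> = \<Phi>' b x \<Psi>"
    and "simulable \<epsilon> ex V T R \<Phi>'"
  shows "simulable \<epsilon> ex V T R \<Phi>"
proof -
  have "weight (ex b) V T R (\<Phi> b) e = weight (ex b) V T R (\<Phi>' b) e" for b e
    unfolding weight_def using assms(1)
    by (intro arg_cong[where f = "\<lambda>t. normalizer T R * t"] integral_cong_AE AE_pmfI) auto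
  then show ?thesis using assms(2) by (simp add: simulable_def)
qed

text \<open>\<open>weight\<close> is linear in the distribution of the outcome, so the ideal
  probabilities for the two values of the coin can be averaged; the average is again the same for
  both hidden bits.\<close>

lemma simulable_coin:
  assumes "finite V" "\<And>c. simulable \<epsilon> ex V T R (\<Phi> c)"
  shows "simulable \<epsilon> ex V T R (\<lambda>b x \<Psi>. bernoulli_pmf (1 / 2) \<bind> (\<lambda>c. \<Phi> c b x \<Psi>))"
proof -
  have "\<forall>c. \<exists>w\<in>{0..1}. \<forall>b e. (1 - \<epsilon>) * (if e then w else 1 - w) \<le> weight (ex b) V T R (\<Phi> c b) e"
    using assms(2) unfolding simulable_def by blast
  then obtain w where w: "\<And>c. w c \<in> {0..1}"
    "\<And>c b e. (1 - \<epsilon>) * (if e then w c else 1 - w c) \<le> weight (ex b) V T R (\<Phi> c b) e"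
    by metis
  have Z: "weight (ex b) V T R (\<lambda>x \<Psi>. bernoulli_pmf (1 / 2) \<bind> (\<lambda>c. \<Phi> c b x \<Psi>)) e =
      (weight (ex b) V T R (\<Phi> True b) e + weight (ex b) V T R (\<Phi> False b) e) / 2" for b e
    unfolding weight_def pmf_bind
    by (simp add: sum.distrib sum_divide_distrib[symmetric] integrable_rand_asn[OF assms(1)] distrib_left add_divide_distrib)
  show ?thesis
    unfolding simulable_def
  proof (intro bexI[of _ "(w True + w False) / 2"] allI)
    fix b e
    show "(1 - \<epsilon>) * (if e then (w True + w False) / 2 else 1 - (w True + w False) / 2)
        \<le> weight (ex b) V T R (\<lambda>x \<Psi>. bernoulli_pmf (1 / 2) \<bind> (\<lambda>c. \<Phi> c b x \<Psi>)) e"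
      unfolding Z using w(2)[of e True b] w(2)[of e False b]
      by (cases e) (simp_all add: field_simps)
  qed (use w(1)[of True] w(1)[of False] in auto)
qed

text \<open>Deferred sampling: secrets on which no table entry depends do not influence the set of
  consistent encodings, so they may be drawn at the moment of their use. The map \<open>ex\<close>
  may change at the same time, as it does at the challenge, provided that the entries keep their
  values.\<close>

lemma simulable_fresh:
  assumes "finite V" "finite V'" "V \<inter> V' = {}"
    and T: "\<And>b g f w x y. (f, w) \<in> T g \<Longrightarrow> f (ex' b (override_on x y V')) = f (ex b x)"
    and simulable: "simulable \<epsilon> ex' (V \<union> V') T R \<Phi>'"
  shows "simulable \<epsilon> ex V T R (\<lambda>b x \<Psi>. rand_asn V' \<bind> (\<lambda>y. \<Phi>' b (override_on x y V') \<Psi>))"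
proof -
  have consistent: "consistent T R (ex' b (override_on x y V')) = consistent T R (ex b x)" for b x y
  proof -
    have "(\<lambda>(f, w). (f (ex' b (override_on x y V')), w)) ` T g = (\<lambda>(f, w). (f (ex b x), w)) ` T g" for g
      using T by (intro image_cong) auto
    then show ?thesis by (simp add: consistent_def consistent1_def)
  qed
  have "weight (ex b) V T R (\<lambda>x \<Psi>. rand_asn V' \<bind> (\<lambda>y. \<Phi>' b (override_on x y V') \<Psi>)) e =
      weight (ex' b) (V \<union> V') T R (\<Phi>' b) e" for b e
    unfolding weight_def rand_asn_union[OF assms(1-3)] pmf_bind
    using assms(1,2)
    by (subst integral_bind_pmf_finite, simp add: finite_rand_asn, simp add: finite_rand_asn)
       (subst integral_bind_pmf_finite, simp add: finite_rand_asn, simp add: finite_rand_asn,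
        simp add: consistent integrable_rand_asn)
  then show ?thesis using simulable unfolding simulable_def by simp
qed

text \<open>The encodings that do use \<open>u\<close> are discarded. This only decreases the sum of
  nonnegative terms, and \<open>normalizer\<close> decreases too because \<open>falling\<close> is
  monotone in its first argument. The price appears in \<open>simulable_base\<close> through the
  size of \<open>R\<close>.\<close>

lemma simulable_refuse:
  assumes "table_ok T R" "u \<in> words" "u \<notin> snd ` T g" "finite V"
    and simulable: "simulable \<epsilon> ex V T (R(g := insert u (R g))) \<Phi>" and "\<epsilon> \<le> 1"
  shows "simulable \<epsilon> ex V T R \<Phi>"
proof -
  let ?R = "R(g := insert u (R g))"
  have "card (R h) \<le> card (?R h)" for h
  proof (intro card_mono)
    have "R h' \<subseteq> words" for h' by (rule table_okD[OF assms(1)])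
    then show "finite (?R h)" using finite_subset[OF _ finite_words] by simp
  qed auto
  then have normalizer: "normalizer T ?R \<le> normalizer T R"
    unfolding normalizer_def by (intro prod_mono conjI divide_right_mono) (auto intro!: falling_mono diff_le_mono2 simp del: fun_upd_apply)
  have consistent: "consistent T ?R x \<subseteq> consistent T R x" for x
    by (rule consistent_antimono) auto
  have "weight (ex b) V T ?R (\<Phi> b) e \<le> weight (ex b) V T R (\<Phi> b) e" for b e
    unfolding weight_def
    by (intro mult_mono normalizer normalizer_nonneg integral_mono_AE AE_pmfI integrable_rand_asn assms sum_mono2 consistent finite_consistent
        integral_nonneg_AE sum_nonneg) auto
  then show ?thesis using simulable unfolding simulable_def by (meson order_trans)
qed

text \<open>Reveals the string of one element \<open>f\<close>. If \<open>f\<close> equals an entry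
  as a function, the string is forced. Otherwise only the strings that are neither refused nor in
  use are kept, which discards the encodings where \<open>f\<close> accidentally meets an entry.
  Each kept string multiplies \<open>normalizer\<close> by their number, so the weight is at least
  the average over them, and the average of the ideal probabilities does not depend on the hidden
  bit.\<close>

lemma simulable_insert:
  assumes ok: "table_ok T R" and V: "finite V"
    and f: "\<And>b x. x \<in> asns \<Longrightarrow> ex b x \<in> asns" "\<And>x. x \<in> asns \<Longrightarrow> f x \<in> {0..<q}"
    and room: "card (R g) + card (T g) < 2 ^ m"
    and old: "\<And>f' w. (f', w) \<in> T g \<Longrightarrow> elt_eq f f' \<Longrightarrow> simulable \<epsilon> ex V T R (\<Phi> w)"
    and new: "\<And>w. w \<in> words - R g - snd ` T g \<Longrightarrow> table_ok (T(g := insert (f, w) (T g))) R \<Longrightarrow>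
      (f, w) \<notin> T g \<Longrightarrow> simulable \<epsilon> ex V (T(g := insert (f, w) (T g))) R (\<Phi> w)"
  shows "simulable \<epsilon> ex V T R (\<lambda>b x \<Psi>. \<Phi> (\<Psi> g (f (ex b x))) b x \<Psi>)"
proof (cases "\<exists>(f', w)\<in>T g. elt_eq f f'")
  case True
  then obtain f' w where fw: "(f', w) \<in> T g" "elt_eq f f'" by auto
  have eq: "\<Psi> g (f (ex b x)) = w" if "x \<in> set_pmf (rand_asn V)" "\<Psi> \<in> consistent T R (ex b x)" for b x \<Psi>
  proof -
    have "\<Psi> g (f' (ex b x)) = w" by (rule consistentD(2)[OF that(2) fw(1)])
    moreover have "f (ex b x) = f' (ex b x)"
      using fw(2) f(1)[OF rand_asn_asns[OF V that(1)]] unfolding elt_eq_def by blast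
    ultimately show ?thesis by simp
  qed
  show ?thesis
    by (rule simulable_cong[OF _ old[OF fw]]) (simp only: eq)
next
  case False
  define W where "W = words - R g - snd ` T g"
  let ?T = "\<lambda>w. T(g := insert (f, w) (T g))"
  have fin: "finite (T h)" "R h \<subseteq> words" "snd ` T h \<subseteq> words - R h" "inj_on snd (T h)" for h
    by (rule table_okD[OF ok])+
  have "card W = card (words - R g) - card (snd ` T g)"
    unfolding W_def using fin by (intro card_Diff_subset) auto
  also have "\<dots> = 2 ^ m - card (R g) - card (T g)"
    using fin by (simp add: card_Diff_subset finite_subset[OF fin(2)] card_words card_image)
  finally have cardW: "card W = 2 ^ m - card (R g) - card (T g)" .
  then have Wpos: "0 < card W" using room by simp
  have finW: "finite W" by (simp add: W_def)
  have notin: "(f, w) \<notin> T g" for w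
    using False elt_eq_refl by blast
  have okw: "table_ok (?T w) R" if w: "w \<in> W" for w
  proof -
    have sep: "separated (?T w h)" for h
      unfolding separated_def
    proof (intro allI impI)
      fix f1 w1 f2 w2 assume that: "(f1, w1) \<in> ?T w h" "(f2, w2) \<in> ?T w h" "elt_eq f1 f2"
      have nf: "\<not> elt_eq f f'" "\<not> elt_eq f' f" if "(f', w') \<in> T g" for f' w'
        using False that elt_eq_sym by blast+
      have old: "w1 = w2" if "(f1, w1) \<in> T h" "(f2, w2) \<in> T h"
        using separatedD[OF table_okD(5)[OF ok] that \<open>elt_eq f1 f2\<close>] .
      show "w1 = w2"
      proof (cases "h = g")
        case True
        have 1: "(f1, w1) = (f, w) \<or> (f1, w1) \<in> T g" and 2: "(f2, w2) = (f, w) \<or> (f2, w2) \<in> T g"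
          using that(1,2) True by simp_all
        show "w1 = w2"
          using 1
        proof
          assume 1: "(f1, w1) = (f, w)"
          show "w1 = w2" using 2 nf(1)[of f2 w2] that(3) 1 by auto
        next
          assume 1: "(f1, w1) \<in> T g"
          show "w1 = w2" using 2 nf(2)[of f1 w1] that(3) 1 old True by auto
        qed
      next
        case False
        then show "w1 = w2" using that(1,2) old by simp
      qed
    qed
    have "inj_on snd (insert (f, w) (T g))"
      using fin(4)[of g] w by (force simp: W_def inj_on_def)
    moreover have "snd ` insert (f, w) (T g) \<subseteq> words - R g"
      using fin(3)[of g] w unfolding W_def by force
    moreover have "finite (?T w h)" for h using fin(1) by simp
    moreover have "snd ` ?T w h \<subseteq> words - R h" "inj_on snd (?T w h)" for h
      using calculation fin(3)[of h] fin(4)[of h] by (cases "h = g"; simp)+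
    ultimately show ?thesis
      unfolding table_ok_def using fin(2) sep by simp
  qed
  have "\<exists>u\<in>{0..1}. \<forall>b e. (1 - \<epsilon>) * (if e then u else 1 - u) \<le> weight (ex b) V (?T w) R (\<Phi> w b) e" if "w \<in> W" for w
    using new[OF _ okw[OF that] notin] that unfolding simulable_def W_def by blast
  then obtain u where u: "\<And>w. w \<in> W \<Longrightarrow> u w \<in> {0..1}"
    "\<And>w b e. w \<in> W \<Longrightarrow> (1 - \<epsilon>) * (if e then u w else 1 - u w) \<le> weight (ex b) V (?T w) R (\<Phi> w b) e"
    by metis
  have normalizer: "normalizer (?T w) R = normalizer T R * card W" if "w \<in> W" for w
  proof -
    have "card (?T w g) = Suc (card (T g))" "\<And>h. h \<noteq> g \<Longrightarrow> ?T w h = T h"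
      using notin fin by auto
    then show ?thesis
      unfolding normalizer_def UNIV_grp by (cases g) (simp_all add: falling_Suc2 cardW del: falling.simps)
  qed
  have split: "(\<Sum>\<Psi>\<in>consistent T R (ex b x). pmf (\<Phi> (\<Psi> g (f (ex b x))) b x \<Psi>) e) \<ge>
      (\<Sum>w\<in>W. \<Sum>\<Psi>\<in>consistent (?T w) R (ex b x). pmf (\<Phi> w b x \<Psi>) e)" for b x e
  proof -
    let ?h = "\<lambda>\<Psi>. pmf (\<Phi> (\<Psi> g (f (ex b x))) b x \<Psi>) e"
    have in_new: "\<Psi> \<in> consistent T R (ex b x) \<and> \<Psi> g (f (ex b x)) = w" if "\<Psi> \<in> consistent (?T w) R (ex b x)" for w \<Psi>
    proof
      show "\<Psi> \<in> consistent T R (ex b x)"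
        using that by (rule rev_subsetD) (rule consistent_antimono; auto)
      show "\<Psi> g (f (ex b x)) = w"
        by (rule consistentD(2)[OF that]) simp
    qed
    have "(\<Sum>w\<in>W. \<Sum>\<Psi>\<in>consistent (?T w) R (ex b x). pmf (\<Phi> w b x \<Psi>) e) =
        (\<Sum>w\<in>W. \<Sum>\<Psi>\<in>consistent (?T w) R (ex b x). ?h \<Psi>)"
    proof (intro sum.cong refl)
      fix w \<Psi> assume "\<Psi> \<in> consistent (?T w) R (ex b x)"
      then show "pmf (\<Phi> w b x \<Psi>) e = ?h \<Psi>" using in_new[of \<Psi> w] by simp
    qed
    also have "\<dots> = sum ?h (\<Union>w\<in>W. consistent (?T w) R (ex b x))"
      proof (rule sum.UNION_disjoint[symmetric])
      show "\<forall>w\<in>W. \<forall>w'\<in>W. w \<noteq> w' \<longrightarrow> consistent (?T w) R (ex b x) \<inter> consistent (?T w') R (ex b x) = {}"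
        using in_new by blast
    qed (use finW in simp_all)
    also have "\<dots> \<le> sum ?h (consistent T R (ex b x))"
    proof (intro sum_mono2)
      show "(\<Union>w\<in>W. consistent (?T w) R (ex b x)) \<subseteq> consistent T R (ex b x)" using in_new by blast
    qed auto
    finally show ?thesis .
  qed
  have Z: "(\<Sum>w\<in>W. weight (ex b) V (?T w) R (\<Phi> w b) e) / card W
      \<le> weight (ex b) V T R (\<lambda>x \<Psi>. \<Phi> (\<Psi> g (f (ex b x))) b x \<Psi>) e" for b e
  proof -
    have "(\<Sum>w\<in>W. weight (ex b) V (?T w) R (\<Phi> w b) e) =
        (\<Sum>w\<in>W. normalizer T R * card W * (\<integral>x. (\<Sum>\<Psi>\<in>consistent (?T w) R (ex b x). pmf (\<Phi> w b x \<Psi>) e) \<partial>measure_pmf (rand_asn V)))"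
      unfolding weight_def by (intro sum.cong refl) (simp add: normalizer)
    also have "\<dots> = card W * (normalizer T R * (\<integral>x. (\<Sum>w\<in>W. \<Sum>\<Psi>\<in>consistent (?T w) R (ex b x). pmf (\<Phi> w b x \<Psi>) e) \<partial>measure_pmf (rand_asn V)))"
      by (subst Bochner_Integration.integral_sum) (auto simp: integrable_rand_asn V sum_distrib_left mult_ac)
    finally have "(\<Sum>w\<in>W. weight (ex b) V (?T w) R (\<Phi> w b) e) / card W =
        normalizer T R * (\<integral>x. (\<Sum>w\<in>W. \<Sum>\<Psi>\<in>consistent (?T w) R (ex b x). pmf (\<Phi> w b x \<Psi>) e) \<partial>measure_pmf (rand_asn V))"
      using Wpos by simp
    also have "\<dots> \<le> weight (ex b) V T R (\<lambda>x \<Psi>. \<Phi> (\<Psi> g (f (ex b x))) b x \<Psi>) e"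
      unfolding weight_def
      by (rule mult_left_mono[OF integral_mono_AE normalizer_nonneg]) (rule integrable_rand_asn[OF V], rule integrable_rand_asn[OF V], rule AE_pmfI, rule split)
    finally show ?thesis .
  qed
  show ?thesis
    unfolding simulable_def
  proof (intro bexI[of _ "(\<Sum>w\<in>W. u w) / card W"] allI)
    have "0 \<le> (\<Sum>w\<in>W. u w)" "(\<Sum>w\<in>W. u w) \<le> (\<Sum>w\<in>W. 1)"
      using u(1) by (auto intro!: sum_nonneg sum_mono simp del: sum_constant)
    then show "(\<Sum>w\<in>W. u w) / card W \<in> {0..1}" using Wpos by simp
    fix b e
    have "(1 - \<epsilon>) * (if e then (\<Sum>w\<in>W. u w) / card W else 1 - (\<Sum>w\<in>W. u w) / card W) =
        (\<Sum>w\<in>W. (1 - \<epsilon>) * (if e then u w else 1 - u w)) / card W"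
      using Wpos by (cases e) (simp_all only: if_True if_False sum_distrib_left[symmetric] sum_subtractf,
        simp_all add: field_simps)
    also have "\<dots> \<le> (\<Sum>w\<in>W. weight (ex b) V (?T w) R (\<Phi> w b) e) / card W"
      using u(2) by (intro divide_right_mono sum_mono) auto
    also note Z
    finally show "(1 - \<epsilon>) * (if e then (\<Sum>w\<in>W. u w) / card W else 1 - (\<Sum>w\<in>W. u w) / card W)
        \<le> weight (ex b) V T R (\<lambda>x \<Psi>. \<Phi> (\<Psi> g (f (ex b x))) b x \<Psi>) e" .
  qed
qed

lemma table_ok_refuse: "table_ok T R \<Longrightarrow> u \<in> words \<Longrightarrow> u \<notin> snd ` T g \<Longrightarrow> table_ok T (R(g := insert u (R g)))"
proof -
  assume a: "table_ok T R" "u \<in> words" "u \<notin> snd ` T g"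
  have *: "(R(g := insert u (R g))) h \<subseteq> words" "snd ` T h \<subseteq> words - (R(g := insert u (R g))) h" for h
    using table_okD(2,3)[OF a(1), of h] a(2,3) by (cases "h = g"; simp; blast)+
  show ?thesis
    unfolding table_ok_def by (intro allI conjI * table_okD[OF a(1)])
qed

definition collision :: "tab \<Rightarrow> asn \<Rightarrow> bool" where
  "collision T x \<longleftrightarrow> (\<exists>g. \<exists>(f, w)\<in>T g. \<exists>(f', w')\<in>T g. w \<noteq> w' \<and> f x = f' x)"

text \<open>The place where all discarded parts are paid for. Without a collision the number of
  consistent encodings is exact, and by \<open>falling_add\<close> its product with
  \<open>normalizer\<close> no longer depends on the size of the table: only
  \<open>falling (2 ^ m - card (R g)) p / falling (2 ^ m) p\<close> remains for each group, which is
  at least \<open>1 - a\<close>. The total is at least \<open>(1 - \<delta>) * (1 - a) ^ 2\<close>,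
  hence at least \<open>1 - \<delta> - 2 * a\<close>. Since the outcome is fixed, the ideal
  probability is 0 or 1.\<close>

lemma simulable_base:
  assumes ok: "table_ok T R" and V: "finite V"
    and ex: "\<And>b x. x \<in> asns \<Longrightarrow> ex b x \<in> asns"
    and rg: "\<And>g f w x. (f, w) \<in> T g \<Longrightarrow> x \<in> asns \<Longrightarrow> f x \<in> {0..<q}"
    and \<delta>: "\<And>b. measure_pmf.prob (rand_asn V) {x. collision T (ex b x)} \<le> \<delta>"
    and s: "\<And>g. card (R g) \<le> s" "\<And>g. card (T g) \<le> p" 
    and \<epsilon>: "\<delta> + 2 * (real p * (real s / real (2 ^ m - p))) \<le> \<epsilon>" "\<epsilon> \<le> 1" "p < 2 ^ m"
  shows "simulable \<epsilon> ex V T R (\<lambda>b x \<Psi>. return_pmf c)"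
proof -
  define a where "a = real p * (real s / real (2 ^ m - p))"
  have fin: "finite (T h)" "R h \<subseteq> words" "snd ` T h \<subseteq> words - R h" "inj_on snd (T h)" for h
    by (rule table_okD[OF ok])+
  let ?P = "\<lambda>g. real (falling (2 ^ m - card (R g) - card (T g)) (p - card (T g)))"
  have card: "card (consistent T R (ex b x)) = (\<Prod>g\<in>UNIV. ?P g)" if "x \<in> asns" "\<not> collision T (ex b x)" for b x
    unfolding card_consistent of_nat_prod
  proof (intro prod.cong refl arg_cong[where f = real])
    fix g
    let ?D = "(\<lambda>(f, w). (f (ex b x), w)) ` T g"
    have inj: "inj_on snd ?D" "inj_on fst ?D"
      using fin(4)[of g] that(2) unfolding collision_def inj_on_def by force+
    have "inj_on (\<lambda>(f, w). (f (ex b x), w)) (T g)"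
      using fin(4)[of g] unfolding inj_on_def by force
    then have "card ?D = card (T g)" by (rule card_image)
    moreover have "fst ` ?D \<subseteq> {0..<q}"
      using rg ex[OF that(1)] by fastforce
    moreover have "snd ` ?D \<subseteq> words - R g"
      using fin(3)[of g] by force
    ultimately show "card (consistent1 (T g) (R g) (ex b x)) = falling (2 ^ m - card (R g) - card (T g)) (p - card (T g))"
      unfolding consistent1_def using card_encs_through[of ?D "R g" "p - card (T g)"] inj fin s(2)[of g] by simp
  qed
  have ratio: "normalizer T R * (\<Prod>g\<in>UNIV. ?P g) = (\<Prod>g\<in>UNIV. real (falling (2 ^ m - card (R g)) p) / falling (2 ^ m) p)"
    unfolding normalizer_def prod.distrib[symmetric]
  proof (intro prod.cong refl)
    fix g
    show "real (falling (2 ^ m - card (R g)) (card (T g))) / real (falling (2 ^ m) p) * ?P g =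
        real (falling (2 ^ m - card (R g)) p) / real (falling (2 ^ m) p)"
      using falling_add[of "2 ^ m - card (R g)" "card (T g)" "p - card (T g)"] s(2)[of g] by simp
  qed
  have one: "1 - a \<le> real (falling (2 ^ m - card (R g)) p) / falling (2 ^ m) p" for g
  proof -
    have pos: "0 < real (falling (2 ^ m) p)" using falling_pos[of p "2 ^ m"] \<epsilon>(3) by simp
    have "(1 - a) * falling (2 ^ m) p \<le> (1 - real p * (real (card (R g)) / real (2 ^ m - p))) * falling (2 ^ m) p"
      unfolding a_def using s(1)[of g] by (intro mult_right_mono diff_left_mono mult_left_mono divide_right_mono) auto
    also have "\<dots> \<le> falling (2 ^ m - card (R g)) p"
      by (rule falling_ratio) (use \<epsilon>(3) in auto)
    finally show ?thesis using pos by (simp add: field_simps)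
  qed
  have a0: "0 \<le> a" by (simp add: a_def)
  have \<delta>0: "0 \<le> \<delta>" using \<delta>[of True] measure_nonneg order_trans by blast
  have a1: "a \<le> 1" "\<delta> \<le> 1" using \<epsilon> a0 \<delta>0 unfolding a_def[symmetric] by auto
  have main: "1 - \<epsilon> \<le> normalizer T R * (\<integral>x. real (card (consistent T R (ex b x))) \<partial>measure_pmf (rand_asn V))" for b
  proof -
    let ?C = "{x. collision T (ex b x)}"
    have "(1 - \<delta>) * (\<Prod>g\<in>UNIV. ?P g) \<le> (1 - measure_pmf.prob (rand_asn V) ?C) * (\<Prod>g\<in>UNIV. ?P g)"
      using \<delta>[of b] by (intro mult_right_mono prod_nonneg) auto
    also have "\<dots> = (\<integral>x. (1 - indicat_real ?C x) * (\<Prod>g\<in>UNIV. ?P g) \<partial>measure_pmf (rand_asn V))"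
      by (simp add: integrable_rand_asn[OF V])
    also have "\<dots> \<le> (\<integral>x. real (card (consistent T R (ex b x))) \<partial>measure_pmf (rand_asn V))"
    proof (intro integral_mono_AE AE_pmfI integrable_rand_asn V)
      fix x assume "x \<in> set_pmf (rand_asn V)"
      then have "x \<in> asns" using rand_asn_asns V by blast
      then show "(1 - indicat_real ?C x) * (\<Prod>g\<in>UNIV. ?P g) \<le> real (card (consistent T R (ex b x)))"
        using card[of x b] by (cases "x \<in> ?C") auto
    qed
    finally have "normalizer T R * ((1 - \<delta>) * (\<Prod>g\<in>UNIV. ?P g)) \<le> normalizer T R * (\<integral>x. real (card (consistent T R (ex b x))) \<partial>measure_pmf (rand_asn V))"
      by (intro mult_left_mono normalizer_nonneg)
    moreover have "normalizer T R * ((1 - \<delta>) * (\<Prod>g\<in>UNIV. ?P g)) = (1 - \<delta>) * (normalizer T R * (\<Prod>g\<in>UNIV. ?P g))" by simp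
    moreover have "(1 - \<delta>) * ((1 - a) * (1 - a)) \<le> (1 - \<delta>) * (normalizer T R * (\<Prod>g\<in>UNIV. ?P g))"
    proof -
      have "(1 - a) * (1 - a) \<le> real (falling (2 ^ m - card (R Src)) p) / falling (2 ^ m) p *
          (real (falling (2 ^ m - card (R Tgt)) p) / falling (2 ^ m) p)"
        using one[of Src] one[of Tgt] a1 by (intro mult_mono) auto
      then have "(1 - a) * (1 - a) \<le> normalizer T R * (\<Prod>g\<in>UNIV. ?P g)"
        unfolding ratio by (simp add: UNIV_grp)
      then show ?thesis using a1 by (intro mult_left_mono) auto
    qed
    moreover have "1 - \<epsilon> \<le> (1 - \<delta>) * ((1 - a) * (1 - a))"
    proof -
      have "1 - 2 * a \<le> (1 - a) * (1 - a)" by (simp add: algebra_simps)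
      then have "(1 - \<delta>) * (1 - 2 * a) \<le> (1 - \<delta>) * ((1 - a) * (1 - a))"
        using a1 by (intro mult_left_mono) auto
      moreover have "1 - \<delta> - 2 * a \<le> (1 - \<delta>) * (1 - 2 * a)"
        using \<delta>0 a0 by (simp add: algebra_simps)
      ultimately show ?thesis using \<epsilon>(1) unfolding a_def[symmetric] by linarith
    qed
    ultimately show ?thesis by linarith
  qed
  have nonneg: "0 \<le> weight (ex b) V T R \<Phi> e" for b e and \<Phi> :: "asn \<Rightarrow> (grp \<Rightarrow> enc) \<Rightarrow> bool pmf"
    unfolding weight_def by (intro mult_nonneg_nonneg normalizer_nonneg integral_nonneg_AE AE_pmfI sum_nonneg) auto
  show ?thesis
    unfolding simulable_def
  proof (intro bexI[of _ "of_bool c"] allI)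
    fix b e
    show "(1 - \<epsilon>) * (if e then of_bool c else 1 - of_bool c) \<le> weight (ex b) V T R (\<lambda>x \<Psi>. return_pmf c) e"
      using main[of b] nonneg[of b "\<lambda>x \<Psi>. return_pmf c" e]
      by (cases c; cases e) (simp_all add: weight_def)
  qed auto
qed

end

section \<open>Symbolic group elements\<close>

text \<open>The shape of the challenger without the values of its secrets. The keys are kept in
  order of issue, so that \<open>KeyR k\<close> and \<open>KeyRJ k j\<close> name the randomness of
  the \<open>k\<close>-th one. \<open>k_msg\<close> is the exponent of the challenge message and the
  only field that takes the hidden bit as an argument.\<close>

record sym_state =
  k_ver :: nat
  k_hashed :: "bits set"
  k_keys :: "bits list list"
  k_pol :: "policy option"
  k_msg :: "bool \<Rightarrow> elt"

text \<open>The coefficients of degree 0 are not variables: they are determined by the polynomial of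
  the parent, and by \<open>CtS\<close> at the root. A gate of threshold \<open>k\<close> therefore
  has the degrees \<open>1\<close> to \<open>k - 1\<close>.\<close>

fun qvars :: "policy \<Rightarrow> var set" where
  "qvars (Leaf i a) = {}"
| "qvars (Gate i k cs) = CtQ i ` {1..<k} \<union> \<Union> (set (map qvars cs))"

definition keyvars :: "nat \<Rightarrow> bits list \<Rightarrow> var set" where
  "keyvars k js = insert (KeyR k) (KeyRJ k ` set js)"

definition polvars :: "policy option \<Rightarrow> var set" where
  "polvars po = (case po of None \<Rightarrow> {} | Some P \<Rightarrow> insert CtS (qvars P))"

definition vars :: "sym_state \<Rightarrow> var set" where
  "vars K = insert Alpha (Beta ` {..k_ver K} \<union> Hsh ` k_hashed K \<union>
     (\<Union>k<length (k_keys K). keyvars k (k_keys K ! k)) \<union> polvars (k_pol K))"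

text \<open>\<open>k_msg\<close> is left free on purpose, since it is set at the challenge; the
  symbolic elements do not refer to it, and before the challenge none of them contains
  \<open>Theta\<close>.\<close>

definition state_le :: "sym_state \<Rightarrow> sym_state \<Rightarrow> bool" where
  "state_le K K' \<longleftrightarrow> k_ver K \<le> k_ver K' \<and> k_hashed K \<subseteq> k_hashed K' \<and>
     (\<exists>ks. k_keys K' = k_keys K @ ks) \<and> (\<forall>P. k_pol K = Some P \<longrightarrow> k_pol K' = Some P)"

lemma qvars_CtQ: "v \<in> qvars P \<Longrightarrow> \<exists>i j. v = CtQ i j \<and> i \<in> set (node_indices P)"
  by (induction P) fastforce+

lemma finite_qvars [simp]: "finite (qvars P)"
  by (induction P) auto

lemma Theta_vars: "Theta \<notin> vars K"
  using qvars_CtQ by (auto simp: vars_def keyvars_def polvars_def split: option.splits)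

lemma finite_vars: "finite (k_hashed K) \<Longrightarrow> finite (vars K)"
  by (auto simp: vars_def keyvars_def polvars_def split: option.splits)

definition depends_on :: "var set \<Rightarrow> elt \<Rightarrow> bool" where
  "depends_on V f \<longleftrightarrow> (\<forall>x y. (\<forall>v\<in>V. x v = y v) \<longrightarrow> f x = f y)"

lemma depends_onD: "depends_on V f \<Longrightarrow> (\<And>v. v \<in> V \<Longrightarrow> x v = y v) \<Longrightarrow> f x = f y"
  unfolding depends_on_def by blast

lemma depends_on_var [intro]: "v \<in> V \<Longrightarrow> depends_on V (\<lambda>x. x v)"
  by (simp add: depends_on_def)

lemma depends_on_const [intro]: "depends_on V (\<lambda>x. c)"
  by (simp add: depends_on_def)

lemma depends_on_app2: "depends_on V f \<Longrightarrow> depends_on V g \<Longrightarrow> depends_on V (\<lambda>x. h (f x) (g x))"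
  unfolding depends_on_def by metis

lemma depends_on_app: "depends_on V f \<Longrightarrow> depends_on V (\<lambda>x. h (f x))"
  unfolding depends_on_def by metis

context bilinear
begin

lemma mod_q [simp]: "0 \<le> a mod q" "a mod q < q"
  using q_pos(1) by (simp_all del: of_nat_0_less_iff)

text \<open>\<open>Q i j\<close> is the coefficient of degree \<open>j\<close> of the polynomial of node \<open>i\<close>.\<close>

fun shares :: "(nat \<Rightarrow> nat \<Rightarrow> int) \<Rightarrow> policy \<Rightarrow> int \<Rightarrow> (bits \<times> int) list" where
  "shares Q (Leaf i a) c = [(a, c)]"
| "shares Q (Gate i k cs) c =
     concat (map (\<lambda>x. shares Q x ((c + (\<Sum>j=1..<k. Q i j * int (node_index x) ^ j)) mod q)) cs)"

lemma map_fst_shares [simp]: "map fst (shares Q P c) = leaf_attrs P"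
  by (induction P arbitrary: c) (auto simp: map_concat intro!: arg_cong[where f = concat])

lemma length_shares [simp]: "length (shares Q P c) = length (leaf_attrs P)"
  by (metis length_map map_fst_shares)

lemma fst_shares: "y < length (leaf_attrs P) \<Longrightarrow> fst (shares Q P c ! y) = leaf_attrs P ! y"
  by (metis length_shares map_fst_shares nth_map)

lemma shares_cong:
  "(\<And>i j. CtQ i j \<in> qvars P \<Longrightarrow> Q i j = Q' i j) \<Longrightarrow> shares Q P c = shares Q' P c"
proof (induction P arbitrary: c)
  case (Gate i k cs)
  have "(\<Sum>j=1..<k. Q i j * int (node_index x) ^ j) = (\<Sum>j=1..<k. Q' i j * int (node_index x) ^ j)" for x
    using Gate.prems by (intro sum.cong) auto
  moreover have "shares Q x c' = shares Q' x c'" if "x \<in> set cs" for x c'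
    using Gate that by fastforce
  ultimately show ?case
    by (auto intro!: arg_cong[where f = concat])
qed auto

abbreviation coefs :: "asn \<Rightarrow> nat \<Rightarrow> nat \<Rightarrow> int" where
  "coefs x \<equiv> (\<lambda>i j. x (CtQ i j))"

definition leaf_share :: "policy \<Rightarrow> nat \<Rightarrow> elt" where
  "leaf_share P y x = snd (shares (coefs x) P (x CtS) ! y)"

text \<open>
  The components of the keys and ciphertexts in the source group.  The element \<open>g ^ \<alpha>\<close> of the master key
  is not among them.
\<close>

inductive base :: "sym_state \<Rightarrow> elt \<Rightarrow> bool" for K where
  one: "base K (\<lambda>x. 1)"
| beta: "i \<le> k_ver K \<Longrightarrow> base K (\<lambda>x. x (Beta i))"
| hash: "a \<in> k_hashed K \<Longrightarrow> base K (\<lambda>x. x (Hsh a))"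
| D: "k < length (k_keys K) \<Longrightarrow> i \<le> k_ver K \<Longrightarrow>
    base K (\<lambda>x. ((x Alpha + x (KeyR k)) * inv_q (x (Beta i))) mod q)"
| Dj: "k < length (k_keys K) \<Longrightarrow> j \<in> set (k_keys K ! k) \<Longrightarrow>
    base K (\<lambda>x. (x (KeyR k) + x (Hsh j) * x (KeyRJ k j)) mod q)"
| Dj': "k < length (k_keys K) \<Longrightarrow> j \<in> set (k_keys K ! k) \<Longrightarrow> base K (\<lambda>x. x (KeyRJ k j))"
| C: "k_pol K = Some P \<Longrightarrow> i \<le> k_ver K \<Longrightarrow> base K (\<lambda>x. (x (Beta i) * x CtS) mod q)"
| Cy: "k_pol K = Some P \<Longrightarrow> y < length (leaf_attrs P) \<Longrightarrow> base K (leaf_share P y)"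
| Cy': "k_pol K = Some P \<Longrightarrow> y < length (leaf_attrs P) \<Longrightarrow>
    base K (\<lambda>x. (x (Hsh (leaf_attrs P ! y)) * leaf_share P y x) mod q)"

text \<open>
  \<open>u\<close> bounds the number of key and ciphertext updates an element has gone through, hence its degree.
\<close>

inductive elt0 :: "sym_state \<Rightarrow> nat \<Rightarrow> elt \<Rightarrow> bool" for K where
  base: "base K f \<Longrightarrow> elt0 K u f"
| add: "elt0 K u f \<Longrightarrow> elt0 K u g \<Longrightarrow> elt0 K u (\<lambda>x. (f x + g x) mod q)"
| neg: "elt0 K u f \<Longrightarrow> elt0 K u (\<lambda>x. (- f x) mod q)"
| upd: "elt0 K u f \<Longrightarrow> i \<le> k_ver K \<Longrightarrow> j \<le> k_ver K \<Longrightarrow>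
    elt0 K (Suc u) (\<lambda>x. (f x * (x (Beta i) * inv_q (x (Beta j)))) mod q)"

inductive elt1a :: "sym_state \<Rightarrow> nat \<Rightarrow> elt \<Rightarrow> bool" for K where
  pair: "elt0 K u f \<Longrightarrow> elt0 K u g \<Longrightarrow> elt1a K u (\<lambda>x. (f x * g x) mod q)"
| alpha: "elt1a K u (\<lambda>x. x Alpha)"
| add: "elt1a K u f \<Longrightarrow> elt1a K u g \<Longrightarrow> elt1a K u (\<lambda>x. (f x + g x) mod q)"
| neg: "elt1a K u f \<Longrightarrow> elt1a K u (\<lambda>x. (- f x) mod q)"

text \<open>In the target group the adversary can only multiply and invert, so \<open>Theta\<close>
  enters linearly with an integer coefficient, which must be 0 as long as no challenge has been
  made.\<close>

definition elt1 :: "sym_state \<Rightarrow> nat \<Rightarrow> elt \<Rightarrow> bool" where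
  "elt1 K u f \<longleftrightarrow> (\<exists>c h. elt1a K u h \<and> (k_pol K = None \<longrightarrow> c = 0) \<and> (\<forall>x. f x = (c * x Theta + h x) mod q))"

definition elt_of :: "sym_state \<Rightarrow> nat \<Rightarrow> grp \<Rightarrow> elt \<Rightarrow> bool" where
  "elt_of K u g = (case g of Src \<Rightarrow> elt0 K u | Tgt \<Rightarrow> elt1 K u)"

text \<open>Fewer than \<open>p\<close> nodes means that all node indices are invertible modulo
  \<open>p\<close>, which the interpolation in \<open>share_vanish\<close> relies on. The final
  clause is the rule of the game that no issued key satisfies the challenge policy.\<close>

definition state_ok :: "sym_state \<Rightarrow> nat \<Rightarrow> bool" where
  "state_ok K u \<longleftrightarrow> finite (k_hashed K) \<and> (\<forall>js\<in>set (k_keys K). set js \<subseteq> k_hashed K) \<and>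
     (\<forall>b. elt1a K u (k_msg K b)) \<and>
     (\<forall>P. k_pol K = Some P \<longrightarrow> wf_policy P \<and> length (node_indices P) < p \<and> set (leaf_attrs P) \<subseteq> k_hashed K \<and>
       (\<forall>js\<in>set (k_keys K). \<not> satisfies (set js) P))"

lemma base_mono: "base K f \<Longrightarrow> state_le K K' \<Longrightarrow> base K' f"
  by (induction rule: base.induct; auto simp: state_le_def nth_append intro!: base.intros)

lemma elt0_mono_u: "elt0 K u f \<Longrightarrow> elt0 K (u + d) f"
  by (induction rule: elt0.induct) (auto intro: elt0.intros simp del: add_Suc_right)

lemma elt0_mono: "elt0 K u f \<Longrightarrow> state_le K K' \<Longrightarrow> u \<le> u' \<Longrightarrow> elt0 K' u' f"
proof -
  assume "elt0 K u f" "state_le K K'" "u \<le> u'"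
  then have "elt0 K' u f"
  proof (induction rule: elt0.induct)
    case (upd u f i j)
    then show ?case unfolding state_le_def by (intro elt0.upd) auto
  qed (auto intro: elt0.intros base_mono)
  then show ?thesis using elt0_mono_u[of K' u f "u' - u"] \<open>u \<le> u'\<close> by simp
qed

lemma elt1a_mono: "elt1a K u f \<Longrightarrow> state_le K K' \<Longrightarrow> u \<le> u' \<Longrightarrow> elt1a K' u' f"
  by (induction rule: elt1a.induct) (auto intro: elt1a.intros elt0_mono)

lemma elt_of_mono: "elt_of K u g f \<Longrightarrow> state_le K K' \<Longrightarrow> u \<le> u' \<Longrightarrow> elt_of K' u' g f"
proof (cases g)
  case Tgt
  assume elt_of: "elt_of K u g f" and K: "state_le K K'" "u \<le> u'"
  then have "elt1 K u f" using Tgt by (simp add: elt_of_def)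
  then obtain c h where h: "elt1a K u h" "k_pol K = None \<longrightarrow> c = 0" "\<forall>x. f x = (c * x Theta + h x) mod q"
    unfolding elt1_def by (elim exE conjE)
  have "k_pol K' = None \<longrightarrow> c = 0"
    using h(2) K(1) unfolding state_le_def by (cases "k_pol K") auto
  then have "elt1 K' u' f"
    unfolding elt1_def using elt1a_mono[OF h(1) K] h(3) by (intro exI conjI)
  then show ?thesis using Tgt by (simp add: elt_of_def)
qed (auto simp: elt_of_def intro: elt0_mono)

lemma base_depends_on:
  assumes "base K f" "state_ok K u"
  shows "depends_on (vars K) f"
proof -
  have leaf_share: "depends_on (vars K) (leaf_share P y)" if "k_pol K = Some P" for P y
    unfolding depends_on_def leaf_share_def
  proof (intro allI impI)
    fix x x' :: asn assume eq: "\<forall>v\<in>vars K. x v = x' v"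
    have "insert CtS (qvars P) \<subseteq> vars K" using that by (auto simp: vars_def polvars_def)
    then have "x CtS = x' CtS" "shares (coefs x) P (x' CtS) = shares (coefs x') P (x' CtS)"
      using eq by (auto intro!: shares_cong)
    then show "snd (shares (coefs x) P (x CtS) ! y) = snd (shares (coefs x') P (x' CtS) ! y)" by simp
  qed
  have key: "KeyR k \<in> vars K" if "k < length (k_keys K)" for k
    using that by (auto simp: vars_def keyvars_def)
  have keyj: "KeyRJ k j \<in> vars K" "Hsh j \<in> vars K" if "k < length (k_keys K)" "j \<in> set (k_keys K ! k)" for k j
  proof -
    show "KeyRJ k j \<in> vars K" using that by (auto simp: vars_def keyvars_def)
    have "j \<in> k_hashed K" using that assms(2) nth_mem[of k "k_keys K"] unfolding state_ok_def by blast
    then show "Hsh j \<in> vars K" by (auto simp: vars_def)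
  qed
  have leaf: "Hsh (leaf_attrs P ! y) \<in> vars K" "CtS \<in> vars K" if "k_pol K = Some P" "y < length (leaf_attrs P)" for P y
  proof -
    have "leaf_attrs P ! y \<in> k_hashed K" using that assms(2) nth_mem[of y "leaf_attrs P"] unfolding state_ok_def by blast
    then show "Hsh (leaf_attrs P ! y) \<in> vars K" by (auto simp: vars_def)
    show "CtS \<in> vars K" using that by (auto simp: vars_def polvars_def)
  qed
  have cts: "CtS \<in> vars K" if "k_pol K = Some P" for P
    using that by (auto simp: vars_def polvars_def)
  have bet: "Beta i \<in> vars K" if "i \<le> k_ver K" for i using that by (auto simp: vars_def)
  have hsh: "Hsh a \<in> vars K" if "a \<in> k_hashed K" for a using that by (auto simp: vars_def)
  have alp: "Alpha \<in> vars K" by (auto simp: vars_def)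
  show ?thesis
    using assms(1)
  proof cases
    case (Dj k j)
    show ?thesis unfolding Dj(1)
      by (intro depends_on_app[where h = "\<lambda>a. a mod q"] depends_on_app2[where h = "(*)"] depends_on_app2[where h = "(+)"] depends_on_var
          key keyj[OF Dj(2,3)] Dj(2))
  next
    case (Cy' P y)
    show ?thesis unfolding Cy'(1)
      by (intro depends_on_app[where h = "\<lambda>a. a mod q"] depends_on_app2[where h = "(*)"] depends_on_var leaf_share leaf[OF Cy'(2,3)] Cy'(2))
  qed (auto intro!: depends_on_app[where h = "\<lambda>a. a mod q"] depends_on_app2[where h = "(*)"] depends_on_app2[where h = "(+)"]
      depends_on_app[where h = inv_q] leaf_share key keyj leaf cts bet hsh alp)
qed

lemma elt0_depends_on: "elt0 K u f \<Longrightarrow> state_ok K u' \<Longrightarrow> depends_on (vars K) f"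
proof (induction rule: elt0.induct)
  case (upd u f i j)
  have "Beta i \<in> vars K" "Beta j \<in> vars K" using upd by (auto simp: vars_def)
  with upd show ?case
    by (auto intro!: depends_on_app[where h = "\<lambda>a. a mod q"] depends_on_app2[where h = "(*)"] depends_on_app[where h = inv_q])
qed (auto intro: base_depends_on intro!: depends_on_app[where h = "\<lambda>a. a mod q"] depends_on_app[where h = "uminus"] depends_on_app2[where h = "(+)"])

lemma elt1a_depends_on: "elt1a K u f \<Longrightarrow> state_ok K u' \<Longrightarrow> depends_on (vars K) f"
proof (induction rule: elt1a.induct)
  case alpha
  show ?case by (rule depends_on_var) (simp add: vars_def)
qed (auto intro: elt0_depends_on intro!: depends_on_app[where h = "\<lambda>a. a mod q"] depends_on_app[where h = "uminus"] depends_on_app2[where h = "(+)"] depends_on_app2[where h = "(*)"])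

text \<open>Shares are linear in the secret and in the coefficients, with the node indices as
  constants, so the degree does not grow on the way down the tree. The root value is generalised to
  a function \<open>c\<close> because a child receives an expression in the coefficients above
  it.\<close>

lemma shares_laurent:
  assumes "laurent 1 c" "y < length (leaf_attrs P)"
  shows "laurent 1 (\<lambda>x. snd (shares (coefs x) P (c x) ! y))"
  using assms
proof (induction P arbitrary: c y)
  case (Leaf i a)
  then show ?case by simp
next
  case (Gate i k cs)
  have "laurent 1 (\<lambda>x. snd (concat (map (\<lambda>z. shares (coefs x) z ((c x + (\<Sum>j=1..<k. x (CtQ i j) * int (node_index z) ^ j)) mod q)) cs) ! y))"
    using Gate.IH Gate.prems(2)[simplified]
  proof (induction cs arbitrary: y)
    case (Cons z zs)
    have c': "laurent 1 (\<lambda>x. (c x + (\<Sum>j=1..<k. x (CtQ i j) * int (node_index z) ^ j)) mod q)"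
      unfolding laurent_mod using Gate.prems(1) laurent_cmult[OF laurent_var]
      by (intro laurent_add laurent_sum) (simp_all add: mult.commute[of _ "int (node_index z) ^ _"])
    show ?case
    proof (cases "y < length (leaf_attrs z)")
      case True
      then show ?thesis using Cons.prems(1)[of z, OF _ c' True] by (simp add: nth_append)
    next
      case False
      then have "laurent 1 (\<lambda>x. snd (concat (map (\<lambda>z. shares (coefs x) z ((c x + (\<Sum>j=1..<k. x (CtQ i j) * int (node_index z) ^ j)) mod q)) zs) ! (y - length (leaf_attrs z))))"
        using Cons.prems by (intro Cons.IH) auto
      then show ?thesis using False by (simp add: nth_append)
    qed
  qed auto
  then show ?case by simp
qed

lemma base_laurent: "base K f \<Longrightarrow> laurent 2 f"
proof (induction rule: base.induct)
  have 1: "laurent 1 (\<lambda>x. x v)" "laurent 2 (\<lambda>x. x v)" for v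
    by (auto intro: laurent_var laurent_mono[OF laurent_var])
  have 2: "laurent 2 (\<lambda>x. f x * g x)" if "laurent 1 f" "laurent 1 g" for f g
    using laurent_mult[OF that] by (simp add: numeral_2_eq_2)
  have leaf_share: "laurent 1 (leaf_share P y)" if "y < length (leaf_attrs P)" for P y
    unfolding leaf_share_def[abs_def] using that by (intro shares_laurent laurent_var)
  {
    case one show ?case by (rule laurent_const)
  next
    case beta show ?case by (rule 1)
  next
    case hash show ?case by (rule 1)
  next
    case D show ?case unfolding laurent_mod by (intro 2 laurent_add 1 laurent_inv)
  next
    case Dj show ?case unfolding laurent_mod by (intro 2 laurent_add 1)
  next
    case Dj' show ?case by (rule 1)
  next
    case C show ?case unfolding laurent_mod by (intro 2 1)
  next
    case Cy then show ?case by (intro laurent_mono[OF leaf_share]) auto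
  next
    case Cy' then show ?case unfolding laurent_mod by (intro 2 1 leaf_share)
  }
qed

text \<open>A base element is built with at most one product of two functions of degree one; every
  update contributes two further such factors, one \<beta> and the inverse of another.\<close>

lemma elt0_laurent: "elt0 K u f \<Longrightarrow> laurent (2 + 2 * u) f"
proof (induction rule: elt0.induct)
  case (base f u)
  then show ?case by (intro laurent_mono[OF base_laurent]) auto
next
  case (upd u f i j)
  have "laurent (2 + 2 * u + (1 + 1)) (\<lambda>x. f x * (x (Beta i) * inv_q (x (Beta j))))"
    by (intro laurent_mult upd laurent_var laurent_inv)
  then show ?case by (simp add: laurent_mod)
qed (auto intro: laurent_add laurent_uminus)

lemma elt1a_laurent: "elt1a K u f \<Longrightarrow> laurent (4 + 4 * u) f"
proof (induction rule: elt1a.induct)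
  case (pair u f g)
  have "laurent ((2 + 2 * u) + (2 + 2 * u)) (\<lambda>x. f x * g x)"
    using pair by (intro laurent_mult elt0_laurent)
  moreover have "(2 + 2 * u) + (2 + 2 * u) = 4 + 4 * u" by simp
  ultimately show ?case by (simp only: laurent_mod)
next
  case alpha
  show ?case by (rule laurent_mono[OF laurent_var]) simp
qed (auto intro: laurent_add laurent_uminus)

lemma shares_range:
  assumes "c \<in> {0..<q}" "(a, v) \<in> set (shares Q P c)"
  shows "v \<in> {0..<q}"
  using assms
proof (induction P arbitrary: c)
  case (Gate i k cs)
  then obtain x where "x \<in> set cs" "(a, v) \<in> set (shares Q x ((c + (\<Sum>j=1..<k. Q i j * int (node_index x) ^ j)) mod q))"
    by auto
  then show ?case using Gate.IH by (meson atLeastLessThan_iff mod_q)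
qed auto

lemma base_range: "base K f \<Longrightarrow> x \<in> asns \<Longrightarrow> f x \<in> {0..<q}"
proof (induction rule: base.induct)
  case (Cy P y)
  then have "shares (coefs x) P (x CtS) ! y \<in> set (shares (coefs x) P (x CtS))" by simp
  then show ?case
    using shares_range[of "x CtS" _ "leaf_share P y x" "coefs x" P] asns_range[OF Cy(3), of CtS]
    unfolding leaf_share_def by (metis atLeastLessThan_iff prod.collapse)
qed (use asns_range p_gt2 in auto)

lemma elt0_range: "elt0 K u f \<Longrightarrow> x \<in> asns \<Longrightarrow> f x \<in> {0..<q}"
  by (induction rule: elt0.induct) (use base_range in auto)

lemma elt_of_range: "elt_of K u g f \<Longrightarrow> x \<in> asns \<Longrightarrow> f x \<in> {0..<q}"
  by (cases g) (auto simp: elt_of_def elt1_def dest: elt0_range)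

text \<open>Substitutes for the formal \<open>Theta\<close> its true value, the exponent of the
  message plus \<alpha> times the secret of the ciphertext. This is the only link between the
  symbolic table and the hidden bit.\<close>

definition masked :: "sym_state \<Rightarrow> bool \<Rightarrow> asn \<Rightarrow> asn" where
  "masked K b x = x(Theta := (k_msg K b x + x Alpha * x CtS) mod q)"

lemma masked_asns: "x \<in> asns \<Longrightarrow> masked K b x \<in> asns"
  unfolding masked_def by (rule asns_upd) auto

lemma masked_other: "v \<noteq> Theta \<Longrightarrow> masked K b x v = x v"
  by (simp add: masked_def)

lemma depends_on_masked: "depends_on (vars K') f \<Longrightarrow> f (masked K b x) = f x"
  using Theta_vars by (intro depends_onD[of _ f]) (auto simp: masked_def)

end

section \<open>The mask of the challenge is not in the span of the pairings\<close>

text \<open>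
  On the witnesses below every base element is, up to a factor that does not depend on the signs, a
  character of the group of sign assignments.  By orthogonality only the products that have the same
  character as \<open>\<alpha> s\<close> matter.
\<close>

definition sgn_of :: "var set \<Rightarrow> var \<Rightarrow> int" where
  "sgn_of S v = (if v \<in> S then - 1 else 1)"

definition chi :: "var set \<Rightarrow> var set \<Rightarrow> int" where
  "chi A S = (\<Prod>v\<in>A. sgn_of S v)"

definition toggle :: "'a \<Rightarrow> 'a set \<Rightarrow> 'a set" where
  "toggle v S = {w. (w \<in> S) \<noteq> (w = v)}"

lemma toggle_iff: "w \<in> toggle v S \<longleftrightarrow> (w \<in> S) \<noteq> (w = v)"
  by (simp add: toggle_def)

lemma toggle_toggle [simp]: "toggle v (toggle v S) = S"
  by (rule set_eqI) (simp only: toggle_iff, blast)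

lemma sgn_of_toggle: "sgn_of (toggle v S) w = (if w = v then - sgn_of S w else sgn_of S w)"
  by (cases "w = v") (simp_all add: sgn_of_def toggle_iff)

lemma sgn_of_sq [simp]: "sgn_of S v * sgn_of S v = 1"
  by (simp add: sgn_of_def)

lemma chi_toggle: "finite A \<Longrightarrow> chi A (toggle v S) = (if v \<in> A then - chi A S else chi A S)"
proof (cases "v \<in> A")
  case True
  assume "finite A"
  then have "chi A S = sgn_of S v * (\<Prod>w\<in>A - {v}. sgn_of S w)" for S
    unfolding chi_def using True by (rule prod.remove)
  moreover have "(\<Prod>w\<in>A - {v}. sgn_of (toggle v S) w) = (\<Prod>w\<in>A - {v}. sgn_of S w)"
    by (intro prod.cong) (auto simp: sgn_of_toggle)
  ultimately show ?thesis using True by (simp add: sgn_of_toggle)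
next
  case False
  then show ?thesis unfolding chi_def by (auto simp: sgn_of_toggle intro!: prod.cong)
qed

text \<open>Toggling \<open>v\<close> is an involution of the index set that reverses the sign, so
  the terms cancel in pairs.\<close>

lemma sum_Pow_toggle:
  fixes h :: "var set \<Rightarrow> int"
  assumes "v \<in> F" "\<And>S. h (toggle v S) = - h S"
  shows "(\<Sum>S\<in>Pow F. h S) = 0"
proof -
  have "(\<Sum>S\<in>Pow F. h S) = (\<Sum>S\<in>Pow F. h (toggle v S))"
  proof (rule sum.reindex_bij_witness[of _ "toggle v" "toggle v"])
    show "toggle v S \<in> Pow F" if "S \<in> Pow F" for S
      using that assms(1) by (auto simp: toggle_iff)
    then show "toggle v S \<in> Pow F" if "S \<in> Pow F" for S
      using that .
  qed simp_all
  then show ?thesis by (simp add: assms(2) sum_negf)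
qed

text \<open>Orthogonality of characters: the hypothesis on \<open>v\<close> says that the sign of
  \<open>v\<close> occurs an odd number of times in the whole product.\<close>

lemma sum_chi:
  assumes "finite A" "finite A'" "v \<in> F" "((v \<in> A) = (v \<in> A')) = (v \<in> {Alpha, CtS})"
  shows "(\<Sum>S\<in>Pow F. sgn_of S Alpha * sgn_of S CtS * (chi A S * chi A' S)) = 0"
  using assms by (intro sum_Pow_toggle[of v]) (auto simp: chi_toggle sgn_of_toggle)

text \<open>The independent signs. All \<beta>'s share one; the randomness of the keys and the
  coefficients of the sharing borrow theirs from \<open>Alpha\<close>, \<open>CtS\<close> and the
  hash values.\<close>

definition signs :: "sym_state \<Rightarrow> var set" where
  "signs K = {Alpha, CtS, Beta 0} \<union> Hsh ` k_hashed K"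

context bilinear
begin

text \<open>The product of the factors \<open>1 - X / a\<close>, multiplied by \<open>c\<close>;
  invertibility of the points \<open>a\<close> makes the constant coefficient free to
  choose.\<close>

lemma vanishing_poly:
  assumes "\<And>a. a \<in> set xs \<Longrightarrow> coprime a q"
  shows "\<exists>r. degree r \<le> length xs \<and> coeff r 0 = c \<and> (\<forall>a\<in>set xs. q dvd poly r a)"
  using assms
proof (induction xs)
  case Nil
  then show ?case by (intro exI[of _ "[:c:]"]) auto
next
  case (Cons a xs)
  then obtain r where r: "degree r \<le> length xs" "coeff r 0 = c" "\<forall>a\<in>set xs. q dvd poly r a"
    by auto
  let ?r = "r * [:1, - inv_q a:]"
  have "[inv_q a * a = 1] (mod q)"
    using Cons.prems by (intro cong_modular_inverse2) auto
  then have "q dvd poly [:1, - inv_q a:] a"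
    by (simp add: cong_iff_dvd_diff cong_sym mult.commute dvd_diff_commute)
  then have "q dvd poly ?r a" unfolding poly_mult by (rule dvd_mult)
  moreover have "q dvd poly ?r b" if "b \<in> set xs" for b
    unfolding poly_mult using r(3) that by (intro dvd_mult2) blast
  ultimately have "\<forall>b\<in>set (a # xs). q dvd poly ?r b" by simp
  moreover have "degree ?r \<le> length (a # xs)"
    using degree_mult_le[of r "[:1, - inv_q a:]"] r(1) by (auto split: if_splits)
  moreover have "coeff ?r 0 = c" using r(2) by (simp add: coeff_mult)
  ultimately show ?case by blast
qed

lemma poly_coeffs_sum:
  assumes "degree r < k"
  shows "poly r a = coeff r 0 + (\<Sum>j=1..<k. coeff r j * (a :: int) ^ j)"
proof -
  have "poly r a = (\<Sum>j<k. coeff r j * a ^ j)"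
    unfolding poly_altdef using assms
    by (intro sum.mono_neutral_left) (auto simp: coeff_eq_0)
  also have "{..<k} = insert 0 {1..<k}" using assms by auto
  finally show ?thesis by simp
qed

lemma shares_zero: "shares (\<lambda>_ _. 0) P 0 = map (\<lambda>a. (a, 0)) (leaf_attrs P)"
  by (induction P) (auto simp: map_concat intro!: arg_cong[where f = concat])

lemma distinct_children:
  "distinct (concat (map node_indices cs)) \<Longrightarrow> x \<in> set cs \<Longrightarrow> y \<in> set cs \<Longrightarrow>
    n \<in> set (node_indices x) \<Longrightarrow> n \<in> set (node_indices y) \<Longrightarrow> x = y"
  by (induction cs) auto

text \<open>An unsatisfied gate has fewer than \<open>k\<close> satisfied children, so a polynomial
  of degree less than \<open>k\<close> can take the value \<open>c\<close> at 0 and vanish at the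
  indices of all satisfied children. These pass on 0 with zero coefficients, and the others are
  unsatisfied, so the induction applies to whatever share they receive.\<close>

lemma share_vanish:
  assumes "valid_thresholds P" "distinct (node_indices P)" "\<forall>i\<in>set (node_indices P). 0 < i \<and> i < p"
    "\<not> satisfies \<gamma> P"
  shows "\<exists>Q. \<forall>(a, v)\<in>set (shares Q P c). a \<in> \<gamma> \<longrightarrow> v = 0 \<or> q dvd v"
  using assms
proof (induction P arbitrary: c)
  case (Leaf i a)
  then show ?case by auto
next
  case (Gate i k cs)
  let ?sat = "filter (satisfies \<gamma>) cs"
  have idx: "node_index x \<in> set (node_indices x)" for x by (cases x) auto
  have cop: "coprime (int (node_index x)) q" if "x \<in> set cs" for x
    using Gate.prems(3) that idx[of x] by (intro coprime_q) auto
  obtain r where r: "degree r \<le> length ?sat" "coeff r 0 = c" "\<forall>x\<in>set ?sat. q dvd poly r (int (node_index x))"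
  proof -
    have "coprime a q" if "a \<in> set (map (\<lambda>x. int (node_index x)) ?sat)" for a
      using that cop by auto
    from vanishing_poly[of "map (\<lambda>x. int (node_index x)) ?sat" c, OF this]
    show ?thesis using that by auto
  qed
  let ?c = "\<lambda>x. poly r (int (node_index x)) mod q"
  have deg: "degree r < k" using r(1) Gate.prems(4) by simp
  have "\<exists>Q. \<forall>(a, v)\<in>set (shares Q x (?c x)). a \<in> \<gamma> \<longrightarrow> v = 0 \<or> q dvd v" if x: "x \<in> set cs" for x
  proof (cases "satisfies \<gamma> x")
    case True
    then have "?c x = 0" using r(3) x by auto
    then show ?thesis by (intro exI[of _ "\<lambda>_ _. 0"]) (auto simp: shares_zero)
  next
    case False
    have "distinct (node_indices x)" using Gate.prems(2) x by (auto simp: distinct_concat_iff)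
    then show ?thesis
      using Gate.prems False x by (intro Gate.IH) auto
  qed
  then have "\<forall>x\<in>set cs. \<exists>Q. \<forall>(a, v)\<in>set (shares Q x (?c x)). a \<in> \<gamma> \<longrightarrow> v = 0 \<or> q dvd v"
    by blast
  from bchoice[OF this] obtain Q where Q: "\<forall>x\<in>set cs. \<forall>(a, v)\<in>set (shares (Q x) x (?c x)). a \<in> \<gamma> \<longrightarrow> v = 0 \<or> q dvd v"
    by blast
  \<comment> \<open>The coefficients found for the children are glued along the node indices; as
    these are distinct, the child that contains \<open>n\<close> is unique.\<close>
  define Q' where "Q' n j = (if n = i then coeff r j else Q (THE x. x \<in> set cs \<and> n \<in> set (node_indices x)) n j)" for n j
  have "shares Q' x c' = shares (Q x) x c'" if x: "x \<in> set cs" for x c'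
  proof (rule shares_cong)
    fix n j assume "CtQ n j \<in> qvars x"
    then have n: "n \<in> set (node_indices x)" using qvars_CtQ by blast
    then have "n \<noteq> i" using Gate.prems(2) x by auto
    moreover have "(THE x. x \<in> set cs \<and> n \<in> set (node_indices x)) = x"
    proof (rule the_equality)
      show "y = x" if "y \<in> set cs \<and> n \<in> set (node_indices y)" for y
        using distinct_children[of cs y x n] Gate.prems(2) that x n by auto
    qed (use n x in simp)
    ultimately show "Q' n j = Q x n j" by (simp add: Q'_def)
  qed
  moreover have "c + (\<Sum>j=1..<k. Q' i j * int (node_index x) ^ j) = poly r (int (node_index x))" for x
    using poly_coeffs_sum[OF deg] r(2) by (simp add: Q'_def)
  ultimately have "shares Q' (Gate i k cs) c = concat (map (\<lambda>x. shares (Q x) x (?c x)) cs)"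
    by (auto intro!: arg_cong[where f = concat])
  then show ?case using Q by (intro exI[of _ Q']) fastforce
qed

text \<open>Homogeneity of the sharing; it is used with \<open>d\<close> the sign of
  \<open>CtS\<close>, which \<open>witness\<close> puts on the secret and on all coefficients
  alike.\<close>

lemma shares_scale:
  assumes "\<And>i j. [Q' i j = d * Q i j] (mod q)" "[c' = d * c] (mod q)" "y < length (leaf_attrs P)"
  shows "[snd (shares Q' P c' ! y) = d * snd (shares Q P c ! y)] (mod q)"
  using assms(2,3)
proof (induction P arbitrary: c c' y)
  case (Gate i k cs)
  let ?s = "\<lambda>Q c zs. concat (map (\<lambda>z. shares Q z ((c + (\<Sum>j=1..<k. Q i j * int (node_index z) ^ j)) mod q)) zs)"
  have "[snd (?s Q' c' cs ! y) = d * snd (?s Q c cs ! y)] (mod q)"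
    using Gate.IH Gate.prems(2)[simplified]
  proof (induction cs arbitrary: y)
    case (Cons z zs)
    have "[(c' + (\<Sum>j=1..<k. Q' i j * int (node_index z) ^ j)) =
        d * c + (\<Sum>j=1..<k. d * Q i j * int (node_index z) ^ j)] (mod q)"
      by (intro cong_add Gate.prems cong_sum cong_mult assms cong_refl)
    also have "d * c + (\<Sum>j=1..<k. d * Q i j * int (node_index z) ^ j) =
        d * (c + (\<Sum>j=1..<k. Q i j * int (node_index z) ^ j))"
      by (simp add: distrib_left sum_distrib_left mult.assoc)
    finally have c': "[(c' + (\<Sum>j=1..<k. Q' i j * int (node_index z) ^ j)) mod q =
        d * ((c + (\<Sum>j=1..<k. Q i j * int (node_index z) ^ j)) mod q)] (mod q)"
      by (simp add: Cong.cong_def mod_mult_right_eq)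
    show ?case
    proof (cases "y < length (leaf_attrs z)")
      case True
      then show ?thesis using Cons.prems(1)[of z, OF _ c' True] by (simp add: nth_append)
    next
      case False
      then have "[snd (?s Q' c' zs ! (y - length (leaf_attrs z))) = d * snd (?s Q c zs ! (y - length (leaf_attrs z)))] (mod q)"
        using Cons.prems by (intro Cons.IH) auto
      then show ?thesis using False by (simp add: nth_append)
    qed
  qed auto
  then show ?case by simp
qed simp

text \<open>
  All \<open>\<beta>\<close>'s are equal, which makes the updates invisible.  For \<open>i = k + 1\<close> only the randomness of the
  \<open>k\<close>-th key is switched on, in such a way that its components \<open>D_j\<close> vanish; \<open>Q i\<close> shares the
  secret \<open>1\<close> so that the shares at the attributes of that key vanish.  For \<open>i = 0\<close> only \<open>\<alpha>\<close>
  is switched on, with the opposite sign: thus \<open>(\<alpha> + r) s\<close> sums to zero over all \<open>i\<close> for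
  each key, but \<open>\<alpha> s\<close> does not.
\<close>

fun witness :: "(nat \<Rightarrow> nat \<Rightarrow> nat \<Rightarrow> int) \<Rightarrow> nat \<Rightarrow> var set \<Rightarrow> asn" where
  "witness Q i S Alpha = (if i = 0 then - sgn_of S Alpha else 0) mod q"
| "witness Q i S (Beta l) = sgn_of S (Beta 0) mod q"
| "witness Q i S (Hsh a) = sgn_of S (Hsh a) mod q"
| "witness Q i S (KeyR k) = (if i = Suc k then sgn_of S Alpha else 0) mod q"
| "witness Q i S (KeyRJ k j) = (if i = Suc k then - sgn_of S Alpha * sgn_of S (Hsh j) else 0) mod q"
| "witness Q i S CtS = sgn_of S CtS mod q"
| "witness Q i S (CtQ a j) = (sgn_of S CtS * Q i a j) mod q"
| "witness Q i S Theta = 0"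

lemma witness_asns: "witness Q i S \<in> asns"
  unfolding asns_def
proof (intro CollectI allI)
  fix v
  have m1: "(-1) mod q = q - 1"
    using p_gt2 by (simp add: zmod_minus1)
  show "witness Q i S v \<in> var_range v"
    using p_gt2 by (cases v) (auto simp: sgn_of_def m1)
qed

definition signed_sum :: "sym_state \<Rightarrow> (nat \<Rightarrow> nat \<Rightarrow> nat \<Rightarrow> int) \<Rightarrow> elt \<Rightarrow> int" where
  "signed_sum K Q f = (\<Sum>i\<le>length (k_keys K). \<Sum>S\<in>Pow (signs K). sgn_of S Alpha * sgn_of S CtS * f (witness Q i S))"

lemma signed_sum_cong:
  assumes "\<And>i S. [f (witness Q i S) = g (witness Q i S)] (mod q)"
  shows "[signed_sum K Q f = signed_sum K Q g] (mod q)"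
  unfolding signed_sum_def by (intro cong_sum cong_mult assms cong_refl)

lemma signed_sum_add: "signed_sum K Q (\<lambda>x. f x + g x) = signed_sum K Q f + signed_sum K Q g"
  by (simp add: signed_sum_def sum.distrib distrib_left)

lemma signed_sum_cmult: "signed_sum K Q (\<lambda>x. c * f x) = c * signed_sum K Q f"
  by (simp add: signed_sum_def sum_distrib_left mult_ac)

lemma signed_sum_mod: "[signed_sum K Q (\<lambda>x. f x mod q) = signed_sum K Q f] (mod q)"
  by (rule signed_sum_cong) simp

text \<open>The possible shapes of a base element on the witnesses: \<open>A\<close> is its sign
  character and \<open>\<kappa> i\<close> its size on the \<open>i\<close>-th witness.
  \<open>neutral\<close> covers 1, the \<beta>'s, the hash values and the vanishing
  \<open>D_j\<close>; \<open>key\<close> is \<open>D\<close>, \<open>keyj\<close> is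
  \<open>D'_j\<close>, \<open>ctC\<close> is \<open>C\<close>, and \<open>leaf\<close> and
  \<open>leafh\<close> are \<open>C_y\<close> and \<open>C'_y\<close>.\<close>

inductive basis_char :: "sym_state \<Rightarrow> var set \<Rightarrow> (nat \<Rightarrow> int) \<Rightarrow> bool" for K where
  neutral: "A \<subseteq> insert (Beta 0) (Hsh ` k_hashed K) \<Longrightarrow> finite A \<Longrightarrow> basis_char K A \<kappa>"
| key: "k < length (k_keys K) \<Longrightarrow>
    basis_char K {Alpha, Beta 0} (\<lambda>i. if i = 0 then -1 else if i = Suc k then 1 else 0)"
| keyj: "k < length (k_keys K) \<Longrightarrow> j \<in> set (k_keys K ! k) \<Longrightarrow> j \<in> k_hashed K \<Longrightarrow>
    basis_char K {Alpha, Hsh j} (\<lambda>i. if i = Suc k then -1 else 0)"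
| ctC: "basis_char K {CtS, Beta 0} (\<lambda>_. 1)"
| leaf: "basis_char K {CtS} \<kappa>"
| leafh: "a \<in> k_hashed K \<Longrightarrow> (\<And>k. k < length (k_keys K) \<Longrightarrow> a \<in> set (k_keys K ! k) \<Longrightarrow> q dvd \<kappa> (Suc k)) \<Longrightarrow>
    basis_char K {CtS, Hsh a} \<kappa>"

definition pairsum :: "sym_state \<Rightarrow> var set \<Rightarrow> (nat \<Rightarrow> int) \<Rightarrow> var set \<Rightarrow> (nat \<Rightarrow> int) \<Rightarrow> int" where
  "pairsum K A \<kappa> A' \<kappa>' = (\<Sum>i\<le>length (k_keys K). \<kappa> i * \<kappa>' i) *
     (\<Sum>S\<in>Pow (signs K). sgn_of S Alpha * sgn_of S CtS * (chi A S * chi A' S))"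

lemma basis_char_finite: "basis_char K A \<kappa> \<Longrightarrow> finite A"
  by (induction rule: basis_char.induct) auto

text \<open>Only two combinations have the character of \<alpha> times the secret. For
  \<open>key\<close> with \<open>ctC\<close> the sizes \<open>-1\<close> and \<open>1\<close> of the
  key add up to 0 over the witnesses. For \<open>keyj\<close> with \<open>leafh\<close> at the same
  attribute, the witness that switches on this key has a share divisible by \<open>q\<close>. Every
  other combination leaves the sign of \<open>Beta 0\<close> or of a hash value odd.\<close>

lemma pairsum_half:
  assumes "basis_char K A \<kappa>" "basis_char K A' \<kappa>'" "Alpha \<in> A" "CtS \<in> A'"
  shows "q dvd pairsum K A \<kappa> A' \<kappa>'"
proof -
  have fin: "finite A" "finite A'" using assms basis_char_finite by auto
  have odd: ?thesis if "v \<in> signs K" "((v \<in> A) = (v \<in> A')) = (v \<in> {Alpha, CtS})" for v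
    unfolding pairsum_def sum_chi[OF fin that] by simp
  show ?thesis
    using assms(1)
  proof cases
    case (key k)
    show ?thesis
      using assms(2)
    proof cases
      case ctC
      have "(\<Sum>i\<le>length (k_keys K). \<kappa> i * \<kappa>' i) = (\<Sum>i\<in>{0, Suc k}. \<kappa> i)"
        using key ctC by (intro sum.mono_neutral_cong_right) auto
      then show ?thesis using key by (simp add: pairsum_def)
    qed (rule odd[of "Beta 0"]; use assms(4) key(1) in \<open>auto simp: signs_def\<close>)+
  next
    case (keyj k j)
    show ?thesis
      using assms(2)
    proof cases
      case (leafh a)
      show ?thesis
      proof (cases "a = j")
        case True
        have "q dvd \<kappa> i * \<kappa>' i" for i
          using keyj leafh(3)[of k] True by (cases "i = Suc k") auto
        then have "q dvd (\<Sum>i\<le>length (k_keys K). \<kappa> i * \<kappa>' i)" by (intro dvd_sum)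
        then show ?thesis unfolding pairsum_def by (rule dvd_mult2)
      next
        case False
        then show ?thesis by (intro odd[of "Hsh j"]) (simp_all add: keyj(1,5) leafh(1) signs_def)
      qed
    next
      case neutral
      then show ?thesis using assms(4) by auto
    next
      case (key l)
      then show ?thesis using assms(4) by auto
    next
      case (keyj l i)
      then show ?thesis using assms(4) by auto
    next
      case ctC
      show ?thesis by (rule odd[of "Hsh j"]) (simp_all add: keyj(1,5) ctC(1) signs_def)
    next
      case leaf
      show ?thesis by (rule odd[of "Hsh j"]) (simp_all add: keyj(1,5) leaf(1) signs_def)
    qed
  qed (use assms in auto)
qed

text \<open>No base element carries the signs of both \<open>Alpha\<close> and \<open>CtS\<close>.
  So either each of the two factors carries one of them, as in \<open>pairsum_half\<close>, or one
  of these signs is odd in the sum.\<close>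

lemma pairsum_dvd:
  assumes "basis_char K A \<kappa>" "basis_char K A' \<kappa>'"
  shows "q dvd pairsum K A \<kappa> A' \<kappa>'"
proof -
  have fin: "finite A" "finite A'" using assms basis_char_finite by auto
  have odd: ?thesis if "v \<in> signs K" "((v \<in> A) = (v \<in> A')) = (v \<in> {Alpha, CtS})" for v
    unfolding pairsum_def sum_chi[OF fin that] by simp
  have both: "\<not> (Alpha \<in> B \<and> CtS \<in> B)" if "basis_char K B \<mu>" for B \<mu>
    using that by cases auto
  have comm: "pairsum K A \<kappa> A' \<kappa>' = pairsum K A' \<kappa>' A \<kappa>"
    by (simp add: pairsum_def mult_ac)
  consider "Alpha \<in> A" "CtS \<in> A'" | "Alpha \<in> A'" "CtS \<in> A" | "(Alpha \<in> A) = (Alpha \<in> A')" | "(CtS \<in> A) = (CtS \<in> A')"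
    using both assms by blast
  then show ?thesis
  proof cases
    case 1
    then show ?thesis using pairsum_half assms by blast
  next
    case 2
    then show ?thesis unfolding comm using pairsum_half assms by blast
  qed (auto simp: signs_def intro: odd[of Alpha] odd[of CtS])
qed

definition vanishing :: "sym_state \<Rightarrow> policy \<Rightarrow> (nat \<Rightarrow> nat \<Rightarrow> nat \<Rightarrow> int) \<Rightarrow> bool" where
  "vanishing K P Q \<longleftrightarrow> (\<forall>k<length (k_keys K). \<forall>(a, v)\<in>set (shares (Q (Suc k)) P 1).
     a \<in> set (k_keys K ! k) \<longrightarrow> v = 0 \<or> q dvd v)"

lemma vanishing_exists:
  assumes "state_ok K u" "k_pol K = Some P"
  shows "\<exists>Q. vanishing K P Q"
proof -
  have P: "wf_policy P" "length (node_indices P) < p" "\<And>js. js \<in> set (k_keys K) \<Longrightarrow> \<not> satisfies (set js) P"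
    using assms unfolding state_ok_def by auto
  then have "\<forall>i\<in>set (node_indices P). 0 < i \<and> i < p"
    unfolding wf_policy_def by fastforce
  then have "\<exists>Q. \<forall>(a, v)\<in>set (shares Q P 1). a \<in> set (k_keys K ! k) \<longrightarrow> v = 0 \<or> q dvd v"
    if "k < length (k_keys K)" for k
    using P that nth_mem[OF that] by (intro share_vanish) (auto simp: wf_policy_def)
  then have "\<forall>k\<in>{..<length (k_keys K)}. \<exists>Q. \<forall>(a, v)\<in>set (shares Q P 1). a \<in> set (k_keys K ! k) \<longrightarrow> v = 0 \<or> q dvd v"
    by blast
  from bchoice[OF this] obtain Q where "\<forall>k\<in>{..<length (k_keys K)}.
      \<forall>(a, v)\<in>set (shares (Q k) P 1). a \<in> set (k_keys K ! k) \<longrightarrow> v = 0 \<or> q dvd v"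
    by blast
  \<comment> \<open>Key \<open>k\<close> belongs to witness \<open>Suc k\<close>, hence the shift;
    witness 0 may use any sharing.\<close>
  then show ?thesis unfolding vanishing_def by (intro exI[of _ "\<lambda>i. Q (i - 1)"]) auto
qed

lemma chi_simps: "chi {} S = 1" "chi {v} S = sgn_of S v" "v \<noteq> w \<Longrightarrow> chi {v, w} S = sgn_of S v * sgn_of S w"
  by (simp_all add: chi_def)

lemma inv_sgn_of: "[sgn_of S v * inv_q (sgn_of S v mod q) = 1] (mod q)" "[inv_q (sgn_of S v mod q) = sgn_of S v] (mod q)"
proof -
  \<comment> \<open>A witness whose sign on \<open>Beta 0\<close> is the given one lends the
    invertibility of the \<beta>'s to a bare sign.\<close>
  have x: "witness (\<lambda>_ _ _. 0) 0 {w. w = Beta 0 \<and> v \<in> S} \<in> asns" by (rule witness_asns)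
  have e: "sgn_of {w. w = Beta 0 \<and> v \<in> S} (Beta 0) = sgn_of S v" by (simp add: sgn_of_def)
  have "[(sgn_of S v mod q) * inv_q (sgn_of S v mod q) = 1] (mod q)"
    using inv_q_cong[OF x, of 0] by (simp add: e)
  then show 1: "[sgn_of S v * inv_q (sgn_of S v mod q) = 1] (mod q)"
    by (simp add: Cong.cong_def mod_mult_left_eq)
  have "[sgn_of S v * (sgn_of S v * inv_q (sgn_of S v mod q)) = sgn_of S v * 1] (mod q)"
    using 1 by (intro cong_mult) auto
  then show "[inv_q (sgn_of S v mod q) = sgn_of S v] (mod q)"
    by (simp add: mult.assoc[symmetric])
qed

text \<open>The choices made in \<open>witness\<close> are verified here: squares of signs are 1, so
  the two summands of \<open>D_j\<close> cancel; a sign is its own inverse, so the division by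
  \<beta> in \<open>D\<close> becomes multiplication by the sign of \<open>Beta 0\<close>; and all
  signs come out of the shares as a single factor.\<close>

lemma base_basis_char:
  assumes "base K f" "state_ok K u" "k_pol K = Some P" "vanishing K P Q"
  shows "\<exists>A \<kappa>. basis_char K A \<kappa> \<and> (\<forall>i S. [f (witness Q i S) = \<kappa> i * chi A S] (mod q))"
  using assms(1)
proof cases
  case one
  show ?thesis
    by (intro exI[of _ "{}"] exI[of _ "\<lambda>_. 1"] conjI basis_char.neutral) (auto simp: one chi_simps)
next
  case (beta i)
  show ?thesis
    by (intro exI[of _ "{Beta 0}"] exI[of _ "\<lambda>_. 1"] conjI basis_char.neutral) (auto simp: beta chi_simps)
next
  case (hash a)
  show ?thesis
    by (intro exI[of _ "{Hsh a}"] exI[of _ "\<lambda>_. 1"] conjI basis_char.neutral) (auto simp: hash chi_simps)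
next
  case (D k l)
  have "[f (witness Q i S) = (if i = 0 then -1 else if i = Suc k then 1 else 0) * chi {Alpha, Beta 0} S] (mod q)" for i S
  proof -
    have "[f (witness Q i S) = ((if i = 0 then - sgn_of S Alpha else 0) + (if i = Suc k then sgn_of S Alpha else 0)) * sgn_of S (Beta 0)] (mod q)"
      unfolding D(1) cong_mod_left witness.simps
      by (rule cong_mult[OF cong_add inv_sgn_of(2)]) simp_all
    then show ?thesis by (auto simp: chi_simps split: if_splits)
  qed
  then show ?thesis using basis_char.key[OF D(2)] by blast
next
  case (Dj k j)
  have "[f (witness Q i S) = 0 * chi {} S] (mod q)" for i S
  proof -
    have "[f (witness Q i S) = (if i = Suc k then sgn_of S Alpha else 0) + sgn_of S (Hsh j) * (if i = Suc k then - sgn_of S Alpha * sgn_of S (Hsh j) else 0)] (mod q)"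
      unfolding Dj(1) witness.simps cong_mod_left
      by (intro cong_add cong_mult) (auto simp: Cong.cong_def)
    also have "(if i = Suc k then sgn_of S Alpha else 0) + sgn_of S (Hsh j) * (if i = Suc k then - sgn_of S Alpha * sgn_of S (Hsh j) else 0) = 0"
      by (simp add: sgn_of_def)
    finally show ?thesis by simp
  qed
  then show ?thesis
    by (intro exI[of _ "{}"] exI[of _ "\<lambda>_. 0"] conjI basis_char.neutral) auto
next
  case (Dj' k j)
  have "j \<in> k_hashed K" using assms(2) Dj' nth_mem[of k "k_keys K"] unfolding state_ok_def by blast
  then have "basis_char K {Alpha, Hsh j} (\<lambda>i. if i = Suc k then -1 else 0)"
    using Dj' by (intro basis_char.keyj)
  moreover have "[f (witness Q i S) = (if i = Suc k then -1 else 0) * chi {Alpha, Hsh j} S] (mod q)" for i S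
    unfolding Dj'(1) by (simp add: chi_simps)
  ultimately show ?thesis by blast
next
  case (C P' l)
  have "[f (witness Q i S) = 1 * chi {CtS, Beta 0} S] (mod q)" for i S
    unfolding C(1) by (simp add: chi_simps Cong.cong_def mod_mult_eq mult.commute)
  then show ?thesis using basis_char.ctC by blast
next
  case (Cy P' y)
  have P: "P' = P" "y < length (leaf_attrs P)" using Cy assms(3) by auto
  have "[leaf_share P y (witness Q i S) = snd (shares (Q i) P 1 ! y) * chi {CtS} S] (mod q)" for i S
    using shares_scale[of "coefs (witness Q i S)" "sgn_of S CtS" "Q i" "witness Q i S CtS" 1 y P] P
    by (simp add: leaf_share_def chi_simps mult.commute)
  then show ?thesis
    using basis_char.leaf[of K "\<lambda>i. snd (shares (Q i) P 1 ! y)"] Cy(1) P(1) by blast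
next
  case (Cy' P' y)
  have P: "P' = P" "y < length (leaf_attrs P)" using Cy' assms(3) by auto
  let ?a = "leaf_attrs P ! y" and ?\<kappa> = "\<lambda>i. snd (shares (Q i) P 1 ! y)"
  have leaf_share: "[leaf_share P y (witness Q i S) = sgn_of S CtS * ?\<kappa> i] (mod q)" for i S
    using shares_scale[of "coefs (witness Q i S)" "sgn_of S CtS" "Q i" "witness Q i S CtS" 1 y P] P
    by (simp add: leaf_share_def)
  have "[f (witness Q i S) = ?\<kappa> i * chi {CtS, Hsh ?a} S] (mod q)" for i S
  proof -
    have "[f (witness Q i S) = sgn_of S (Hsh ?a) * (sgn_of S CtS * ?\<kappa> i)] (mod q)"
      unfolding Cy'(1) P(1) cong_mod_left by (intro cong_mult leaf_share) simp
    then show ?thesis by (simp add: chi_simps mult_ac)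
  qed
  moreover have "basis_char K {CtS, Hsh ?a} ?\<kappa>"
  proof (rule basis_char.leafh)
    show "?a \<in> k_hashed K" using assms(2,3) nth_mem[OF P(2)] unfolding state_ok_def by blast
    fix k assume k: "k < length (k_keys K)" "?a \<in> set (k_keys K ! k)"
    have "shares (Q (Suc k)) P 1 ! y \<in> set (shares (Q (Suc k)) P 1)" using P by simp
    then have "(?a, ?\<kappa> (Suc k)) \<in> set (shares (Q (Suc k)) P 1)"
      using fst_shares[OF P(2), of "Q (Suc k)" 1] by (metis prod.collapse)
    then have "?\<kappa> (Suc k) = 0 \<or> q dvd ?\<kappa> (Suc k)"
      using assms(4) k unfolding vanishing_def by blast
    then show "q dvd ?\<kappa> (Suc k)" by auto
  qed
  ultimately show ?thesis by blast
qed

lemma signed_sum_base_pair: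
  assumes "base K f" "base K g" "state_ok K u" "k_pol K = Some P" "vanishing K P Q"
  shows "q dvd signed_sum K Q (\<lambda>x. f x * g x)"
proof -
  obtain A \<kappa> where A: "basis_char K A \<kappa>" "\<And>i S. [f (witness Q i S) = \<kappa> i * chi A S] (mod q)"
    using base_basis_char[OF assms(1,3-5)] by blast
  obtain A' \<kappa>' where A': "basis_char K A' \<kappa>'" "\<And>i S. [g (witness Q i S) = \<kappa>' i * chi A' S] (mod q)"
    using base_basis_char[OF assms(2-5)] by blast
  have "[signed_sum K Q (\<lambda>x. f x * g x) = (\<Sum>i\<le>length (k_keys K). \<Sum>S\<in>Pow (signs K). sgn_of S Alpha * sgn_of S CtS * ((\<kappa> i * chi A S) * (\<kappa>' i * chi A' S)))] (mod q)"
    unfolding signed_sum_def by (intro cong_sum cong_mult A A' cong_refl)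
  also have "(\<Sum>i\<le>length (k_keys K). \<Sum>S\<in>Pow (signs K). sgn_of S Alpha * sgn_of S CtS * ((\<kappa> i * chi A S) * (\<kappa>' i * chi A' S))) = pairsum K A \<kappa> A' \<kappa>'"
    unfolding pairsum_def sum_product by (intro sum.cong refl) (simp add: mult_ac)
  finally show ?thesis
    using pairsum_dvd[OF A(1) A'(1)] cong_dvd_iff by blast
qed

lemma signed_sum_upd:
  "[signed_sum K Q (\<lambda>x. ((f x * (x (Beta i) * inv_q (x (Beta j)))) mod q) * g x) = signed_sum K Q (\<lambda>x. f x * g x)] (mod q)"
proof (rule signed_sum_cong)
  fix l S
  let ?x = "witness Q l S"
  have "[?x (Beta i) * inv_q (?x (Beta j)) = 1] (mod q)"
    using inv_q_cong[OF witness_asns, of Q l S j] by simp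
  then have "[f ?x * (?x (Beta i) * inv_q (?x (Beta j))) = f ?x * 1] (mod q)"
    by (intro cong_mult cong_refl)
  then have "[(f ?x * (?x (Beta i) * inv_q (?x (Beta j)))) mod q = f ?x] (mod q)"
    by simp
  then show "[((f ?x * (?x (Beta i) * inv_q (?x (Beta j)))) mod q) * g ?x = f ?x * g ?x] (mod q)"
    by (intro cong_mult cong_refl)
qed

text \<open>The second factor \<open>g\<close> is arbitrary, so the lemma can be applied to each of
  the two factors in turn; this reduces products of source elements to products of base
  elements.\<close>

lemma signed_sum_elt0_closed:
  assumes "elt0 K u f" "\<And>f. base K f \<Longrightarrow> q dvd signed_sum K Q (\<lambda>x. f x * g x)"
  shows "q dvd signed_sum K Q (\<lambda>x. f x * g x)"
  using assms(1)
proof (induction rule: elt0.induct)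
  case (base f u)
  then show ?case by (rule assms(2))
next
  case (add u f f')
  have "[signed_sum K Q (\<lambda>x. ((f x + f' x) mod q) * g x) = signed_sum K Q (\<lambda>x. f x * g x + f' x * g x)] (mod q)"
    by (rule signed_sum_cong) (simp add: Cong.cong_def mod_mult_left_eq distrib_right)
  then show ?case using add by (simp add: signed_sum_add cong_dvd_iff)
next
  case (neg u f)
  have "[signed_sum K Q (\<lambda>x. ((- f x) mod q) * g x) = signed_sum K Q (\<lambda>x. (- 1) * (f x * g x))] (mod q)"
    by (rule signed_sum_cong) (simp add: Cong.cong_def mod_mult_left_eq)
  then show ?case using neg by (simp only: signed_sum_cmult cong_dvd_iff dvd_mult)
next
  case (upd u f i j)
  then show ?case using cong_dvd_iff[OF signed_sum_upd] by blast
qed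

lemma signed_sum_elt0_pair:
  assumes "elt0 K u f" "elt0 K u' g" "state_ok K u''" "k_pol K = Some P" "vanishing K P Q"
  shows "q dvd signed_sum K Q (\<lambda>x. f x * g x)"
proof (rule signed_sum_elt0_closed[OF assms(1)])
  fix f assume f: "base K f"
  have "q dvd signed_sum K Q (\<lambda>x. g x * f x)"
    by (rule signed_sum_elt0_closed[OF assms(2)]) (rule signed_sum_base_pair[OF _ f assms(3-5)])
  then show "q dvd signed_sum K Q (\<lambda>x. f x * g x)" by (simp add: mult.commute)
qed

lemma finite_signs: "state_ok K u \<Longrightarrow> finite (signs K)"
  by (simp add: signs_def state_ok_def)

lemma signed_sum_elt1a:
  assumes "elt1a K u f" "state_ok K u''" "k_pol K = Some P" "vanishing K P Q"
  shows "q dvd signed_sum K Q f"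
  using assms(1)
proof (induction rule: elt1a.induct)
  case (pair u f g)
  then show ?case using signed_sum_elt0_pair[OF pair assms(2-4)] signed_sum_mod[of K Q "\<lambda>x. f x * g x"] cong_dvd_iff by blast
next
  case (alpha u)
  have "[signed_sum K Q (\<lambda>x. x Alpha) = (\<Sum>i\<le>length (k_keys K). \<Sum>S\<in>Pow (signs K).
      sgn_of S Alpha * sgn_of S CtS * (if i = 0 then - sgn_of S Alpha else 0))] (mod q)"
    unfolding signed_sum_def by (intro cong_sum cong_mult cong_refl) simp
  \<comment> \<open>The public \<alpha> comes without the secret of the ciphertext, so the sign of
    \<open>CtS\<close> occurs only once and the sum vanishes.\<close>
  moreover have "(\<Sum>S\<in>Pow (signs K). sgn_of S Alpha * sgn_of S CtS * (if i = 0 then - sgn_of S Alpha else 0)) = 0" for i :: nat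
    by (rule sum_Pow_toggle[of CtS]) (auto simp: signs_def sgn_of_toggle)
  ultimately show ?case by (simp add: cong_0_iff)
next
  case (add u f g)
  then have "q dvd signed_sum K Q (\<lambda>x. f x + g x)" by (simp add: signed_sum_add)
  then show ?case using signed_sum_mod[of K Q "\<lambda>x. f x + g x"] cong_dvd_iff by blast
next
  case (neg u f)
  then have "q dvd signed_sum K Q (\<lambda>x. (- 1) * f x)" by (simp only: signed_sum_cmult dvd_mult)
  then have "q dvd signed_sum K Q (\<lambda>x. - f x)" by simp
  then show ?case using signed_sum_mod[of K Q "\<lambda>x. - f x"] cong_dvd_iff by blast
qed

text \<open>\<alpha> is switched on in witness 0 only, and there every choice of signs contributes
  \<open>-1\<close>. The sum is minus the number of sign choices, a power of two, which an odd prime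
  does not divide.\<close>

lemma signed_sum_challenge:
  assumes "state_ok K u"
  shows "\<not> q dvd signed_sum K Q (\<lambda>x. x Alpha * x CtS)"
proof -
  have "[signed_sum K Q (\<lambda>x. x Alpha * x CtS) = (\<Sum>i\<le>length (k_keys K). \<Sum>S\<in>Pow (signs K).
      sgn_of S Alpha * sgn_of S CtS * ((if i = 0 then - sgn_of S Alpha else 0) * sgn_of S CtS))] (mod q)"
    unfolding signed_sum_def by (intro cong_sum cong_mult cong_refl) simp_all
  also have "(\<Sum>i\<le>length (k_keys K). \<Sum>S\<in>Pow (signs K).
      sgn_of S Alpha * sgn_of S CtS * ((if i = 0 then - sgn_of S Alpha else 0) * sgn_of S CtS)) =
      (\<Sum>i\<le>length (k_keys K). if i = 0 then (\<Sum>S\<in>Pow (signs K). - 1) else 0)"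
  proof (intro sum.cong refl)
    fix i :: nat
    have "sgn_of S Alpha * sgn_of S CtS * (- sgn_of S Alpha * sgn_of S CtS) = - 1" for S
      by (simp add: sgn_of_def)
    then have eq: "(\<Sum>S\<in>Pow (signs K). sgn_of S Alpha * sgn_of S CtS * (- sgn_of S Alpha * sgn_of S CtS)) = (\<Sum>S\<in>Pow (signs K). - 1)"
      by (intro sum.cong refl)
    show "(\<Sum>S\<in>Pow (signs K). sgn_of S Alpha * sgn_of S CtS * ((if i = 0 then - sgn_of S Alpha else 0) * sgn_of S CtS)) =
        (if i = 0 then (\<Sum>S\<in>Pow (signs K). - 1) else 0)"
    proof (cases "i = 0")
      case True
      show ?thesis by (simp only: if_P[OF True] eq)
    next
      case False
      show ?thesis by (simp only: if_not_P[OF False] mult_zero_left mult_zero_right sum.neutral_const)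
    qed
  qed
  also have "\<dots> = - (2 ^ card (signs K))"
    using finite_signs[OF assms] by (simp add: card_Pow)
  finally have "[signed_sum K Q (\<lambda>x. x Alpha * x CtS) = - (2 ^ card (signs K))] (mod q)" .
  from cong_dvd_iff[OF this] have "q dvd signed_sum K Q (\<lambda>x. x Alpha * x CtS) \<longleftrightarrow> q dvd 2 ^ card (signs K)"
    by (simp only: dvd_minus_iff)
  moreover have "\<not> q dvd 2 ^ card (signs K)"
  proof
    assume "q dvd 2 ^ card (signs K)"
    then have "q dvd 2" using prime_p prime_dvd_power[of q 2] by auto
    then show False using p_gt2 by (auto dest: zdvd_imp_le)
  qed
  ultimately show ?thesis by blast
qed

section \<open>From unequal symbolic elements to rare coincidences\<close>

lemma elt1E:
  assumes "elt1 K u f"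
  obtains h c where "elt1a K u h" "k_pol K = None \<longrightarrow> c = 0" "\<forall>x. f x = (c * x Theta + h x) mod q"
  using assms unfolding elt1_def by (elim exE conjE)

text \<open>Putting the true value for \<open>Theta\<close> identifies no two elements, whichever
  bit is hidden. If the coefficients of \<open>Theta\<close> agree modulo \<open>q\<close>, then
  \<open>Theta\<close> cancels from the difference. Otherwise an identity on all of
  \<open>asns\<close> would express a nonzero multiple of \<alpha> times the secret through elements
  of \<open>elt1a\<close>, including the message; all of these have signed sum 0 modulo
  \<open>q\<close>, and the product has not.\<close>

lemma not_elt_eq_masked:
  assumes K: "state_ok K u'" and f: "elt_of K u g f" "elt_of K u g f'" and ne: "\<not> elt_eq f f'"
  shows "\<exists>x\<in>asns. \<not> [f (masked K b x) = f' (masked K b x)] (mod q)"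
proof (cases g)
  case Src
  then have elt0: "elt0 K u f" "elt0 K u f'" using f by (auto simp: elt_of_def)
  obtain x where x: "x \<in> asns" "f x \<noteq> f' x" using ne by (auto simp: elt_eq_def)
  then have "\<not> [f x = f' x] (mod q)"
    using elt0_range[OF elt0(1) x(1)] elt0_range[OF elt0(2) x(1)] by (simp add: Cong.cong_def)
  moreover have "f (masked K b x) = f x" "f' (masked K b x) = f' x"
    using depends_on_masked[OF elt0_depends_on[OF elt0(1) K]] depends_on_masked[OF elt0_depends_on[OF elt0(2) K]] by auto
  ultimately show ?thesis using x(1) by (intro bexI[of _ x]) simp
next
  case Tgt
  then have elt1: "elt1 K u f" "elt1 K u f'" using f by (auto simp: elt_of_def)
  obtain h c where h'': "elt1a K u h" "k_pol K = None \<longrightarrow> c = 0" "\<forall>x. f x = (c * x Theta + h x) mod q"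
    using elt1(1) by (rule elt1E)
  note h = h''(1,2) h''(3)[rule_format]
  obtain h' c' where h''': "elt1a K u h'" "k_pol K = None \<longrightarrow> c' = 0" "\<forall>x. f' x = (c' * x Theta + h' x) mod q"
    using elt1(2) by (rule elt1E)
  note h' = h'''(1,2) h'''(3)[rule_format]
  have hx: "h (masked K b x) = h x" "h' (masked K b x) = h' x" for x
    using depends_on_masked elt1a_depends_on[OF h(1) K] elt1a_depends_on[OF h'(1) K] by auto
  show ?thesis
  proof (cases "[c = c'] (mod q)")
    case True
    have eq: "[f x = f' x] (mod q) \<longleftrightarrow> [h x = h' x] (mod q)" for x
    proof -
      have "[c * x Theta = c' * x Theta] (mod q)" using True by (intro cong_mult cong_refl)
      then show ?thesis unfolding h(3) h'(3) cong_mod_left cong_mod_right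
        by (simp add: cong_iff_dvd_diff) (metis add_diff_add dvd_add_right_iff)
    qed
    obtain x where x: "x \<in> asns" "f x \<noteq> f' x" using ne by (auto simp: elt_eq_def)
    then have "\<not> [f x = f' x] (mod q)" unfolding h(3) h'(3) by (simp add: Cong.cong_def)
    then have "\<not> [f (masked K b x) = f' (masked K b x)] (mod q)" unfolding eq hx .
    then show ?thesis using x(1) by blast
  next
    case False
    then obtain P where P: "k_pol K = Some P" using h(2) h'(2) by (cases "k_pol K") auto
    obtain Q where Q: "vanishing K P Q" using vanishing_exists[OF K P] by blast
    have msg: "elt1a K u' (k_msg K b)" using K by (simp add: state_ok_def)
    show ?thesis
    proof (rule ccontr)
      assume "\<not> ?thesis"
      then have all: "[f (masked K b x) = f' (masked K b x)] (mod q)" if "x \<in> asns" for x using that by blast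
      let ?G = "\<lambda>x. (c - c') * (k_msg K b x + x Alpha * x CtS) + (h x + (- 1) * h' x)"
      have "[?G (witness Q i S) = 0] (mod q)" for i S
      proof -
        let ?x = "witness Q i S" and ?t = "\<lambda>x. (k_msg K b x + x Alpha * x CtS) mod q"
        have "[c * ?t ?x + h ?x = c' * ?t ?x + h' ?x] (mod q)"
          using all[OF witness_asns, of Q i S] unfolding h(3) h'(3) hx cong_mod_left cong_mod_right
          by (simp add: masked_def)
        then have "[(c - c') * ?t ?x + (h ?x + (- 1) * h' ?x) = 0] (mod q)"
          by (simp add: cong_iff_dvd_diff algebra_simps)
        moreover have "[?G ?x = (c - c') * ?t ?x + (h ?x + (- 1) * h' ?x)] (mod q)"
          by (intro cong_add cong_mult cong_refl) simp
        ultimately show ?thesis by (rule cong_trans[rotated])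
      qed
      then have "[signed_sum K Q ?G = signed_sum K Q (\<lambda>_. 0)] (mod q)" by (rule signed_sum_cong)
      then have "q dvd signed_sum K Q ?G" by (simp add: signed_sum_def cong_0_iff)
      then have "q dvd (c - c') * (signed_sum K Q (k_msg K b) + signed_sum K Q (\<lambda>x. x Alpha * x CtS)) + (signed_sum K Q h + (- 1) * signed_sum K Q h')"
        by (simp only: signed_sum_add signed_sum_cmult)
      moreover have "q dvd signed_sum K Q (k_msg K b)" "q dvd signed_sum K Q h" "q dvd signed_sum K Q h'"
        using signed_sum_elt1a[OF _ K P Q] msg h(1) h'(1) by auto
      ultimately have "q dvd (c - c') * signed_sum K Q (\<lambda>x. x Alpha * x CtS)"
        by (metis (no_types, lifting) distrib_left dvd_add dvd_add_right_iff dvd_add_left_iff dvd_mult)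
      then have "q dvd c - c'"
        using signed_sum_challenge[OF K, of Q] prime_p by (auto simp: prime_dvd_mult_iff)
      then show False using False by (simp add: cong_iff_dvd_diff)
    qed
  qed
qed

lemma laurent_masked:
  assumes "elt_of K u g f" "state_ok K u"
  shows "laurent (4 + 4 * u) (\<lambda>x. f (masked K b x))"
proof (cases g)
  case Src
  then have f: "elt0 K u f" using assms by (simp add: elt_of_def)
  have "laurent (4 + 4 * u) f" by (rule laurent_mono[OF elt0_laurent[OF f]]) simp
  then show ?thesis using depends_on_masked[OF elt0_depends_on[OF f assms(2)]] by simp
next
  case Tgt
  then have "elt1 K u f" using assms by (simp add: elt_of_def)
  then obtain h c where h': "elt1a K u h" "k_pol K = None \<longrightarrow> c = 0" "\<forall>x. f x = (c * x Theta + h x) mod q"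
    by (rule elt1E)
  note h = h'(1) h'(3)[rule_format]
  have "elt1a K u (k_msg K b)" using assms(2) by (simp add: state_ok_def)
  then have "laurent (4 + 4 * u) (k_msg K b)" by (rule elt1a_laurent)
  moreover have "laurent (4 + 4 * u) (\<lambda>x. x Alpha * x CtS)"
    by (rule laurent_mono[OF laurent_mult[OF laurent_var laurent_var]]) simp
  ultimately have "laurent (4 + 4 * u) (\<lambda>x. k_msg K b x + x Alpha * x CtS)" by (rule laurent_add)
  then have "laurent (4 + 4 * u) (\<lambda>x. (c * ((k_msg K b x + x Alpha * x CtS) mod q) + h x) mod q)"
    unfolding laurent_mod by (intro laurent_add laurent_cmult elt1a_laurent[OF h(1)]) (simp add: laurent_mod)
  moreover have "f (masked K b x) = (c * ((k_msg K b x + x Alpha * x CtS) mod q) + h x) mod q" for x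
    unfolding h(2) using depends_on_masked[OF elt1a_depends_on[OF h(1) assms(2)]] by (simp add: masked_def)
  ultimately show ?thesis by simp
qed

lemma depends_on_elt_of_masked:
  assumes "elt_of K u g f" "state_ok K u" "k_pol K = None \<or> CtS \<in> V" "vars K \<subseteq> V"
    and eq: "\<And>v. v \<in> V \<Longrightarrow> x v = y v"
  shows "f (masked K b x) = f (masked K b y)"
proof (cases g)
  case Src
  then have f: "elt0 K u f" using assms by (simp add: elt_of_def)
  have "f x = f y"
    by (rule depends_onD[OF elt0_depends_on[OF f assms(2)]]) (use assms in auto)
  then show ?thesis using depends_on_masked[OF elt0_depends_on[OF f assms(2)]] by simp
next
  case Tgt
  then have "elt1 K u f" using assms by (simp add: elt_of_def)
  then obtain h c where h': "elt1a K u h" "k_pol K = None \<longrightarrow> c = 0" "\<forall>x. f x = (c * x Theta + h x) mod q"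
    by (rule elt1E)
  note h = h'(1,2) h'(3)[rule_format]
  have m: "elt1a K u (k_msg K b)" using assms(2) by (simp add: state_ok_def)
  have "h x = h y" "k_msg K b x = k_msg K b y"
    by (rule depends_onD[OF elt1a_depends_on[OF h(1) assms(2)]] depends_onD[OF elt1a_depends_on[OF m assms(2)]]; use assms in auto)+
  moreover have "x Alpha = y Alpha" using assms by (auto simp: vars_def)
  moreover have "c = 0 \<or> x CtS = y CtS" using assms h(2) by auto
  ultimately show ?thesis
    unfolding h(3) depends_on_masked[OF elt1a_depends_on[OF h(1) assms(2)]] by (auto simp: masked_def)
qed

text \<open>\<open>not_elt_eq_masked\<close> supplies the point with nonzero difference that
  \<open>schwartz_zippel\<close> starts from. The two elements depend on \<open>vars K\<close>
  alone, so the values of this point elsewhere drop out.\<close>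

lemma collision_prob:
  assumes K: "state_ok K u" and f: "elt_of K u g f" "elt_of K u g f'" and ne: "\<not> elt_eq f f'"
  shows "measure_pmf.prob (rand_asn (vars K)) {x. f (masked K b x) = f' (masked K b x)} \<le>
    card (vars K) * (2 * (4 + 4 * u)) / (p - 1)"
proof -
  let ?F = "\<lambda>x. f (masked K b x) - f' (masked K b x)"
  obtain x0 where x0: "x0 \<in> asns" "\<not> [?F x0 = 0] (mod q)"
    using not_elt_eq_masked[OF K f ne, of b] by (auto simp: cong_iff_dvd_diff)
  have "finite (vars K)" using K by (simp add: state_ok_def finite_vars)
  moreover have "laurent (4 + 4 * u) ?F" by (rule laurent_diff[OF laurent_masked[OF f(1) K] laurent_masked[OF f(2) K]])
  ultimately have "measure_pmf.prob (rand_asn (vars K)) {y. [?F (override_on x0 y (vars K)) = 0] (mod q)} \<le>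
      card (vars K) * (2 * (4 + 4 * u)) / (p - 1)"
    using x0 by (intro schwartz_zippel)
  moreover have "?F (override_on x0 y (vars K)) = ?F y" for y
  proof -
    have "k_pol K = None \<or> CtS \<in> vars K" by (cases "k_pol K") (auto simp: vars_def polvars_def)
    then show ?thesis
      using depends_on_elt_of_masked[OF f(1) K, of "vars K" "override_on x0 y (vars K)" y b]
        depends_on_elt_of_masked[OF f(2) K, of "vars K" "override_on x0 y (vars K)" y b] by simp
  qed
  moreover have "measure_pmf.prob (rand_asn (vars K)) {x. f (masked K b x) = f' (masked K b x)} \<le>
      measure_pmf.prob (rand_asn (vars K)) {x. [?F x = 0] (mod q)}"
    by (intro measure_pmf.finite_measure_mono) auto
  ultimately show ?thesis by simp
qed

section \<open>Sampling the secrets\<close>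

definition group_of :: "(grp \<Rightarrow> enc) \<Rightarrow> grp \<Rightarrow> generic_group" where
  "group_of \<Psi> g = \<lparr>gorder = p, genc = \<Psi> g\<rparr>"

lemma group_of_simps [simp]: "gorder (group_of \<Psi> g) = p" "genc (group_of \<Psi> g) = \<Psi> g"
  by (simp_all add: group_of_def)

lemma gcarrier_group_of: "gcarrier (group_of \<Psi> g) = \<Psi> g ` {0..<q}"
  by (simp add: gcarrier_def)

lemma glog_group_of: "\<Psi> g \<in> encs \<Longrightarrow> v \<in> {0..<q} \<Longrightarrow> glog (group_of \<Psi> g) (\<Psi> g v) = v"
  unfolding glog_def encs_def by (simp add: inv_into_f_f)

lemma group_of_ops:
  assumes "\<Psi> g \<in> encs" "v \<in> {0..<q}" "w \<in> {0..<q}"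
  shows "gmul (group_of \<Psi> g) (\<Psi> g v) (\<Psi> g w) = \<Psi> g ((v + w) mod q)"
    and "ginv (group_of \<Psi> g) (\<Psi> g v) = \<Psi> g ((- v) mod q)"
    and "gpow (group_of \<Psi> g) (\<Psi> g v) a = \<Psi> g ((v * a) mod q)"
  using assms by (simp_all add: gmul_def ginv_def gpow_def glog_group_of)

lemma group_of_pairing:
  assumes "\<Psi> Src \<in> encs" "v \<in> {0..<q}" "w \<in> {0..<q}"
  shows "pairing (group_of \<Psi> Src) (group_of \<Psi> Tgt) (\<Psi> Src v) (\<Psi> Src w) = \<Psi> Tgt ((v * w) mod q)"
  using assms by (simp add: pairing_def glog_group_of)

lemma group_of_gpow_gen: "\<Psi> g \<in> encs \<Longrightarrow> gpow (group_of \<Psi> g) (ggen (group_of \<Psi> g)) a = \<Psi> g (a mod q)"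
  using group_of_ops(3)[of \<Psi> g 1 1 a] p_gt2 by (simp add: ggen_def)

lemma scalar_var_pmf: "(\<And>i. v \<noteq> Beta i) \<Longrightarrow> scalar p = var_pmf v"
  by (cases v) (auto simp: scalar_def var_pmf_def)

lemma nonzero_scalar_var_pmf: "nonzero_scalar p = var_pmf (Beta i)"
  by (simp add: nonzero_scalar_def var_pmf_def)

lemma rand_asn_insert: "finite V \<Longrightarrow> v \<notin> V \<Longrightarrow>
    rand_asn (insert v V) = do {a \<leftarrow> var_pmf v; y \<leftarrow> rand_asn V; return_pmf (y(v := a))}"
  unfolding rand_asn_def by (rule Pi_pmf_insert')

definition hash_fun :: "bits set \<Rightarrow> asn \<Rightarrow> (grp \<Rightarrow> enc) \<Rightarrow> (bits \<rightharpoonup> bits)" where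
  "hash_fun S x \<Psi> a = (if a \<in> S then Some (\<Psi> Src (x (Hsh a))) else None)"

text \<open>Lazy sampling of the random oracle amounts to drawing the variables \<open>Hsh a\<close>
  of the attributes not hashed before; an attribute repeated in the list is found in the map the
  second time.\<close>

lemma hash_all_rand_asn:
  "hash_all (group_of \<Psi> Src) (hash_fun S x \<Psi>) js =
    rand_asn (Hsh ` (set js - S)) \<bind> (\<lambda>y. return_pmf (hash_fun (S \<union> set js) (override_on x y (Hsh ` (set js - S))) \<Psi>))"
proof (induction js arbitrary: S x)
  case Nil
  have "Hsh ` ({} - S) = {}" by simp
  then show ?case by (simp add: bind_return_pmf)
next
  case (Cons j js)
  show ?case
  proof (cases "j \<in> S")
    case True
    then have "j \<in> dom (hash_fun S x \<Psi>)" "set (j # js) - S = set js - S" "S \<union> set (j # js) = S \<union> set js"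
      by (auto simp: hash_fun_def dom_def)
    then show ?thesis by (simp add: Cons.IH bind_return_pmf)
  next
    case False
    then have dom: "j \<notin> dom (hash_fun S x \<Psi>)" by (simp add: hash_fun_def dom_def)
    let ?V = "Hsh ` (set js - insert j S)"
    have V: "Hsh ` (set (j # js) - S) = insert (Hsh j) ?V" using False by auto
    have upd: "(hash_fun S x \<Psi>)(j \<mapsto> \<Psi> Src a) = hash_fun (insert j S) (x(Hsh j := a)) \<Psi>" for a
      by (rule HOL.ext) (auto simp: hash_fun_def)
    have "hash_all (group_of \<Psi> Src) (hash_fun S x \<Psi>) (j # js) =
        scalar p \<bind> (\<lambda>a. hash_all (group_of \<Psi> Src) (hash_fun (insert j S) (x(Hsh j := a)) \<Psi>) js)"
      using dom by (simp add: bind_map_pmf upd)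
    also have "\<dots> = var_pmf (Hsh j) \<bind> (\<lambda>a. rand_asn ?V \<bind> (\<lambda>y. return_pmf (hash_fun (insert j S \<union> set js) (override_on (x(Hsh j := a)) y ?V) \<Psi>)))"
      unfolding Cons.IH by (simp add: scalar_var_pmf[of "Hsh j"])
    also have "\<dots> = var_pmf (Hsh j) \<bind> (\<lambda>a. rand_asn ?V \<bind> (\<lambda>y. return_pmf (hash_fun (S \<union> set (j # js)) (override_on x (y(Hsh j := a)) (insert (Hsh j) ?V)) \<Psi>)))"
    proof -
      have "override_on (x(Hsh j := a)) y ?V = override_on x (y(Hsh j := a)) (insert (Hsh j) ?V)" for y a
        by (rule HOL.ext) (auto simp: override_on_def)
      then show ?thesis by simp
    qed
    also have "\<dots> = rand_asn (insert (Hsh j) ?V) \<bind> (\<lambda>y. return_pmf (hash_fun (S \<union> set (j # js)) (override_on x y (insert (Hsh j) ?V)) \<Psi>))"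
      by (subst rand_asn_insert) (auto simp: bind_assoc_pmf bind_return_pmf)
    finally show ?thesis unfolding V .
  qed
qed

lemma keygen_attrs_rand_asn:
  assumes "distinct js" "gorder G = p"
  shows "keygen_attrs G H r js = rand_asn (KeyRJ k ` set js) \<bind> (\<lambda>y. return_pmf
    (map (\<lambda>j. (j, gmul G (gpow G (ggen G) r) (gpow G (H j) (y (KeyRJ k j))), gpow G (ggen G) (y (KeyRJ k j)))) js))"
  using assms(1)
proof (induction js)
  case Nil
  then show ?case by (simp add: bind_return_pmf)
next
  case (Cons j js)
  have "rand_asn (KeyRJ k ` set (j # js)) = do {a \<leftarrow> var_pmf (KeyRJ k j); y \<leftarrow> rand_asn (KeyRJ k ` set js); return_pmf (y(KeyRJ k j := a))}"
    using Cons.prems by (simp add: rand_asn_insert image_iff)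
  then show ?case
    using Cons assms(2)
    by (simp add: bind_assoc_pmf bind_return_pmf scalar_var_pmf[of "KeyRJ k j"])
       (intro bind_pmf_cong refl arg_cong[where f = return_pmf], auto)
qed

lemma coeff_Poly_upt: "coeff (Poly (c # map f [1..<k])) n = (if n = 0 then c else if n < k then f n else (0 :: int))"
  by (cases n) (auto simp: coeff_Poly_eq nth_default_def simp del: Poly.simps)

text \<open>The admissible polynomials correspond bijectively to the choices of the coefficients of
  degree \<open>1\<close> to \<open>k - 1\<close>, the constant one being prescribed.\<close>

lemma random_poly_rand_asn:
  assumes "c \<in> {0..<q}"
  shows "random_poly p (k - 1) c = rand_asn (CtQ i ` {1..<k}) \<bind> (\<lambda>y. return_pmf (Poly (c # map (\<lambda>j. y (CtQ i j)) [1..<k])))"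
proof -
  let ?V = "CtQ i ` {1..<k}"
  let ?f = "\<lambda>y. Poly (c # map (\<lambda>j. y (CtQ i j)) [1..<k]) :: int poly"
  let ?D = "PiE_dflt ?V 1 var_range"
  have coeff: "coeff (?f y) n = (if n = 0 then c else if n < k then y (CtQ i n) else 0)" for y n
    by (rule coeff_Poly_upt)
  have rand_asn: "rand_asn ?V = pmf_of_set ?D"
    unfolding rand_asn_def var_pmf_def by (subst Pi_pmf_of_set) (auto simp: var_range_props)
  have fin: "finite ?D" by (intro finite_PiE_dflt) (auto simp: var_range_props)
  have ne: "?D \<noteq> {}" by (simp add: PiE_dflt_empty_iff var_range_props)
  have inj: "inj_on ?f ?D"
  proof (rule inj_onI)
    fix y y' assume y: "y \<in> ?D" "y' \<in> ?D" "?f y = ?f y'"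
    show "y = y'"
    proof
      fix v
      show "y v = y' v"
      proof (cases "v \<in> ?V")
        case True
        then obtain j where "v = CtQ i j" "1 \<le> j" "j < k" by auto
        then show ?thesis using coeff[of y j] coeff[of y' j] y(3) by simp
      next
        case False
        then show ?thesis using y(1,2) by (auto simp: PiE_dflt_def)
      qed
    qed
  qed
  have "{r. degree r \<le> k - 1 \<and> (\<forall>i. coeff r i \<in> {0..<q}) \<and> poly r 0 = c} = ?f ` ?D" (is "?L = _")
  proof (intro equalityI subsetI)
    fix r assume r: "r \<in> ?L"
    define y where "y v = (if v \<in> ?V then (case v of CtQ _ j \<Rightarrow> coeff r j | _ \<Rightarrow> 1) else 1)" for v
    have "y \<in> ?D" using r by (auto simp: PiE_dflt_def y_def)
    moreover have "r = ?f y"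
    proof (rule poly_eqI)
      fix n
      have "coeff r n = 0" if "k \<le> n" "n \<noteq> 0"
        using r that by (intro coeff_eq_0) auto
      then show "coeff r n = coeff (?f y) n"
        using r unfolding coeff by (auto simp: y_def poly_0_coeff_0)
    qed
    ultimately show "r \<in> ?f ` ?D" by blast
  next
    fix r assume "r \<in> ?f ` ?D"
    then obtain y where y: "y \<in> ?D" "r = ?f y" by blast
    have var_range: "y (CtQ i n) \<in> {0..<q}" if "1 \<le> n" "n < k" for n
    proof -
      have "CtQ i n \<in> ?V" using that by auto
      then have "y (CtQ i n) \<in> var_range (CtQ i n)" using y(1) unfolding PiE_dflt_def by blast
      then show ?thesis by simp
    qed
    have "degree r \<le> k - 1"
      unfolding y(2) by (rule degree_le) (use coeff in auto)
    moreover have "coeff r n \<in> {0..<q}" for n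
      unfolding y(2) coeff using var_range[of n] assms by auto
    moreover have "poly r 0 = c" using coeff[of y 0] by (simp add: y(2) poly_0_coeff_0)
    ultimately show "r \<in> ?L" by (intro CollectI conjI allI)
  qed
  then have "random_poly p (k - 1) c = map_pmf ?f (rand_asn ?V)"
    unfolding random_poly_def rand_asn by (simp only: map_pmf_of_set_inj[OF inj ne fin])
  then show ?thesis by (simp add: map_pmf_def)
qed

lemma random_poly_0: "c \<in> {0..<q} \<Longrightarrow> random_poly p 0 c = return_pmf [:c:]"
  using random_poly_rand_asn[of c 1 i] by (simp add: bind_return_pmf)

lemma poly_Poly_upt: "poly (Poly (c # map f [1..<k])) a = c + (\<Sum>j=1..<k. f j * (a :: int) ^ j)"
proof -
  let ?r = "Poly (c # map f [1..<k])"
  have coeff: "coeff ?r n = (if n = 0 then c else if n < k then f n else 0)" for n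
    by (rule coeff_Poly_upt)
  have "degree ?r < Suc k"
    using degree_le[of k ?r] coeff by simp
  from poly_coeffs_sum[OF this, of a] have "poly ?r a = c + (\<Sum>j=1..<Suc k. coeff ?r j * a ^ j)"
    by (simp add: coeff)
  also have "(\<Sum>j=1..<Suc k. coeff ?r j * a ^ j) = (\<Sum>j=1..<k. f j * a ^ j)"
    by (rule sum.mono_neutral_cong_right) (auto simp: coeff simp del: Poly.simps coeff_Poly_eq One_nat_def)
  finally show ?thesis .
qed

lemma qvars_disjoint:
  assumes "set (node_indices x) \<inter> set (concat (map node_indices xs)) = {}"
  shows "qvars x \<inter> \<Union> (set (map qvars xs)) = {}"
proof (intro equals0I, elim IntE)
  fix v assume v: "v \<in> qvars x" "v \<in> \<Union> (set (map qvars xs))"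
  then obtain y where y: "y \<in> set xs" "v \<in> qvars y" by auto
  obtain i j where "v = CtQ i j" "i \<in> set (node_indices x)" using qvars_CtQ[OF v(1)] by blast
  moreover obtain i' j' where "v = CtQ i' j'" "i' \<in> set (node_indices y)" using qvars_CtQ[OF y(2)] by blast
  ultimately show False using assms y(1) by auto
qed

text \<open>The recursive sampling becomes a single draw of all coefficients. Distinct node indices
  make the variables of different subtrees disjoint, so that independent draws combine by
  \<open>rand_asn_union\<close>.\<close>

lemma share_rand_asn:
  assumes "valid_thresholds P" "distinct (node_indices P)" "c \<in> {0..<q}"
  shows "share p P c = rand_asn (qvars P) \<bind> (\<lambda>y. return_pmf (shares (coefs y) P c))"
  using assms
proof (induction P arbitrary: c)
  case (Leaf i a)
  then show ?case by (simp add: random_poly_0 bind_return_pmf)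
next
  case (Gate i k cs)
  let ?U = "\<lambda>xs. \<Union> (set (map qvars xs))"
  have children: "share_children p r xs = rand_asn (?U xs) \<bind>
      (\<lambda>y. return_pmf (concat (map (\<lambda>x. shares (coefs y) x (poly r (int (node_index x)) mod q)) xs)))"
    if "set xs \<subseteq> set cs" "distinct (concat (map node_indices xs))" for r xs
    using that
  proof (induction xs)
    case Nil
    then show ?case by (simp add: bind_return_pmf)
  next
    case (Cons x xs)
    have disj: "qvars x \<inter> ?U xs = {}" using Cons.prems by (intro qvars_disjoint) auto
    have x: "share p x c' = rand_asn (qvars x) \<bind> (\<lambda>y. return_pmf (shares (coefs y) x c'))" if "c' \<in> {0..<q}" for c'
      using Cons.prems Gate.prems that by (intro Gate.IH) auto
    have rand_asn: "rand_asn (?U (x # xs)) = do {y \<leftarrow> rand_asn (qvars x); z \<leftarrow> rand_asn (?U xs); return_pmf (override_on y z (?U xs))}"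
      using rand_asn_union[OF _ _ disj] by simp
    have eq1: "shares (coefs (override_on y z (?U xs))) x c' = shares (coefs y) x c'" for y z c'
      using disj by (intro shares_cong) (auto simp: override_on_def)
    have eq2: "map (\<lambda>w. shares (coefs (override_on y z (?U xs))) w (poly r (int (node_index w)) mod q)) xs =
        map (\<lambda>w. shares (coefs z) w (poly r (int (node_index w)) mod q)) xs" for y z
      by (intro map_cong refl shares_cong) (auto simp: override_on_def)
    have "share_children p r (x # xs) = rand_asn (qvars x) \<bind> (\<lambda>y. rand_asn (?U xs) \<bind> (\<lambda>z. return_pmf
        (shares (coefs y) x (poly r (int (node_index x)) mod q) @
          concat (map (\<lambda>w. shares (coefs z) w (poly r (int (node_index w)) mod q)) xs))))"
      using Cons by (simp add: x bind_assoc_pmf bind_return_pmf)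
    also have "\<dots> = rand_asn (?U (x # xs)) \<bind>
        (\<lambda>y. return_pmf (concat (map (\<lambda>w. shares (coefs y) w (poly r (int (node_index w)) mod q)) (x # xs))))"
      by (simp only: rand_asn bind_assoc_pmf bind_return_pmf) (simp only: list.map concat.simps eq1 eq2)
    finally show ?case .
  qed
  let ?V = "CtQ i ` {1..<k}"
  have disj: "?V \<inter> ?U cs = {}"
  proof (intro equals0I, elim IntE)
    fix v assume v: "v \<in> ?V" "v \<in> ?U cs"
    then obtain y where y: "y \<in> set cs" "v \<in> qvars y" by auto
    then show False using v(1) qvars_CtQ[OF y(2)] Gate.prems(2) by auto
  qed
  have "share p (Gate i k cs) c = rand_asn ?V \<bind> (\<lambda>y. rand_asn (?U cs) \<bind> (\<lambda>z. return_pmf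
      (concat (map (\<lambda>x. shares (coefs z) x ((c + (\<Sum>j=1..<k. y (CtQ i j) * int (node_index x) ^ j)) mod q)) cs))))"
    using Gate.prems children[of cs]
    by (simp add: random_poly_rand_asn[where i = i] bind_assoc_pmf bind_return_pmf poly_Poly_upt del: Union_iff UN_simps Poly.simps One_nat_def)
  also have "\<dots> = rand_asn ?V \<bind> (\<lambda>y. rand_asn (?U cs) \<bind> (\<lambda>z. return_pmf
      (shares (coefs (override_on y z (?U cs))) (Gate i k cs) c)))"
  proof -
    have eq1: "(\<Sum>j=1..<k. override_on y z (?U cs) (CtQ i j) * int (node_index x) ^ j) =
        (\<Sum>j=1..<k. y (CtQ i j) * int (node_index x) ^ j)" for y z x
    proof (intro sum.cong refl)
      fix j assume "j \<in> {1..<k}"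
      then have "CtQ i j \<notin> ?U cs" using disj by blast
      then show "override_on y z (?U cs) (CtQ i j) * int (node_index x) ^ j = y (CtQ i j) * int (node_index x) ^ j"
        by (simp only: override_on_def if_False)
    qed
    have eq2: "map (\<lambda>w. shares (coefs (override_on y z (?U cs))) w (h w)) cs =
        map (\<lambda>w. shares (coefs z) w (h w)) cs" for y z h
      by (intro map_cong refl shares_cong) (auto simp: override_on_def)
    show ?thesis by (simp only: shares.simps eq1 eq2)
  qed
  also have "\<dots> = rand_asn (?V \<union> ?U cs) \<bind> (\<lambda>y. return_pmf (shares (coefs y) (Gate i k cs) c))"
    by (subst rand_asn_union[OF _ _ disj]) (auto simp: bind_assoc_pmf bind_return_pmf)
  finally show ?case by simp
qed

text \<open>The inner factors cancel in pairs \<open>X i * Y i\<close>. With \<beta>'s for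
  \<open>X\<close> and inverses for \<open>Y\<close> this collapses the product of ciphertext update
  quantities; with the roles exchanged, that of the key update quantities.\<close>

lemma cong_prod_tele:
  fixes v n :: nat
  assumes "v \<le> n" "\<And>i. [X i * Y i = 1] (mod q)"
  shows "[(\<Prod>i\<in>{v + 1..n}. X i * Y (i - 1) mod q) = X n * Y v] (mod q)"
  using assms(1)
proof (induction n rule: dec_induct)
  case base
  then show ?case using assms(2) by (simp add: cong_sym)
next
  case (step n)
  have "{v + 1..Suc n} = insert (Suc n) {v + 1..n}" using step by auto
  then have "(\<Prod>i\<in>{v + 1..Suc n}. X i * Y (i - 1) mod q) = (X (Suc n) * Y n mod q) * (\<Prod>i\<in>{v + 1..n}. X i * Y (i - 1) mod q)"
    by simp
  also have "[\<dots> = (X (Suc n) * Y n) * (X n * Y v)] (mod q)"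
    by (intro cong_mult step.IH) simp
  also have "(X (Suc n) * Y n) * (X n * Y v) = (X n * Y n) * (X (Suc n) * Y v)" by simp
  also have "[\<dots> = 1 * (X (Suc n) * Y v)] (mod q)"
    by (intro cong_mult assms(2) cong_refl)
  finally show ?case by simp
qed

end

section \<open>Sizes of policies and attribute lists, bounded by the length of the query\<close>

lemma length_write_sexp_pos: "1 \<le> length (write_sexp t)"
  by (cases t) auto

lemma length_concat_ge: "(\<And>x. x \<in> set xs \<Longrightarrow> f x \<le> length (h x)) \<Longrightarrow> sum_list (map f xs) \<le> length (concat (map h xs))"
  by (induction xs) (auto intro!: add_mono)

lemma length_write_list: "length ts \<le> length (concat (map write_sexp ts))"
  using length_concat_ge[of ts "\<lambda>_. 1" write_sexp] length_write_sexp_pos by (simp add: sum_list_triv)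

lemma length_write_policy: "length (node_indices P) \<le> length (write_sexp (policy_sexp P))"
proof (induction P)
  case (Gate i k cs)
  have "sum_list (map (\<lambda>x. length (node_indices x)) cs) \<le> length (concat (map (\<lambda>x. write_sexp (policy_sexp x)) cs))"
    using Gate by (intro length_concat_ge) auto
  then show ?case by (simp add: length_concat o_def)
qed simp

lemma length_write_challenge: "length (node_indices P) \<le> length (write_query (Challenge m0 m1 P))"
  using length_write_policy[of P] by (simp add: write_query_def)

lemma length_write_gen: "length js \<le> length (write_query (Gen_DK js))"
  using length_write_list[of "map Atom js"] by (simp add: write_query_def)

lemma length_leaf_attrs: "length (leaf_attrs P) \<le> length (node_indices P)"
proof (induction P)
  case (Gate i k cs)
  then have "sum_list (map (\<lambda>x. length (leaf_attrs x)) cs) \<le> sum_list (map (\<lambda>x. length (node_indices x)) cs)"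
    by (intro sum_list_mono) auto
  then show ?case by (simp add: length_concat o_def)
qed simp

text \<open>A gate of threshold \<open>k\<close> has \<open>k - 1\<close> free coefficients, fewer
  than it has children, so each coefficient can be charged to a child.\<close>

lemma card_qvars: "valid_thresholds P \<Longrightarrow> Suc (card (qvars P)) \<le> length (node_indices P)"
proof (induction P)
  case (Gate i k cs)
  have "card (\<Union> (set (map qvars xs))) + length xs \<le> sum_list (map (\<lambda>x. length (node_indices x)) xs)"
    if "set xs \<subseteq> set cs" for xs
    using that
  proof (induction xs)
    case (Cons x xs)
    have "card (\<Union> (set (map qvars (x # xs)))) \<le> card (qvars x) + card (\<Union> (set (map qvars xs)))"
      by (simp add: card_Un_le)
    moreover have "Suc (card (qvars x)) \<le> length (node_indices x)"
      using Cons.prems Gate by auto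
    ultimately show ?case using Cons by simp
  qed simp
  from this[of cs] have children: "card (\<Union> (set (map qvars cs))) + length cs \<le> sum_list (map (\<lambda>x. length (node_indices x)) cs)"
    by simp
  have "card (qvars (Gate i k cs)) \<le> card (CtQ i ` {1..<k}) + card (\<Union> (set (map qvars cs)))"
    using card_Un_le by simp
  also have "card (CtQ i ` {1..<k}) \<le> k - 1"
    using card_image_le[of "{1..<k}" "CtQ i"] by simp
  finally show ?case using children Gate.prems by (auto simp: length_concat o_def)
qed simp

context bilinear
begin

section \<open>Simulation of the game\<close>

text \<open>The value 1 of the update quantities outside the versions \<open>1\<close> to
  \<open>n\<close> is their default in the initial challenger, so that an update changes them at one
  place only.\<close>

definition real_state :: "sym_state \<Rightarrow> bool \<Rightarrow> asn \<Rightarrow> (grp \<Rightarrow> enc) \<Rightarrow> challenger" where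
  "real_state K b x \<Psi> = (let n = k_ver K in
     \<lparr>ch_ek = EncKey p (\<Psi> Src 1) (\<Psi> Src (x (Beta n))) (\<Psi> Tgt (x Alpha)) n,
      ch_mk = MasterKey (x (Beta n)) (\<Psi> Src (x Alpha)) n,
      ch_ucp = (\<lambda>i. if 1 \<le> i \<and> i \<le> n then x (Beta i) * inv_q (x (Beta (i - 1))) mod q else 1),
      ch_udk = (\<lambda>i. if 1 \<le> i \<and> i \<le> n then x (Beta (i - 1)) * inv_q (x (Beta i)) mod q else 1),
      ch_H = hash_fun (k_hashed K) x \<Psi>,
      ch_asked = set ` set (k_keys K), ch_policy = k_pol K, ch_bit = b\<rparr>)"

lemma hash_fun_cong: "(\<And>a. a \<in> S \<Longrightarrow> x (Hsh a) = y (Hsh a)) \<Longrightarrow> hash_fun S x \<Psi> = hash_fun S y \<Psi>"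
  by (rule HOL.ext) (simp add: hash_fun_def)

definition answered :: "config \<Rightarrow> answer \<Rightarrow> config" where
  "answered c a = c\<lparr>c_state := 2, c_answer := Tape [] (write_answer a), c_query := []\<rparr>"

lemma c_query_answered [simp]: "c_query (answered c a) = []"
  by (simp add: answered_def)

text \<open>
  \<open>s\<close> is a common bound for the sizes of all parts of the symbolic state.
\<close>

definition invar :: "sym_state \<Rightarrow> tab \<Rightarrow> (grp \<Rightarrow> bits set) \<Rightarrow> nat \<Rightarrow> bool" where
  "invar K T R s \<longleftrightarrow> state_ok K s \<and> table_ok T R \<and> card (vars K) \<le> s \<and>
     (\<forall>g. card (T g) \<le> s \<and> card (R g) \<le> s \<and> (\<forall>a\<in>T g. elt_of K s g (fst a)))"

lemma invarD:
  assumes "invar K T R s"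
  shows "state_ok K s" "table_ok T R" "card (vars K) \<le> s" "card (T g) \<le> s" "card (R g) \<le> s"
    "(f, w) \<in> T g \<Longrightarrow> elt_of K s g f" "finite (vars K)"
proof -
  from assms[unfolded invar_def] have *: "card (T g) \<le> s \<and> card (R g) \<le> s \<and> (\<forall>a\<in>T g. elt_of K s g (fst a))" by blast
  then show "card (T g) \<le> s" "card (R g) \<le> s" "(f, w) \<in> T g \<Longrightarrow> elt_of K s g f" by auto
  from assms show K: "state_ok K s" "table_ok T R" "card (vars K) \<le> s" by (auto simp: invar_def)
  show "finite (vars K)" using K(1) by (simp add: state_ok_def finite_vars)
qed

lemma state_ok_mono: "state_ok K u \<Longrightarrow> u \<le> u' \<Longrightarrow> state_ok K u'"
  unfolding state_ok_def using elt1a_mono[of K u _ K u'] by (auto simp: state_le_def)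

lemma state_le_refl [simp]: "state_le K K"
  by (simp add: state_le_def)

lemma invar_step:
  assumes "invar K T R s" "state_le K K'" "state_ok K' s'" "card (vars K') \<le> s'" "s \<le> s'"
  shows "invar K' T R s'"
  unfolding invar_def
proof (intro conjI allI ballI assms invarD(2)[OF assms(1)])
  fix g
  show "card (T g) \<le> s'" "card (R g) \<le> s'" using invarD(4,5)[OF assms(1), of g] assms(5) by simp_all
  show "elt_of K' s' g (fst a)" if "a \<in> T g" for a
    using elt_of_mono[OF invarD(6)[OF assms(1), of "fst a" "snd a" g] assms(2,5)] that by simp
qed

lemma invar_mono: "invar K T R s \<Longrightarrow> s \<le> s' \<Longrightarrow> invar K T R s'"
  using invar_step[of K T R s K s'] invarD[of K T R s] state_ok_mono by auto

lemma elt1_intros: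
  "elt0 K u f \<Longrightarrow> elt0 K u g \<Longrightarrow> elt1 K u (\<lambda>x. (f x * g x) mod q)"
  "elt1 K u f \<Longrightarrow> elt1 K u g \<Longrightarrow> elt1 K u (\<lambda>x. (f x + g x) mod q)"
  "elt1 K u f \<Longrightarrow> elt1 K u (\<lambda>x. (- f x) mod q)"
  "elt1 K u (\<lambda>x. x Alpha mod q)"
proof -
  show "elt1 K u (\<lambda>x. (f x * g x) mod q)" if "elt0 K u f" "elt0 K u g"
    unfolding elt1_def
    by (intro exI[of _ 0] exI[of _ "\<lambda>x. (f x * g x) mod q"]) (simp add: elt1a.pair that)
  show "elt1 K u (\<lambda>x. x Alpha mod q)"
    unfolding elt1_def by (intro exI[of _ 0] exI[of _ "\<lambda>x. x Alpha"]) (simp add: elt1a.alpha)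
  show "elt1 K u (\<lambda>x. (f x + g x) mod q)" if f: "elt1 K u f" and g: "elt1 K u g"
  proof -
    obtain h c where h: "elt1a K u h" "k_pol K = None \<longrightarrow> c = 0" "\<forall>x. f x = (c * x Theta + h x) mod q"
      using f by (rule elt1E)
    obtain h' c' where h': "elt1a K u h'" "k_pol K = None \<longrightarrow> c' = 0" "\<forall>x. g x = (c' * x Theta + h' x) mod q"
      using g by (rule elt1E)
    have "(f x + g x) mod q = ((c + c') * x Theta + (h x + h' x) mod q) mod q" for x
    proof -
      have "(f x + g x) mod q = ((c * x Theta + h x) + (c' * x Theta + h' x)) mod q"
        unfolding spec[OF h(3)] spec[OF h'(3)] by (rule mod_add_eq)
      also have "(c * x Theta + h x) + (c' * x Theta + h' x) = (c + c') * x Theta + (h x + h' x)"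
        by (simp add: distrib_right)
      also have "((c + c') * x Theta + (h x + h' x)) mod q = ((c + c') * x Theta + (h x + h' x) mod q) mod q"
        by (rule mod_add_right_eq[symmetric])
      finally show ?thesis .
    qed
    then show ?thesis
      unfolding elt1_def using h(2) h'(2)
      by (intro exI[of _ "c + c'"] exI[of _ "\<lambda>x. (h x + h' x) mod q"]) (simp add: elt1a.add h(1) h'(1))
  qed
  show "elt1 K u (\<lambda>x. (- f x) mod q)" if f: "elt1 K u f"
  proof -
    obtain h c where h: "elt1a K u h" "k_pol K = None \<longrightarrow> c = 0" "\<forall>x. f x = (c * x Theta + h x) mod q"
      using f by (rule elt1E)
    have "(- f x) mod q = ((- c) * x Theta + (- h x) mod q) mod q" for x
    proof -
      have "(- f x) mod q = (- (c * x Theta + h x)) mod q"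
        unfolding spec[OF h(3)] by (rule mod_minus_eq)
      also have "- (c * x Theta + h x) = (- c) * x Theta + (- h x)" by simp
      also have "((- c) * x Theta + (- h x)) mod q = ((- c) * x Theta + (- h x) mod q) mod q"
        by (rule mod_add_right_eq[symmetric])
      finally show ?thesis .
    qed
    then show ?thesis
      unfolding elt1_def using h(2)
      by (intro exI[of _ "- c"] exI[of _ "\<lambda>x. (- h x) mod q"]) (simp add: elt1a.neg h(1))
  qed
qed

lemma table_value:
  assumes "invar K T R s" "(f, a) \<in> T g" "x \<in> asns" "\<Psi> \<in> consistent T R (masked K b x)"
  shows "\<Psi> g (f (masked K b x)) = a" "f (masked K b x) \<in> {0..<q}" "a \<in> gcarrier (group_of \<Psi> g)"
proof -
  show 1: "\<Psi> g (f (masked K b x)) = a" by (rule consistentD(2)[OF assms(4,2)])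
  show 2: "f (masked K b x) \<in> {0..<q}"
    by (rule elt_of_range[OF invarD(6)[OF assms(1,2)] masked_asns[OF assms(3)]])
  show "a \<in> gcarrier (group_of \<Psi> g)"
    unfolding gcarrier_group_of 1[symmetric] using 2 by blast
qed

end

text \<open>The two summands of the loss: at most \<open>2 * B ^ 2\<close> ordered pairs of entries
  in both groups, each coinciding with probability at most \<open>B\<close> variables times degree
  \<open>2 * (4 + 4 * B)\<close> over \<open>p - 1\<close>; and at most \<open>B\<close> refused
  strings in each of the two groups. \<open>B < p\<close> bounds the table sizes and, at the
  challenge, the number of nodes.\<close>

locale reduction = bilinear p m for p m :: nat +
  fixes A :: machine and B :: nat and \<epsilon> :: real
  assumes B_less: "B < p"
    and eps: "2 * (real B * real B) * (real B * (2 * (4 + 4 * real B)) / (p - 1)) + 2 * (real p * (real B / real (2 ^ m - p))) \<le> \<epsilon>"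
      "\<epsilon> \<le> 1"
begin

text \<open>The outcome makes no reference to the hidden bit, as \<open>simulable\<close> requires;
  a run that has not halted counts as a guess of 0.\<close>

definition guess :: "nat \<Rightarrow> config \<Rightarrow> (grp \<Rightarrow> enc) \<Rightarrow> challenger \<Rightarrow> bool pmf" where
  "guess t c \<Psi> ch = map_pmf (\<lambda>z. c_state (fst z) = 4) (game_steps A (group_of \<Psi> Src) (group_of \<Psi> Tgt) t (c, ch))"

lemma guess_0: "guess 0 c \<Psi> ch = return_pmf (c_state c = 4)"
  by (simp add: guess_def)

lemma guess_halted: "halted c \<Longrightarrow> guess (Suc t) c \<Psi> ch = guess t c \<Psi> ch"
  by (simp add: guess_def game_step_def bind_return_pmf)

lemma guess_coin: "\<not> halted c \<Longrightarrow> c_state c \<noteq> 1 \<Longrightarrow>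
    guess (Suc t) c \<Psi> ch = bernoulli_pmf (1 / 2) \<bind> (\<lambda>coin. guess t (machine_step A coin c) \<Psi> ch)"
  by (simp add: guess_def game_step_def bind_return_pmf bind_assoc_pmf map_bind_pmf)

lemma guess_None: "\<not> halted c \<Longrightarrow> c_state c = 1 \<Longrightarrow> read_query (c_query c) = None \<Longrightarrow>
    guess (Suc t) c \<Psi> ch = guess t (answered c Refused) \<Psi> ch"
  by (simp add: guess_def game_step_def bind_return_pmf bind_assoc_pmf answered_def)

lemma guess_Some: "\<not> halted c \<Longrightarrow> c_state c = 1 \<Longrightarrow> read_query (c_query c) = Some qu \<Longrightarrow>
    guess (Suc t) c \<Psi> ch = respond (group_of \<Psi> Src) (group_of \<Psi> Tgt) ch qu \<bind> (\<lambda>(a, ch'). guess t (answered c a) \<Psi> ch')"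
  by (simp add: guess_def game_step_def bind_return_pmf bind_assoc_pmf map_bind_pmf answered_def case_prod_unfold)

definition goal :: "nat \<Rightarrow> config \<Rightarrow> sym_state \<Rightarrow> tab \<Rightarrow> (grp \<Rightarrow> bits set) \<Rightarrow> bool" where
  "goal t c K T R \<longleftrightarrow> simulable \<epsilon> (masked K) (vars K) T R (\<lambda>b x \<Psi>. guess t c \<Psi> (real_state K b x \<Psi>))"

text \<open>
  A query of length \<open>l\<close> enlarges the state by at most \<open>4 l + 4\<close>, and each symbol of it costs a step.
\<close>

definition bound :: "nat \<Rightarrow> bool" where
  "bound t \<longleftrightarrow> (\<forall>c K T R s. invar K T R s \<longrightarrow> s + 4 * length (c_query c) + 4 * t \<le> B \<longrightarrow> goal t c K T R)"

lemma room: "p < 2 ^ m" "2 * p < 2 ^ m"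
proof -
  have "2 * p < p * p" using p_gt2 by simp
  also have "p * p \<le> p ^ 3" using p_gt2 by (simp add: power3_eq_cube)
  finally show "2 * p < 2 ^ m" using m_large by linarith
  then show "p < 2 ^ m" by linarith
qed

lemma collision_prob:
  assumes invar: "invar K T R s" and s: "s \<le> B"
  shows "measure_pmf.prob (rand_asn (vars K)) {x. collision T (masked K b x)} \<le>
    2 * (real B * real B) * (real B * (2 * (4 + 4 * real B)) / (p - 1))"
proof -
  define I where "I = {(g, a, a'). a \<in> T g \<and> a' \<in> T g \<and> \<not> elt_eq (fst a) (fst a')}"
  let ?E = "\<lambda>(g :: grp, a, a'). {x. fst a (masked K b x) = fst a' (masked K b x)}"
  have finT: "finite (T g)" for g by (rule table_okD(1)[OF invarD(2)[OF invar]])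
  let ?J = "{Src} \<times> T Src \<times> T Src \<union> {Tgt} \<times> T Tgt \<times> T Tgt"
  have IJ: "I \<subseteq> ?J"
  proof
    fix z assume z: "z \<in> I"
    obtain g a a' where "z = (g, a, a')" by (cases z) auto
    then show "z \<in> ?J" using z by (cases g) (auto simp: I_def)
  qed
  have finI: "finite I" by (rule finite_subset[OF IJ]) (simp add: finT)
  have cT: "card (T g) \<le> B" for g using invarD(4)[OF invar, of g] s by simp
  have "card I \<le> card ?J" by (rule card_mono[OF _ IJ]) (simp add: finT)
  also have "\<dots> \<le> card ({Src} \<times> T Src \<times> T Src) + card ({Tgt} \<times> T Tgt \<times> T Tgt)" by (rule card_Un_le)
  also have "\<dots> \<le> B * B + B * B"
    unfolding card_cartesian_product using cT[of Src] cT[of Tgt] by (simp add: add_mono mult_le_mono)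
  finally have "real (card I) \<le> real (B * B + B * B)" by (simp only: of_nat_le_iff)
  then have cardI: "real (card I) \<le> 2 * (real B * real B)" by simp
  let ?d = "real B * (2 * (4 + 4 * real B)) / (p - 1)"
  have each: "measure_pmf.prob (rand_asn (vars K)) (?E z) \<le> ?d" if z: "z \<in> I" for z
  proof -
    obtain g a a' where z': "z = (g, a, a')" by (cases z) auto
    then have a: "a \<in> T g" "a' \<in> T g" "\<not> elt_eq (fst a) (fst a')" using z by (auto simp: I_def)
    have "measure_pmf.prob (rand_asn (vars K)) {x. fst a (masked K b x) = fst a' (masked K b x)} \<le>
        card (vars K) * (2 * (4 + 4 * s)) / (p - 1)"
      using a invarD(6)[OF invar, of "fst a" "snd a" g] invarD(6)[OF invar, of "fst a'" "snd a'" g]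
      by (intro collision_prob[OF invarD(1)[OF invar]]) auto
    also have "\<dots> \<le> ?d"
    proof (intro divide_right_mono)
      have "card (vars K) * (2 * (4 + 4 * s)) \<le> B * (2 * (4 + 4 * B))"
        using invarD(3)[OF invar] s by (intro mult_le_mono add_mono) auto
      then have "real (card (vars K) * (2 * (4 + 4 * s))) \<le> real (B * (2 * (4 + 4 * B)))"
        by (simp only: of_nat_le_iff)
      then show "real (card (vars K) * (2 * (4 + 4 * s))) \<le> real B * (2 * (4 + 4 * real B))" by simp
    qed (use p_gt2 in simp)
    finally show ?thesis by (simp add: z')
  qed
  have sub: "{x. collision T (masked K b x)} \<subseteq> (\<Union>z\<in>I. ?E z)"
  proof
    fix x assume "x \<in> {x. collision T (masked K b x)}"
    then obtain g f w f' w' where fw: "(f, w) \<in> T g" "(f', w') \<in> T g" "w \<noteq> w'" "f (masked K b x) = f' (masked K b x)"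
      unfolding collision_def by auto
    then have "\<not> elt_eq f f'"
      using separatedD[OF table_okD(5)[OF invarD(2)[OF invar]] fw(1,2)] by blast
    then have "(g, (f, w), (f', w')) \<in> I" using fw by (simp add: I_def)
    then show "x \<in> (\<Union>z\<in>I. ?E z)" using fw(4) by (intro UN_I) auto
  qed
  have "measure_pmf.prob (rand_asn (vars K)) {x. collision T (masked K b x)} \<le> measure_pmf.prob (rand_asn (vars K)) (\<Union>z\<in>I. ?E z)"
    by (rule measure_pmf.finite_measure_mono[OF sub]) simp
  also have "\<dots> \<le> (\<Sum>z\<in>I. measure_pmf.prob (rand_asn (vars K)) (?E z))"
    using finI by (intro measure_pmf.finite_measure_subadditive_finite) auto
  also have "\<dots> \<le> real (card I) * ?d"
    by (rule sum_bounded_above) (rule each)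
  also have "\<dots> \<le> 2 * (real B * real B) * ?d"
    using cardI p_gt2 by (intro mult_right_mono) auto
  finally show ?thesis .
qed

lemma goal_0:
  assumes invar: "invar K T R s" and s: "s \<le> B"
  shows "goal 0 c K T R"
  unfolding goal_def guess_0
proof (rule simulable_base[OF invarD(2)[OF invar] invarD(7)[OF invar] masked_asns[of _ K] _ collision_prob[OF invar s]])
  show "f x \<in> {0..<q}" if "(f, w) \<in> T g" "x \<in> asns" for f w x g
    by (rule elt_of_range[OF invarD(6)[OF invar that(1)] that(2)])
  show "card (R g) \<le> B" "card (T g) \<le> p" for g
    using invarD(4,5)[OF invar, of g] s B_less by auto
qed (use eps room in auto)

lemma insert_step:
  assumes invar: "invar K T R s" and f: "elt_of K s g f" and s: "s < B"
    and next_: "\<And>w T'. invar K T' R (Suc s) \<Longrightarrow> simulable \<epsilon> (masked K) (vars K) T' R (\<Phi> w)"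
  shows "simulable \<epsilon> (masked K) (vars K) T R (\<lambda>b x \<Psi>. \<Phi> (\<Psi> g (f (masked K b x))) b x \<Psi>)"
proof (rule simulable_insert[where \<Phi> = \<Phi>, OF invarD(2)[OF invar] invarD(7)[OF invar] masked_asns[of _ K] elt_of_range[OF f]])
  show "card (R g) + card (T g) < 2 ^ m"
    using invarD(4,5)[OF invar, of g] s B_less room by linarith
  show "simulable \<epsilon> (masked K) (vars K) T R (\<Phi> w)" for w
    by (rule next_[OF invar_mono[OF invar]]) simp
  fix w assume ok: "table_ok (T(g := insert (f, w) (T g))) R" and notin: "(f, w) \<notin> T g"
  let ?T = "T(g := insert (f, w) (T g))"
  have invar': "invar K T R (Suc s)" by (rule invar_mono[OF invar]) simp
  have "invar K ?T R (Suc s)"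
    unfolding invar_def
  proof (intro conjI allI ballI ok invarD(1,3)[OF invar'])
    fix h
    show "card (R h) \<le> Suc s" by (rule invarD(5)[OF invar'])
    show "card (?T h) \<le> Suc s"
      using invarD(4)[OF invar, of h] invarD(4)[OF invar', of h] table_okD(1)[OF invarD(2)[OF invar], of h] notin
      by (cases "h = g") auto
    show "elt_of K (Suc s) h (fst a)" if "a \<in> ?T h" for a
    proof (cases "h = g \<and> a = (f, w)")
      case True
      then show ?thesis using elt_of_mono[OF f state_le_refl, of "Suc s"] by simp
    next
      case False
      then have "(fst a, snd a) \<in> T h" using that by (cases "h = g") auto
      then show ?thesis by (rule invarD(6)[OF invar'])
    qed
  qed
  then show "simulable \<epsilon> (masked K) (vars K) ?T R (\<Phi> w)" by (rule next_)
qed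

lemma insert_list_step:
  assumes "invar K T R s" "\<And>g f. (g, f) \<in> set fs \<Longrightarrow> elt_of K s g f" "s + length fs \<le> B"
    and "\<And>ws T'. invar K T' R (s + length fs) \<Longrightarrow> simulable \<epsilon> (masked K) (vars K) T' R (\<Phi> ws)"
  shows "simulable \<epsilon> (masked K) (vars K) T R (\<lambda>b x \<Psi>. \<Phi> (map (\<lambda>(g, f). \<Psi> g (f (masked K b x))) fs) b x \<Psi>)"
  using assms
proof (induction fs arbitrary: T s \<Phi>)
  case Nil
  then show ?case by simp
next
  case (Cons a fs)
  obtain g f where a: "a = (g, f)" by (cases a)
  have "simulable \<epsilon> (masked K) (vars K) T R
      (\<lambda>b x \<Psi>. (\<lambda>w b x \<Psi>. \<Phi> (w # map (\<lambda>(g, f). \<Psi> g (f (masked K b x))) fs) b x \<Psi>) (\<Psi> g (f (masked K b x))) b x \<Psi>)"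
  proof (rule insert_step[where \<Phi> = "\<lambda>w b x \<Psi>. \<Phi> (w # map (\<lambda>(g, f). \<Psi> g (f (masked K b x))) fs) b x \<Psi>", OF Cons.prems(1)])
    show "elt_of K s g f" using Cons.prems(2) a by simp
    show "s < B" using Cons.prems(3) by simp
    fix w T' assume invar': "invar K T' R (Suc s)"
    show "simulable \<epsilon> (masked K) (vars K) T' R (\<lambda>b x \<Psi>. \<Phi> (w # map (\<lambda>(g, f). \<Psi> g (f (masked K b x))) fs) b x \<Psi>)"
    proof (rule Cons.IH[of T' "Suc s" "\<lambda>ws. \<Phi> (w # ws)", OF invar'])
      show "elt_of K (Suc s) g f" if "(g, f) \<in> set fs" for g f
        using elt_of_mono[OF Cons.prems(2)[of g f] state_le_refl, of "Suc s"] that by simp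
      show "Suc s + length fs \<le> B" using Cons.prems(3) by simp
      show "simulable \<epsilon> (masked K) (vars K) T' R (\<Phi> (w # ws))" if "invar K T' R (Suc s + length fs)" for ws T'
        using Cons.prems(4)[of T' "w # ws"] that by simp
    qed
  qed
  then show ?case by (simp add: a)
qed

lemma goalI: "bound t \<Longrightarrow> invar K T R s \<Longrightarrow> s + 4 * t \<le> B \<Longrightarrow> goal t (answered c a) K T R"
  unfolding bound_def by simp

text \<open>For answers that involve no new secrets: the answer is a function \<open>ans\<close> of
  the strings of a list \<open>fs\<close> of symbolic elements, which enter the table one after
  another.\<close>

lemma pure_step:
  assumes "bound t" and invar: "invar K T R s"
    and fs: "\<And>g f. (g, f) \<in> set fs \<Longrightarrow> elt_of K s g f" and s: "s + length fs + 4 * t \<le> B"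
    and \<Phi>: "\<And>b x \<Psi>. x \<in> asns \<Longrightarrow> \<Psi> \<in> consistent T R (masked K b x) \<Longrightarrow>
      \<Phi> b x \<Psi> = guess t (answered c (ans (map (\<lambda>(g, f). \<Psi> g (f (masked K b x))) fs))) \<Psi> (real_state K b x \<Psi>)"
  shows "simulable \<epsilon> (masked K) (vars K) T R \<Phi>"
proof (rule simulable_cong)
  show "\<Phi> b x \<Psi> = (\<lambda>ws b x \<Psi>. guess t (answered c (ans ws)) \<Psi> (real_state K b x \<Psi>)) (map (\<lambda>(g, f). \<Psi> g (f (masked K b x))) fs) b x \<Psi>"
    if "x \<in> set_pmf (rand_asn (vars K))" "\<Psi> \<in> consistent T R (masked K b x)" for b x \<Psi>
    using \<Phi>[OF rand_asn_asns[OF invarD(7)[OF invar] that(1)] that(2)] by simp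
  show "simulable \<epsilon> (masked K) (vars K) T R (\<lambda>b x \<Psi>. (\<lambda>ws b x \<Psi>. guess t (answered c (ans ws)) \<Psi> (real_state K b x \<Psi>))
      (map (\<lambda>(g, f). \<Psi> g (f (masked K b x))) fs) b x \<Psi>)"
  proof (rule insert_list_step[OF invar fs])
    show "simulable \<epsilon> (masked K) (vars K) T' R (\<lambda>b x \<Psi>. guess t (answered c (ans ws)) \<Psi> (real_state K b x \<Psi>))"
      if "invar K T' R (s + length fs)" for ws T'
      using goalI[OF assms(1) that s] unfolding goal_def .
    show "s + length fs \<le> B" using s by linarith
  qed
qed

text \<open>A submitted string without a table entry was never handed out. If its length is wrong it
  encodes nothing; otherwise it is added to \<open>R\<close>, which commits the encodings to avoid
  it from now on.\<close>

lemma refuse_step: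
  assumes "bound t" and invar: "invar K T R s" and a: "a \<notin> snd ` T g" and s: "Suc s + 4 * t \<le> B"
    and \<Phi>: "\<And>b x \<Psi>. x \<in> asns \<Longrightarrow> a \<notin> gcarrier (group_of \<Psi> g) \<Longrightarrow> \<Phi> b x \<Psi> = guess t (answered c Refused) \<Psi> (real_state K b x \<Psi>)"
  shows "simulable \<epsilon> (masked K) (vars K) T R \<Phi>"
proof (cases "a \<in> words")
  case False
  have "\<Phi> b x \<Psi> = guess t (answered c Refused) \<Psi> (real_state K b x \<Psi>)"
    if x: "x \<in> set_pmf (rand_asn (vars K))" and \<Psi>: "\<Psi> \<in> consistent T R (masked K b x)" for b x \<Psi>
  proof (rule \<Phi>[OF rand_asn_asns[OF invarD(7)[OF invar] x]])
    have "\<Psi> g \<in> encs" by (rule consistentD(1)[OF \<Psi>])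
    then show "a \<notin> gcarrier (group_of \<Psi> g)" using False by (auto simp: gcarrier_group_of encs_def)
  qed
  then show ?thesis
    by (rule simulable_cong) (use goalI[OF assms(1) invar, of c Refused] s in \<open>auto simp: goal_def\<close>)
next
  case True
  let ?R = "R(g := insert a (R g))"
  have invar': "invar K T R (Suc s)" by (rule invar_mono[OF invar]) simp
  have "invar K T ?R (Suc s)"
    unfolding invar_def
  proof (intro conjI allI ballI table_ok_refuse[OF invarD(2)[OF invar] True a] invarD(1,3,4)[OF invar'])
    fix h
    show "card (?R h) \<le> Suc s"
      using card_insert_le_m1[of "Suc s" "R g" a] invarD(5)[OF invar, of g] invarD(5)[OF invar', of h]
      by (cases "h = g") auto
    show "elt_of K (Suc s) h (fst a)" if "a \<in> T h" for a
      using invarD(6)[OF invar', of "fst a" "snd a" h] that by simp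
  qed
  then have goal: "simulable \<epsilon> (masked K) (vars K) T ?R (\<lambda>b x \<Psi>. guess t (answered c Refused) \<Psi> (real_state K b x \<Psi>))"
    using goalI[OF assms(1) _ s] unfolding goal_def by blast
  show ?thesis
  proof (rule simulable_refuse[OF invarD(2)[OF invar] True a invarD(7)[OF invar] _ eps(2)])
    show "simulable \<epsilon> (masked K) (vars K) T ?R \<Phi>"
    proof (rule simulable_cong[OF _ goal])
      fix b x \<Psi> assume x: "x \<in> set_pmf (rand_asn (vars K))" and \<Psi>: "\<Psi> \<in> consistent T ?R (masked K b x)"
      have "\<Psi> g v \<noteq> a" if "v \<in> {0..<q}" for v
        using consistentD(3)[OF \<Psi> that, of g] by auto
      then have "a \<notin> gcarrier (group_of \<Psi> g)" unfolding gcarrier_group_of by blast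
      then show "\<Phi> b x \<Psi> = guess t (answered c Refused) \<Psi> (real_state K b x \<Psi>)"
        by (rule \<Phi>[OF rand_asn_asns[OF invarD(7)[OF invar] x]])
    qed
  qed
qed

text \<open>For answers that draw new secrets \<open>V'\<close>. The condition on
  \<open>k_msg\<close> ensures that the old entries keep their values under \<open>masked\<close>:
  either the message is unchanged, or no challenge has been made, and then no entry contains
  \<open>Theta\<close>.\<close>

lemma fresh_step:
  assumes "bound t" and invar: "invar K T R s" and state_le: "state_le K K'" and invar': "invar K' T R s'"
    and V': "finite V'" "vars K \<inter> V' = {}" "vars K' = vars K \<union> V'"
    and msg: "k_pol K = None \<or> k_msg K' = k_msg K"
    and fs: "\<And>g f. (g, f) \<in> set fs \<Longrightarrow> elt_of K' s' g f" and s: "s' + length fs + 4 * t \<le> B"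
    and \<Phi>: "\<And>b x \<Psi>. x \<in> asns \<Longrightarrow> \<Psi> \<in> consistent T R (masked K b x) \<Longrightarrow>
      \<Phi> b x \<Psi> = rand_asn V' \<bind> (\<lambda>y. let z = override_on x y V' in
        guess t (answered c (ans (map (\<lambda>(g, f). \<Psi> g (f (masked K' b z))) fs))) \<Psi> (real_state K' b z \<Psi>))"
  shows "simulable \<epsilon> (masked K) (vars K) T R \<Phi>"
proof (rule simulable_cong)
  let ?\<Phi>' = "\<lambda>b z \<Psi>. guess t (answered c (ans (map (\<lambda>(g, f). \<Psi> g (f (masked K' b z))) fs))) \<Psi> (real_state K' b z \<Psi>)"
  show "\<Phi> b x \<Psi> = rand_asn V' \<bind> (\<lambda>y. ?\<Phi>' b (override_on x y V') \<Psi>)"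
    if "x \<in> set_pmf (rand_asn (vars K))" "\<Psi> \<in> consistent T R (masked K b x)" for b x \<Psi>
    using \<Phi>[OF rand_asn_asns[OF invarD(7)[OF invar] that(1)] that(2)] by (simp add: Let_def)
  show "simulable \<epsilon> (masked K) (vars K) T R (\<lambda>b x \<Psi>. rand_asn V' \<bind> (\<lambda>y. ?\<Phi>' b (override_on x y V') \<Psi>))"
  proof (rule simulable_fresh[OF invarD(7)[OF invar] V'(1,2)])
    show "simulable \<epsilon> (masked K') (vars K \<union> V') T R ?\<Phi>'"
      unfolding V'(3)[symmetric]
      by (rule pure_step[OF assms(1) invar' fs s]) simp_all
    fix b g f w and x y :: asn assume fw: "(f, w) \<in> T g"
    note elt_of = invarD(6)[OF invar fw] and K = invarD(1)[OF invar]
    have eq: "override_on x y V' v = x v" if "v \<in> vars K" for v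
      using that V'(2) by (auto simp: override_on_def)
    show "f (masked K' b (override_on x y V')) = f (masked K b x)"
    proof (cases "k_pol K = None")
      case False
      have "k_msg K' = k_msg K"
        using msg by (rule disjE) (use False in simp_all)
      then have "masked K' = masked K" by (simp only: masked_def[abs_def])
      moreover have "CtS \<in> vars K" using False by (auto simp: vars_def polvars_def)
      ultimately show ?thesis
        using depends_on_elt_of_masked[OF elt_of K, of "vars K" "override_on x y V'" x b] eq by simp
    next
      case True
      have depends_on: "depends_on (vars K) f"
      proof (cases g)
        case Src
        then show ?thesis using elt_of elt0_depends_on[OF _ K] by (simp add: elt_of_def)
      next
        case Tgt
        then have "elt1 K s f" using elt_of by (simp add: elt_of_def)
        then obtain h c where h: "elt1a K s h" "k_pol K = None \<longrightarrow> c = 0" "\<forall>x. f x = (c * x Theta + h x) mod q"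
          by (rule elt1E)
        have "f = (\<lambda>x. h x mod q)" using h(2,3) True by (simp add: fun_eq_iff)
        then show ?thesis using depends_on_app[OF elt1a_depends_on[OF h(1) K], of "\<lambda>a. a mod q"] by simp
      qed
      have "f (masked K' b (override_on x y V')) = f (override_on x y V')" by (rule depends_on_masked[OF depends_on])
      also have "\<dots> = f x" by (rule depends_onD[OF depends_on eq])
      also have "\<dots> = f (masked K b x)" by (rule depends_on_masked[OF depends_on, symmetric])
      finally show ?thesis .
    qed
  qed
qed

section \<open>The queries, one kind at a time\<close>

definition query_goal :: "nat \<Rightarrow> config \<Rightarrow> sym_state \<Rightarrow> tab \<Rightarrow> (grp \<Rightarrow> bits set) \<Rightarrow> query \<Rightarrow> bool" where
  "query_goal t c K T R qu \<longleftrightarrow> simulable \<epsilon> (masked K) (vars K) T R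
     (\<lambda>b x \<Psi>. respond (group_of \<Psi> Src) (group_of \<Psi> Tgt) (real_state K b x \<Psi>) qu \<bind> (\<lambda>(a, ch'). guess t (answered c a) \<Psi> ch'))"

lemma table_cases:
  obtains "a \<notin> snd ` T g" | f where "(f, a) \<in> T g"
  by force

text \<open>Covers all five group oracles; the inversions are treated as binary operations with the
  argument repeated.\<close>

lemma q_operation:
  assumes "bound t" and invar: "invar K T R s" and s: "s + 1 + 4 * t \<le> B"
    and respond: "\<And>ch \<Psi>. respond (group_of \<Psi> Src) (group_of \<Psi> Tgt) ch qu =
      return_pmf (if a \<in> gcarrier (group_of \<Psi> g) \<and> a' \<in> gcarrier (group_of \<Psi> g) then Elem (op \<Psi> a a') else Refused, ch)"
    and op: "\<And>\<Psi> v v'. (\<And>g. \<Psi> g \<in> encs) \<Longrightarrow> v \<in> {0..<q} \<Longrightarrow> v' \<in> {0..<q} \<Longrightarrow>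
      op \<Psi> (\<Psi> g v) (\<Psi> g v') = \<Psi> g' (F v v')"
    and elt_of: "\<And>f f'. elt_of K s g f \<Longrightarrow> elt_of K s g f' \<Longrightarrow> elt_of K s g' (\<lambda>x. F (f x) (f' x))"
  shows "query_goal t c K T R qu"
proof (cases a T g rule: table_cases)
  case 1
  show ?thesis unfolding query_goal_def
    by (rule refuse_step[OF assms(1) invar 1, where c = c]) (use s in \<open>auto simp: bind_return_pmf respond\<close>)
next
  case (2 f)
  note a = this
  show ?thesis
  proof (cases a' T g rule: table_cases)
    case 1
    show ?thesis unfolding query_goal_def
      by (rule refuse_step[OF assms(1) invar 1, where c = c]) (use s in \<open>auto simp: bind_return_pmf respond\<close>)
  next
    case (2 f')
    let ?fs = "[(g', \<lambda>x. F (f x) (f' x))]"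
    show ?thesis unfolding query_goal_def
    proof (rule pure_step[OF assms(1) invar, where fs = ?fs and ans = "\<lambda>ws. Elem (hd ws)"])
      show "elt_of K s h k" if "(h, k) \<in> set ?fs" for h k
        using that elt_of[OF invarD(6)[OF invar a] invarD(6)[OF invar 2]] by simp
      fix b x \<Psi> assume x: "x \<in> asns" and \<Psi>: "\<Psi> \<in> consistent T R (masked K b x)"
      note va = table_value[OF invar a x \<Psi>] and vb = table_value[OF invar 2 x \<Psi>]
      have "op \<Psi> a a' = \<Psi> g' (F (f (masked K b x)) (f' (masked K b x)))"
        using op[of \<Psi>, OF consistentD(1)[OF \<Psi>] va(2) vb(2)] va(1) vb(1) by simp
      then show "respond (group_of \<Psi> Src) (group_of \<Psi> Tgt) (real_state K b x \<Psi>) qu \<bind> (\<lambda>(a, ch'). guess t (answered c a) \<Psi> ch') =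
          guess t (answered c (Elem (hd (map (\<lambda>(g, f). \<Psi> g (f (masked K b x))) ?fs)))) \<Psi> (real_state K b x \<Psi>)"
        using va(3) vb(3) by (simp add: bind_return_pmf respond)
    qed (use s in simp)
  qed
qed

lemma q_Mul0: "bound t \<Longrightarrow> invar K T R s \<Longrightarrow> s + 1 + 4 * t \<le> B \<Longrightarrow> query_goal t c K T R (Mul0 a a')"
  by (rule q_operation[where a = a and a' = a' and g = Src and g' = Src and op = "\<lambda>\<Psi>. gmul (group_of \<Psi> Src)"
      and F = "\<lambda>v w. (v + w) mod q"];
      (assumption | (simp only: group_of_ops; fail) | auto simp: elt_of_def intro: elt0.add))

lemma q_Mul1: "bound t \<Longrightarrow> invar K T R s \<Longrightarrow> s + 1 + 4 * t \<le> B \<Longrightarrow> query_goal t c K T R (Mul1 a a')"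
  by (rule q_operation[where a = a and a' = a' and g = Tgt and g' = Tgt and op = "\<lambda>\<Psi>. gmul (group_of \<Psi> Tgt)"
      and F = "\<lambda>v w. (v + w) mod q"];
      (assumption | (simp only: group_of_ops; fail) | auto simp: elt_of_def intro: elt1_intros))

lemma q_Pairing: "bound t \<Longrightarrow> invar K T R s \<Longrightarrow> s + 1 + 4 * t \<le> B \<Longrightarrow> query_goal t c K T R (Pairing a a')"
  by (rule q_operation[where a = a and a' = a' and g = Src and g' = Tgt and op = "\<lambda>\<Psi>. pairing (group_of \<Psi> Src) (group_of \<Psi> Tgt)"
      and F = "\<lambda>v w. (v * w) mod q"];
      (assumption | (simp only: group_of_pairing; fail) | auto simp: elt_of_def intro: elt1_intros))

lemma q_Inv0: "bound t \<Longrightarrow> invar K T R s \<Longrightarrow> s + 1 + 4 * t \<le> B \<Longrightarrow> query_goal t c K T R (Inv0 a)"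
  by (rule q_operation[where a = a and a' = a and g = Src and g' = Src and F = "\<lambda>v w. (- v) mod q"
      and op = "\<lambda>\<Psi> a a'. ginv (group_of \<Psi> Src) a"];
      (assumption | (simp only: group_of_ops; fail) | auto simp: elt_of_def intro: elt0.neg))

lemma q_Inv1: "bound t \<Longrightarrow> invar K T R s \<Longrightarrow> s + 1 + 4 * t \<le> B \<Longrightarrow> query_goal t c K T R (Inv1 a)"
  by (rule q_operation[where a = a and a' = a and g = Tgt and g' = Tgt and F = "\<lambda>v w. (- v) mod q"
      and op = "\<lambda>\<Psi> a a'. ginv (group_of \<Psi> Tgt) a"];
      (assumption | (simp only: group_of_ops; fail) | auto simp: elt_of_def intro: elt1_intros))

lemma real_state_simps:
  "mk_ver (ch_mk (real_state K b x \<Psi>)) = k_ver K" "mk_beta (ch_mk (real_state K b x \<Psi>)) = x (Beta (k_ver K))"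
  "mk_galpha (ch_mk (real_state K b x \<Psi>)) = \<Psi> Src (x Alpha)" "ch_H (real_state K b x \<Psi>) = hash_fun (k_hashed K) x \<Psi>"
  "ch_policy (real_state K b x \<Psi>) = k_pol K" "ch_asked (real_state K b x \<Psi>) = set ` set (k_keys K)" "ch_bit (real_state K b x \<Psi>) = b"
  "ch_ek (real_state K b x \<Psi>) = EncKey p (\<Psi> Src 1) (\<Psi> Src (x (Beta (k_ver K)))) (\<Psi> Tgt (x Alpha)) (k_ver K)"
  "ch_mk (real_state K b x \<Psi>) = MasterKey (x (Beta (k_ver K))) (\<Psi> Src (x Alpha)) (k_ver K)"
  by (simp_all add: real_state_def Let_def)

lemma prod_ucp:
  assumes "x \<in> asns" "v \<le> k_ver K"
  shows "[(\<Prod>i\<in>{v + 1..k_ver K}. ch_ucp (real_state K b x \<Psi>) i) = x (Beta (k_ver K)) * inv_q (x (Beta v))] (mod q)"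
proof -
  have "(\<Prod>i\<in>{v + 1..k_ver K}. ch_ucp (real_state K b x \<Psi>) i) =
      (\<Prod>i\<in>{v + 1..k_ver K}. x (Beta i) * inv_q (x (Beta (i - 1))) mod q)"
    by (intro prod.cong) (auto simp: real_state_def Let_def)
  then show ?thesis
    using cong_prod_tele[OF assms(2), of "\<lambda>i. x (Beta i)" "\<lambda>i. inv_q (x (Beta i))"] inv_q_cong[OF assms(1)] by simp
qed

lemma prod_udk:
  assumes "x \<in> asns" "v \<le> k_ver K"
  shows "[(\<Prod>i\<in>{v + 1..k_ver K}. ch_udk (real_state K b x \<Psi>) i) = x (Beta v) * inv_q (x (Beta (k_ver K)))] (mod q)"
proof -
  have "(\<Prod>i\<in>{v + 1..k_ver K}. ch_udk (real_state K b x \<Psi>) i) =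
      (\<Prod>i\<in>{v + 1..k_ver K}. inv_q (x (Beta i)) * x (Beta (i - 1)) mod q)"
    by (intro prod.cong) (auto simp: real_state_def Let_def mult.commute)
  then show ?thesis
    using cong_prod_tele[OF assms(2), of "\<lambda>i. inv_q (x (Beta i))" "\<lambda>i. x (Beta i)"] inv_q_cong[OF assms(1)]
    by (simp add: mult.commute)
qed

text \<open>Neither the element \<open>d\<close> nor its version \<open>v\<close> need come from an
  actual key or ciphertext: any table entry can be multiplied by a quotient of two \<beta>'s, which
  is what the rule \<open>upd\<close> of \<open>elt0\<close> provides for. A current or future
  version leaves the object unchanged and gives the answer \<open>ans0\<close>.\<close>

lemma q_update:
  assumes "bound t" and invar: "invar K T R s" and s: "s + 2 + 4 * t \<le> B"
    and respond: "\<And>b x \<Psi>. respond (group_of \<Psi> Src) (group_of \<Psi> Tgt) (real_state K b x \<Psi>) qu =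
      return_pmf (if d \<in> gcarrier (group_of \<Psi> Src)
        then if v < k_ver K then ans (gpow (group_of \<Psi> Src) d (e b x \<Psi>)) else ans0 else Refused, real_state K b x \<Psi>)"
    and ij: "v < k_ver K \<Longrightarrow> i \<le> k_ver K" "v < k_ver K \<Longrightarrow> j \<le> k_ver K"
    and e: "\<And>b x \<Psi>. x \<in> asns \<Longrightarrow> v < k_ver K \<Longrightarrow> [e b x \<Psi> = x (Beta i) * inv_q (x (Beta j))] (mod q)"
  shows "query_goal t c K T R qu"
proof (cases d T Src rule: table_cases)
  case 1
  show ?thesis unfolding query_goal_def
    by (rule refuse_step[OF assms(1) invar 1, where c = c]) (use s in \<open>auto simp: bind_return_pmf respond\<close>)
next
  case (2 f)
  \<comment> \<open>\<open>Suc s\<close> because an update raises the degree parameter of the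
    element; the insertion of its string accounts for the second unit of the budget.\<close>
  have invar': "invar K T R (Suc s)" by (rule invar_mono[OF invar]) simp
  have f: "elt0 K s f" using invarD(6)[OF invar 2] by (simp add: elt_of_def)
  show ?thesis
  proof (cases "v < k_ver K")
    case False
    show ?thesis unfolding query_goal_def
    proof (rule pure_step[OF assms(1) invar, where fs = "[]" and ans = "\<lambda>ws. ans0"])
      fix b x \<Psi> assume x: "x \<in> asns" and \<Psi>: "\<Psi> \<in> consistent T R (masked K b x)"
      show "respond (group_of \<Psi> Src) (group_of \<Psi> Tgt) (real_state K b x \<Psi>) qu \<bind> (\<lambda>(a, ch'). guess t (answered c a) \<Psi> ch') =
          guess t (answered c ans0) \<Psi> (real_state K b x \<Psi>)"
        using table_value(3)[OF invar 2 x \<Psi>] False by (simp add: bind_return_pmf respond)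
    qed (use s in simp_all)
  next
    case True
    let ?h = "\<lambda>x. (f x * (x (Beta i) * inv_q (x (Beta j)))) mod q"
    show ?thesis unfolding query_goal_def
    proof (rule pure_step[OF assms(1) invar', where fs = "[(Src, ?h)]" and ans = "\<lambda>ws. ans (hd ws)"])
      show "elt_of K (Suc s) g h" if "(g, h) \<in> set [(Src, ?h)]" for g h
        using that elt0.upd[OF f ij(1)[OF True] ij(2)[OF True]] by (simp add: elt_of_def)
      fix b x \<Psi> assume x: "x \<in> asns" and \<Psi>: "\<Psi> \<in> consistent T R (masked K b x)"
      note va = table_value[OF invar 2 x \<Psi>]
      have "gpow (group_of \<Psi> Src) d (e b x \<Psi>) = \<Psi> Src ((f (masked K b x) * e b x \<Psi>) mod q)"
        by (subst va(1)[symmetric]) (rule group_of_ops(3)[of \<Psi> Src, OF consistentD(1)[OF \<Psi>] va(2) va(2)])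
      also have "(f (masked K b x) * e b x \<Psi>) mod q = ?h (masked K b x)"
        using cong_mult[OF cong_refl e[OF x True], of "f (masked K b x)"]
        by (simp add: masked_other Cong.cong_def)
      finally show "respond (group_of \<Psi> Src) (group_of \<Psi> Tgt) (real_state K b x \<Psi>) qu \<bind> (\<lambda>(a, ch'). guess t (answered c a) \<Psi> ch') =
          guess t (answered c (ans (hd (map (\<lambda>(g, f). \<Psi> g (f (masked K b x))) [(Src, ?h)])))) \<Psi> (real_state K b x \<Psi>)"
        using va(3) True by (simp add: bind_return_pmf respond)
    qed (use s in simp)
  qed
qed

lemma q_Update_DK: "bound t \<Longrightarrow> invar K T R s \<Longrightarrow> s + 2 + 4 * t \<le> B \<Longrightarrow> query_goal t c K T R (Update_DK dk)"
  by (rule q_update[where d = "dk_D dk" and v = "dk_ver dk" and i = "dk_ver dk" and j = "k_ver K"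
      and e = "\<lambda>b x \<Psi>. \<Prod>i\<in>{dk_ver dk + 1..k_ver K}. ch_udk (real_state K b x \<Psi>) i"
      and ans = "\<lambda>a. Answer_DK (DecKey a (k_ver K) (dk_attrs dk))" and ?ans0.0 = "Answer_DK dk"])
     (simp_all add: prod_udk[simplified] update_dk_def real_state_simps)

lemma q_Update_CP: "bound t \<Longrightarrow> invar K T R s \<Longrightarrow> s + 2 + 4 * t \<le> B \<Longrightarrow> query_goal t c K T R (Update_CP ct)"
  by (rule q_update[where d = "ct_C ct" and v = "ct_ver ct" and i = "k_ver K" and j = "ct_ver ct"
      and e = "\<lambda>b x \<Psi>. \<Prod>i\<in>{ct_ver ct + 1..k_ver K}. ch_ucp (real_state K b x \<Psi>) i"
      and ans = "\<lambda>a. Answer_CP (Ciphertext (ct_policy ct) (ct_Ctilde ct) a (k_ver K) (ct_leaves ct))"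
      and ?ans0.0 = "Answer_CP ct"])
     (simp_all add: prod_ucp[simplified] update_cp_def real_state_simps)

lemma state_ok_extend:
  assumes "state_ok K u" "state_le K K'" "u \<le> u'" "finite (k_hashed K')" "k_msg K' = k_msg K" "k_pol K' = k_pol K"
    "\<And>js. js \<in> set (k_keys K') \<Longrightarrow> js \<in> set (k_keys K) \<or>
      (set js \<subseteq> k_hashed K' \<and> (\<forall>P. k_pol K = Some P \<longrightarrow> \<not> satisfies (set js) P))"
  shows "state_ok K' u'"
proof -
  have sub: "k_hashed K \<subseteq> k_hashed K'" using assms(2) by (simp add: state_le_def)
  have "elt1a K' u' (k_msg K' b)" for b
    using assms elt1a_mono[OF _ assms(2,3)] by (simp add: state_ok_def)
  moreover have "set js \<subseteq> k_hashed K'" if "js \<in> set (k_keys K')" for js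
    using assms(1) assms(7)[OF that] sub unfolding state_ok_def by blast
  moreover have "wf_policy P \<and> length (node_indices P) < p \<and> set (leaf_attrs P) \<subseteq> k_hashed K' \<and>
      (\<forall>js\<in>set (k_keys K'). \<not> satisfies (set js) P)" if "k_pol K' = Some P" for P
  proof -
    have P: "k_pol K = Some P" using that assms(6) by simp
    have old: "wf_policy P \<and> length (node_indices P) < p \<and> set (leaf_attrs P) \<subseteq> k_hashed K \<and>
        (\<forall>js\<in>set (k_keys K). \<not> satisfies (set js) P)"
      using assms(1) P unfolding state_ok_def by blast
    have "\<not> satisfies (set js) P" if "js \<in> set (k_keys K')" for js
      using assms(7)[OF that] old P by blast
    then show ?thesis using old sub by blast
  qed
  ultimately show ?thesis using assms(4) unfolding state_ok_def by blast
qed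

lemma card_vars_le:
  assumes "invar K T R s" "vars K' = vars K \<union> V'" "card V' \<le> d"
  shows "card (vars K') \<le> s + d"
  using card_Un_le[of "vars K" V'] invarD(3)[OF assms(1)] assms(2,3) by simp

text \<open>One new secret and the three strings of the key give the constant 4, the largest among
  the queries and hence the one in \<open>bound\<close>.\<close>

lemma q_Update_EK:
  assumes "bound t" and invar: "invar K T R s" and s: "s + 4 + 4 * t \<le> B"
  shows "query_goal t c K T R Update_EK"
proof -
  let ?n = "k_ver K"
  let ?K = "K\<lparr>k_ver := Suc ?n\<rparr>" and ?V = "{Beta (Suc ?n)}"
  let ?fs = "[(Src, \<lambda>x. 1), (Src, \<lambda>x. x (Beta (Suc ?n))), (Tgt, \<lambda>x. x Alpha mod q)]"
  let ?ans = "\<lambda>ws. Answer_EK (EncKey p (ws ! 0) (ws ! 1) (ws ! 2) (Suc ?n))"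
  have state_le: "state_le K ?K" by (simp add: state_le_def)
  have V: "vars ?K = vars K \<union> ?V"
    by (auto simp: vars_def atMost_Suc)
  have disj: "vars K \<inter> ?V = {}"
    using qvars_CtQ by (auto simp: vars_def keyvars_def polvars_def split: option.splits)
  have state_ok: "state_ok ?K (Suc s)"
    using invarD(1)[OF invar] by (intro state_ok_extend[OF invarD(1)[OF invar] state_le]) (auto simp: state_ok_def)
  have invar': "invar ?K T R (Suc s)"
    using card_vars_le[OF invar V, of 1] by (intro invar_step[OF invar state_le state_ok]) auto
  show ?thesis unfolding query_goal_def
  proof (rule fresh_step[OF assms(1) invar state_le invar' _ disj V, where fs = ?fs and ans = ?ans])
    show "elt_of ?K (Suc s) g f" if "(g, f) \<in> set ?fs" for g f
      using that by (auto simp: elt_of_def intro!: elt0.base base.intros elt1_intros)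
    fix b x \<Psi> assume x: "x \<in> asns" and \<Psi>: "\<Psi> \<in> consistent T R (masked K b x)"
    note encs = consistentD(1)[OF \<Psi>]
    have al: "x Alpha mod q = x Alpha" using asns_range[OF x, of Alpha] by simp
    have "real_state K b x \<Psi>\<lparr>ch_ek := EncKey p (\<Psi> Src 1) (\<Psi> Src a) (\<Psi> Tgt (x Alpha)) (Suc ?n),
        ch_mk := MasterKey a (\<Psi> Src (x Alpha)) (Suc ?n),
        ch_ucp := (ch_ucp (real_state K b x \<Psi>))(Suc ?n := a * inv_q (x (Beta ?n)) mod q),
        ch_udk := (ch_udk (real_state K b x \<Psi>))(Suc ?n := x (Beta ?n) * inv_q a mod q)\<rparr> =
        real_state ?K b (x(Beta (Suc ?n) := a)) \<Psi>" for a
      unfolding real_state_def Let_def using hash_fun_cong[of "k_hashed K" x "x(Beta (Suc ?n) := a)" \<Psi>]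
      by (auto intro!: HOL.ext simp: fun_upd_def)
    moreover have "\<Psi> Src (a mod q) = \<Psi> Src a" if "a \<in> set_pmf (var_pmf (Beta (Suc ?n)))" for a
      using that by simp
    moreover have "override_on x ((\<lambda>_. 1)(Beta (Suc ?n) := a)) ?V = x(Beta (Suc ?n) := a)" for a
      by (auto simp: override_on_def)
    ultimately show "respond (group_of \<Psi> Src) (group_of \<Psi> Tgt) (real_state K b x \<Psi>) Update_EK \<bind> (\<lambda>(a, ch'). guess t (answered c a) \<Psi> ch') =
        rand_asn ?V \<bind> (\<lambda>y. let z = override_on x y ?V in
          guess t (answered c (?ans (map (\<lambda>(g, f). \<Psi> g (f (masked ?K b z))) ?fs))) \<Psi> (real_state ?K b z \<Psi>))"
      unfolding rand_asn_single
      by (auto simp: bind_return_pmf bind_assoc_pmf bind_map_pmf update_mk_def update_ek_def real_state_simps Let_def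
          nonzero_scalar_var_pmf[of "Suc ?n"] group_of_gpow_gen[OF encs] masked_other al case_prod_unfold
          intro!: bind_pmf_cong)
  qed (use s in simp_all)
qed

end

lemma zip_maps: "zip xs (zip (map F xs) (map G xs)) = map (\<lambda>j. (j, F j, G j)) xs"
  by (induction xs) auto

context bilinear
begin

lemma keygen_rand_asn:
  assumes "distinct js" "gorder G = p"
  shows "keygen G H (MasterKey \<beta> ga n) js = rand_asn (keyvars k js) \<bind> (\<lambda>y. return_pmf
    (DecKey (gpow G (gmul G ga (gpow G (ggen G) (y (KeyR k)))) (inv_q \<beta>)) n
      (map (\<lambda>j. (j, gmul G (gpow G (ggen G) (y (KeyR k))) (gpow G (H j) (y (KeyRJ k j))), gpow G (ggen G) (y (KeyRJ k j)))) js)))"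
proof -
  have "rand_asn (keyvars k js) = do {a \<leftarrow> var_pmf (KeyR k); y \<leftarrow> rand_asn (KeyRJ k ` set js); return_pmf (y(KeyR k := a))}"
    unfolding keyvars_def by (rule rand_asn_insert) auto
  then show ?thesis
    by (simp add: keygen_def assms keygen_attrs_rand_asn[OF assms, of _ _ k] bind_assoc_pmf bind_return_pmf scalar_var_pmf[of "KeyR k"])
qed

lemma encrypt_rand_asn:
  assumes "valid_thresholds P" "distinct (node_indices P)" "gorder G = p"
  shows "encrypt G G' H M P (EncKey p' g h l n) = rand_asn (insert CtS (qvars P)) \<bind> (\<lambda>y. return_pmf
    (Ciphertext P (gmul G' M (gpow G' l (y CtS))) (gpow G h (y CtS)) n
      (map (\<lambda>(a, c). (gpow G g c, gpow G (H a) c)) (shares (coefs y) P (y CtS)))))"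
proof -
  have notin: "CtS \<notin> qvars P" using qvars_CtQ by fastforce
  have "rand_asn (insert CtS (qvars P)) = do {a \<leftarrow> var_pmf CtS; y \<leftarrow> rand_asn (qvars P); return_pmf (y(CtS := a))}"
    using notin by (intro rand_asn_insert) auto
  moreover have "share p P a = rand_asn (qvars P) \<bind> (\<lambda>y. return_pmf (shares (coefs y) P a))" if "a \<in> set_pmf (var_pmf CtS)" for a
    using that assms by (intro share_rand_asn) auto
  ultimately show ?thesis
    by (auto simp: encrypt_def assms bind_assoc_pmf bind_return_pmf scalar_var_pmf[of CtS] intro!: bind_pmf_cong)
qed

lemma vars_Hsh: "Hsh a \<in> vars K \<Longrightarrow> a \<in> k_hashed K"
  using qvars_CtQ by (auto simp: vars_def keyvars_def polvars_def split: option.splits)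

lemma vars_key: "KeyR (length (k_keys K)) \<notin> vars K" "KeyRJ (length (k_keys K)) j \<notin> vars K"
  using qvars_CtQ by (auto simp: vars_def keyvars_def polvars_def split: option.splits)

lemma vars_ct: "k_pol K = None \<Longrightarrow> CtS \<notin> vars K \<and> CtQ i j \<notin> vars K"
  by (auto simp: vars_def keyvars_def polvars_def)

lemma asns_z:
  assumes "x \<in> asns" "y1 \<in> set_pmf (rand_asn V1)" "y2 \<in> set_pmf (rand_asn V2)" "finite V1" "finite V2"
  shows "override_on x (override_on y1 y2 V2) V \<in> asns"
  using assms rand_asn_asns by (intro asns_override) auto

end

context reduction
begin

lemma real_state_hash:
  assumes "z Alpha = x Alpha" "\<And>i. z (Beta i) = x (Beta i)" "K' = K\<lparr>k_hashed := S'\<rparr>"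
  shows "real_state K b x \<Psi>\<lparr>ch_H := hash_fun S' z \<Psi>\<rparr> = real_state K' b z \<Psi>"
  using assms by (simp add: real_state_def Let_def cong: if_cong)

lemma q_Hash:
  assumes "bound t" and invar: "invar K T R s" and s: "s + 2 + 4 * t \<le> B"
  shows "query_goal t c K T R (Hash j)"
proof -
  let ?S = "k_hashed K \<union> set [j]"
  let ?K = "K\<lparr>k_hashed := ?S\<rparr>" and ?V = "Hsh ` (set [j] - k_hashed K)"
  let ?fs = "[(Src, \<lambda>x. x (Hsh j))]"
  have state_le: "state_le K ?K" by (auto simp: state_le_def)
  have V: "vars ?K = vars K \<union> ?V" by (auto simp: vars_def)
  have disj: "vars K \<inter> ?V = {}" using vars_Hsh by auto
  have state_ok: "state_ok ?K (Suc s)"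
    using invarD(1)[OF invar] by (intro state_ok_extend[OF invarD(1)[OF invar] state_le]) (auto simp: state_ok_def)
  have "card ?V \<le> 1" by (cases "j \<in> k_hashed K") (auto simp: insert_Diff_if)
  then have invar': "invar ?K T R (Suc s)"
    using card_vars_le[OF invar V, of 1] by (intro invar_step[OF invar state_le state_ok]) auto
  show ?thesis unfolding query_goal_def
  proof (rule fresh_step[OF assms(1) invar state_le invar' _ disj V, where fs = ?fs and ans = "\<lambda>ws. Elem (hd ws)"])
    show "elt_of ?K (Suc s) g f" if "(g, f) \<in> set ?fs" for g f
      using that by (auto simp: elt_of_def intro!: elt0.base base.intros)
    fix b x \<Psi> assume x: "x \<in> asns" and \<Psi>: "\<Psi> \<in> consistent T R (masked K b x)"
    have "real_state K b x \<Psi>\<lparr>ch_H := hash_fun ?S (override_on x y ?V) \<Psi>\<rparr> = real_state ?K b (override_on x y ?V) \<Psi>" for y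
      by (rule real_state_hash) (auto simp: override_on_def)
    then show "respond (group_of \<Psi> Src) (group_of \<Psi> Tgt) (real_state K b x \<Psi>) (Hash j) \<bind> (\<lambda>(a, ch'). guess t (answered c a) \<Psi> ch') =
        rand_asn ?V \<bind> (\<lambda>y. let z = override_on x y ?V in
          guess t (answered c (Elem (hd (map (\<lambda>(g, f). \<Psi> g (f (masked ?K b z))) ?fs)))) \<Psi> (real_state ?K b z \<Psi>))"
      unfolding respond.simps real_state_simps(4) hash_all_rand_asn Let_def
      by (simp add: bind_return_pmf bind_assoc_pmf masked_other hash_fun_def del: hash_all.simps)
  qed (use s in simp_all)
qed

lemma q_refused:
  assumes "bound t" and invar: "invar K T R s" and s: "s + 4 * t \<le> B"
    and "\<And>b x \<Psi>. respond (group_of \<Psi> Src) (group_of \<Psi> Tgt) (real_state K b x \<Psi>) qu = return_pmf (Refused, real_state K b x \<Psi>)"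
  shows "query_goal t c K T R qu"
  unfolding query_goal_def
  by (rule pure_step[OF assms(1) invar, where fs = "[]" and ans = "\<lambda>_. Refused"]) (use s in \<open>auto simp: assms(4) bind_return_pmf\<close>)

text \<open>Each attribute costs up to two secrets, its hash value and \<open>r_j\<close>, and two
  strings, \<open>D_j\<close> and \<open>D'_j\<close>; two more units account for \<open>r\<close>
  and \<open>D\<close>. The draws of the hash values and of the key randomness are merged into one,
  as \<open>fresh_step\<close> expects.\<close>

lemma q_Gen_DK:
  assumes "bound t" and invar: "invar K T R s" and s: "s + 4 * length js + 2 + 4 * t \<le> B"
  shows "query_goal t c K T R (Gen_DK js)"
proof (cases "distinct js \<and> (\<forall>P. k_pol K = Some P \<longrightarrow> \<not> satisfies (set js) P)")
  case False
  show ?thesis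
    by (rule q_refused[OF assms(1) invar]) (use s False in \<open>auto simp: real_state_simps\<close>)
next
  case True
  let ?n = "k_ver K" and ?k = "length (k_keys K)" and ?l = "length js"
  let ?S = "k_hashed K \<union> set js"
  let ?K = "K\<lparr>k_hashed := ?S, k_keys := k_keys K @ [js]\<rparr>"
  let ?V1 = "Hsh ` (set js - k_hashed K)" and ?V2 = "keyvars ?k js"
  let ?fD = "\<lambda>x. ((x Alpha + x (KeyR ?k)) * inv_q (x (Beta ?n))) mod q"
  let ?fJ = "\<lambda>j x. (x (KeyR ?k) + x (Hsh j) * x (KeyRJ ?k j)) mod q"
  let ?fJ' = "\<lambda>j x. x (KeyRJ ?k j)"
  let ?fs = "(Src, ?fD) # map (\<lambda>j. (Src, ?fJ j)) js @ map (\<lambda>j. (Src, ?fJ' j)) js"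
  let ?ans = "\<lambda>ws. Answer_DK (DecKey (hd ws) ?n (zip js (zip (take ?l (tl ws)) (drop ?l (tl ws)))))"
  let ?s = "s + (2 * ?l + 1)"
  have state_le: "state_le K ?K" by (auto simp: state_le_def)
  have V: "vars ?K = vars K \<union> (?V1 \<union> ?V2)"
    by (auto simp: vars_def lessThan_Suc nth_append)
  have fin: "finite ?V1" "finite ?V2" by (auto simp: keyvars_def)
  have disj: "vars K \<inter> (?V1 \<union> ?V2) = {}" using vars_Hsh vars_key by (auto simp: keyvars_def)
  have disj12: "?V1 \<inter> ?V2 = {}" by (auto simp: keyvars_def)
  have state_ok: "state_ok ?K ?s"
    using invarD(1)[OF invar] True by (intro state_ok_extend[OF invarD(1)[OF invar] state_le]) (auto simp: state_ok_def)
  have "card (?V1 \<union> ?V2) \<le> 2 * ?l + 1"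
  proof -
    have "card (?V1 \<union> ?V2) \<le> card ?V1 + card ?V2" by (rule card_Un_le)
    moreover have "card ?V1 \<le> card (set js - k_hashed K)" by (intro card_image_le) simp
    moreover have "card (set js - k_hashed K) \<le> card (set js)" by (intro card_mono) auto
    moreover have "card ?V2 \<le> Suc (card (KeyRJ ?k ` set js))" unfolding keyvars_def by (rule card_insert_le_m1) auto
    moreover have "card (KeyRJ ?k ` set js) \<le> card (set js)" by (intro card_image_le) simp
    ultimately show ?thesis using card_length[of js] by linarith
  qed
  from card_vars_le[OF invar V this] have invar': "invar ?K T R ?s"
    by (intro invar_step[OF invar state_le state_ok]) auto
  show ?thesis unfolding query_goal_def
  proof (rule fresh_step[OF assms(1) invar state_le invar' _ disj V, where fs = ?fs and ans = ?ans])
    show "elt_of ?K ?s g f" if "(g, f) \<in> set ?fs" for g f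
    proof -
      have D: "base ?K ?fD" using base.D[of ?k ?K ?n] by simp
      have J: "base ?K (?fJ j)" "base ?K (?fJ' j)" if "j \<in> set js" for j
        using base.Dj[of ?k ?K j] base.Dj'[of ?k ?K j] that by simp_all
      from that consider "g = Src" "f = ?fD" | j where "j \<in> set js" "g = Src" "f = ?fJ j"
        | j where "j \<in> set js" "g = Src" "f = ?fJ' j" by auto
      then have "g = Src \<and> base ?K f" by cases (simp_all only: D J simp_thms)
      then show ?thesis by (simp add: elt_of_def elt0.base)
    qed
    fix b x \<Psi> assume x: "x \<in> asns" and \<Psi>: "\<Psi> \<in> consistent T R (masked K b x)"
    note encs = consistentD(1)[OF \<Psi>, of Src]
    let ?G = "group_of \<Psi> Src"
    let ?F = "\<lambda>z. guess t (answered c (?ans (map (\<lambda>(g, f). \<Psi> g (f (masked ?K b z))) ?fs))) \<Psi> (real_state ?K b z \<Psi>)"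
    let ?dk = "\<lambda>H y. DecKey (gpow ?G (gmul ?G (\<Psi> Src (x Alpha)) (gpow ?G (ggen ?G) (y (KeyR ?k)))) (inv_q (x (Beta ?n)))) ?n
      (map (\<lambda>j. (j, gmul ?G (gpow ?G (ggen ?G) (y (KeyR ?k))) (gpow ?G (H j) (y (KeyRJ ?k j))), gpow ?G (ggen ?G) (y (KeyRJ ?k j)))) js)"
    let ?h = "\<lambda>y1. hash_fun ?S (override_on x y1 ?V1) \<Psi>"
    have step: "guess t (answered c (Answer_DK (?dk (the \<circ> ?h y1) y2))) \<Psi>
        (real_state K b x \<Psi>\<lparr>ch_H := ?h y1, ch_asked := insert (set js) (ch_asked (real_state K b x \<Psi>))\<rparr>) =
        ?F (override_on x (override_on y1 y2 ?V2) (?V1 \<union> ?V2))"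
      if y: "y1 \<in> set_pmf (rand_asn ?V1)" "y2 \<in> set_pmf (rand_asn ?V2)" for y1 y2
    proof -
      define z where "z = override_on x (override_on y1 y2 ?V2) (?V1 \<union> ?V2)"
      have zD: "z \<in> asns" unfolding z_def by (rule asns_z[OF x y fin])
      note zr = asns_range[OF zD]
      have z: "z Alpha = x Alpha" "\<And>i. z (Beta i) = x (Beta i)" "z (KeyR ?k) = y2 (KeyR ?k)"
        "\<And>j. j \<in> set js \<Longrightarrow> z (KeyRJ ?k j) = y2 (KeyRJ ?k j)"
        by (auto simp: z_def override_on_def keyvars_def)
      have "z (Hsh a) = override_on x y1 ?V1 (Hsh a)" for a
        by (auto simp: z_def override_on_def keyvars_def)
      then have h: "?h y1 = hash_fun ?S z \<Psi>" by (intro hash_fun_cong) simp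
      have real_state: "real_state K b x \<Psi>\<lparr>ch_H := ?h y1, ch_asked := insert (set js) (ch_asked (real_state K b x \<Psi>))\<rparr> = real_state ?K b z \<Psi>"
        unfolding h using z(1,2) by (simp add: real_state_def Let_def cong: if_cong)
      have var_range: "z v \<in> {0..<q}" for v using zr[of v] by simp
      have "gpow ?G (gmul ?G (\<Psi> Src (x Alpha)) (gpow ?G (ggen ?G) (y2 (KeyR ?k)))) (inv_q (x (Beta ?n))) = \<Psi> Src (?fD z)"
        using var_range[of Alpha] z
        by (simp add: group_of_gpow_gen[of \<Psi> Src, OF encs] group_of_ops[of \<Psi> Src, OF encs] mod_add_right_eq mod_mult_left_eq)
      moreover have "gmul ?G (gpow ?G (ggen ?G) (y2 (KeyR ?k))) (gpow ?G ((the \<circ> ?h y1) j) (y2 (KeyRJ ?k j))) = \<Psi> Src (?fJ j z)"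
        if "j \<in> set js" for j
        using var_range[of "Hsh j"] z(3) z(4)[OF that] that unfolding h
        by (simp add: hash_fun_def group_of_gpow_gen[of \<Psi> Src, OF encs] group_of_ops[of \<Psi> Src, OF encs] mod_add_eq)
      moreover have "gpow ?G (ggen ?G) (y2 (KeyRJ ?k j)) = \<Psi> Src (?fJ' j z)" if "j \<in> set js" for j
        using var_range[of "KeyRJ ?k j"] z(4)[OF that] by (simp add: group_of_gpow_gen[of \<Psi> Src, OF encs])
      ultimately have dk1: "?dk (the \<circ> ?h y1) y2 = DecKey (\<Psi> Src (?fD z)) ?n (map (\<lambda>j. (j, \<Psi> Src (?fJ j z), \<Psi> Src (?fJ' j z))) js)"
        by (intro arg_cong2[where f = "\<lambda>a b. DecKey a ?n b"] map_cong refl) (simp only:)+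
      have dk: "Answer_DK (?dk (the \<circ> ?h y1) y2) = ?ans (map (\<lambda>(g, f). \<Psi> g (f (masked ?K b z))) ?fs)"
        unfolding dk1 by (simp add: masked_other o_def zip_maps)
      show ?thesis
        unfolding z_def[symmetric] by (rule arg_cong2[where f = "\<lambda>a ch. guess t (answered c a) \<Psi> ch", OF dk real_state])
    qed
    have "respond (group_of \<Psi> Src) (group_of \<Psi> Tgt) (real_state K b x \<Psi>) (Gen_DK js) \<bind> (\<lambda>(a, ch'). guess t (answered c a) \<Psi> ch') =
      rand_asn ?V1 \<bind> (\<lambda>y1. rand_asn ?V2 \<bind> (\<lambda>y2. guess t (answered c (Answer_DK (?dk (the \<circ> ?h y1) y2))) \<Psi>
        (real_state K b x \<Psi>\<lparr>ch_H := ?h y1, ch_asked := insert (set js) (ch_asked (real_state K b x \<Psi>))\<rparr>)))"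
      using True unfolding respond.simps real_state_simps(4,5,9) hash_all_rand_asn
      by (simp add: keygen_rand_asn[of js "group_of \<Psi> Src", where k = ?k] bind_return_pmf bind_assoc_pmf)
    also have "\<dots> = rand_asn ?V1 \<bind> (\<lambda>y1. rand_asn ?V2 \<bind> (\<lambda>y2. ?F (override_on x (override_on y1 y2 ?V2) (?V1 \<union> ?V2))))"
      by (intro bind_pmf_cong refl step)
    also have "\<dots> = rand_asn (?V1 \<union> ?V2) \<bind> (\<lambda>y. ?F (override_on x y (?V1 \<union> ?V2)))"
      unfolding rand_asn_union[OF fin disj12] bind_assoc_pmf bind_return_pmf ..
    finally show "respond (group_of \<Psi> Src) (group_of \<Psi> Tgt) (real_state K b x \<Psi>) (Gen_DK js) \<bind> (\<lambda>(a, ch'). guess t (answered c a) \<Psi> ch') =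
        rand_asn (?V1 \<union> ?V2) \<bind> (\<lambda>y. let z = override_on x y (?V1 \<union> ?V2) in ?F z)"
      unfolding Let_def .
  qed (use s fin in simp_all)
qed

text \<open>The hidden bit influences an answer here only. Both messages are table entries free of
  \<open>Theta\<close>, hence in \<open>elt1a\<close>. The component \<open>C~\<close> is answered
  with the formal \<open>Theta\<close>, the same for both bits, while the new \<open>masked\<close>
  makes its value the true exponent for the bit at hand.\<close>

lemma q_Challenge_ok:
  assumes "bound t" and invar: "invar K T R s" and s: "s + 4 * length (node_indices P) + 2 + 4 * t \<le> B"
    and pol: "k_pol K = None" and wf: "wf_policy P" and unsat: "\<And>js. js \<in> set (k_keys K) \<Longrightarrow> \<not> satisfies (set js) P"
    and m0: "(f0, m0) \<in> T Tgt" and m1: "(f1, m1) \<in> T Tgt"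
  shows "query_goal t c K T R (Challenge m0 m1 P)"
proof -
  have K: "state_ok K s" by (rule invarD[OF invar])
  have msg: "\<exists>h. elt1a K s h \<and> f = (\<lambda>x. h x mod q)" if "(f, a) \<in> T Tgt" for f a
  proof -
    have "elt1 K s f" using invarD(6)[OF invar that] by (simp add: elt_of_def)
    then obtain h c where h: "elt1a K s h" "k_pol K = None \<longrightarrow> c = 0" "\<forall>x. f x = (c * x Theta + h x) mod q"
      by (rule elt1E)
    have "f = (\<lambda>x. h x mod q)" using h(2,3) pol by (simp add: fun_eq_iff)
    then show ?thesis using h(1) by (intro exI[of _ h] conjI)
  qed
  obtain h0 where h0: "elt1a K s h0" "f0 = (\<lambda>x. h0 x mod q)" using msg[OF m0] by (elim exE conjE)
  obtain h1 where h1: "elt1a K s h1" "f1 = (\<lambda>x. h1 x mod q)" using msg[OF m1] by (elim exE conjE)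
  let ?hh = "\<lambda>b. if b then h1 else h0"
  have hh: "elt1a K s (?hh b)" for b by (cases b) (simp_all add: h0(1) h1(1))
  have len: "length m0 = length m1"
  proof -
    have "a \<in> words" if "(f, a) \<in> T Tgt" for f a
      using table_okD(3)[OF invarD(2)[OF invar], of Tgt] imageI[OF that, of snd] by auto
    from this[OF m0] this[OF m1] show ?thesis by (simp add: words_def)
  qed
  let ?n = "k_ver K" and ?L = "length (leaf_attrs P)" and ?N = "length (node_indices P)"
  let ?as = "leaf_attrs P"
  let ?S = "k_hashed K \<union> set ?as"
  let ?K = "K\<lparr>k_hashed := ?S, k_pol := Some P, k_msg := ?hh\<rparr>"
  let ?V1 = "Hsh ` (set ?as - k_hashed K)" and ?V2 = "insert CtS (qvars P)"
  \<comment> \<open>\<open>elt1\<close> asks for a summand in \<open>elt1a\<close>, so 0 is written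
    as \<alpha> minus \<alpha>.\<close>
  let ?zero = "\<lambda>x :: asn. (x Alpha + (- x Alpha) mod q) mod q"
  let ?fT = "\<lambda>x :: asn. (1 * x Theta + ?zero x) mod q"
  let ?fC = "\<lambda>x. (x (Beta ?n) * x CtS) mod q"
  let ?fy' = "\<lambda>y x. (x (Hsh (?as ! y)) * leaf_share P y x) mod q"
  let ?fs = "(Tgt, ?fT) # (Src, ?fC) # map (\<lambda>y. (Src, leaf_share P y)) [0..<?L] @ map (\<lambda>y. (Src, ?fy' y)) [0..<?L]"
  let ?ans = "\<lambda>ws. Answer_CP (Ciphertext P (ws ! 0) (ws ! 1) ?n (zip (take ?L (drop 2 ws)) (drop ?L (drop 2 ws))))"
  let ?s = "s + 2 * ?N"
  have L: "?L \<le> ?N" by (rule length_leaf_attrs)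
  have vald: "valid_thresholds P" "distinct (node_indices P)" using wf by (auto simp: wf_policy_def)
  have state_le: "state_le K ?K" using pol by (auto simp: state_le_def)
  have V: "vars ?K = vars K \<union> (?V1 \<union> ?V2)"
    using pol by (auto simp: vars_def polvars_def)
  have fin: "finite ?V1" "finite ?V2" by auto
  have disj12: "?V1 \<inter> ?V2 = {}" using qvars_CtQ by fastforce
  have disj: "vars K \<inter> (?V1 \<union> ?V2) = {}"
  proof (intro equals0I, elim IntE)
    fix v assume v: "v \<in> vars K" "v \<in> ?V1 \<union> ?V2"
    then consider a where "v = Hsh a" "a \<notin> k_hashed K" | "v = CtS" | "v \<in> qvars P" by auto
    then show False
    proof cases
      case 1
      then show ?thesis using v(1) vars_Hsh by blast
    next
      case 2
      then show ?thesis using v(1) vars_ct[OF pol] by blast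
    next
      case 3
      then obtain i j where "v = CtQ i j" using qvars_CtQ by blast
      then show ?thesis using v(1) vars_ct[OF pol] by blast
    qed
  qed
  have state_ok: "state_ok ?K ?s"
  proof -
    have "elt1a ?K ?s (?hh b)" for b by (rule elt1a_mono[OF hh state_le]) simp
    \<comment> \<open>The nodes are paid for by the budget \<open>B\<close>, which is below
      \<open>p\<close>; this keeps the node indices nonzero modulo \<open>p\<close>.\<close>
    moreover have "?N < p" using s B_less by linarith
    ultimately show ?thesis
      using K wf unsat unfolding state_ok_def by auto
  qed
  have "card (?V1 \<union> ?V2) \<le> 2 * ?N"
  proof -
    have "card (?V1 \<union> ?V2) \<le> card ?V1 + card ?V2" by (rule card_Un_le)
    moreover have "card ?V1 \<le> card (set ?as - k_hashed K)" by (intro card_image_le) simp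
    moreover have "card (set ?as - k_hashed K) \<le> card (set ?as)" by (intro card_mono) auto
    moreover have "card ?V2 \<le> Suc (card (qvars P))" by (rule card_insert_le_m1) auto
    ultimately show ?thesis using card_length[of ?as] L card_qvars[OF vald(1)] by linarith
  qed
  from card_vars_le[OF invar V this] have invar': "invar ?K T R ?s"
    by (intro invar_step[OF invar state_le state_ok]) auto
  show ?thesis unfolding query_goal_def
  proof (rule fresh_step[OF assms(1) invar state_le invar' _ disj V, where fs = ?fs and ans = ?ans])
    show "elt_of ?K ?s g f" if "(g, f) \<in> set ?fs" for g f
    proof -
      have T: "elt1 ?K ?s ?fT"
        unfolding elt1_def
        by (intro exI[of _ 1] exI[of _ ?zero] conjI elt1a.add elt1a.neg elt1a.alpha) simp_all
      have C: "base ?K ?fC" using base.C[of ?K P ?n] by simp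
      have Y: "base ?K (leaf_share P y)" "base ?K (?fy' y)" if "y < ?L" for y
        using base.Cy[of ?K P y] base.Cy'[of ?K P y] that by simp_all
      from that consider "g = Tgt" "f = ?fT" | "g = Src" "f = ?fC" | y where "y < ?L" "g = Src" "f = leaf_share P y"
        | y where "y < ?L" "g = Src" "f = ?fy' y" by auto
      then have "g = Tgt \<and> elt1 ?K ?s f \<or> g = Src \<and> base ?K f" by cases (simp_all only: T C Y simp_thms)
      then show ?thesis by (auto simp: elt_of_def elt0.base)
    qed
    fix b x \<Psi> assume x: "x \<in> asns" and \<Psi>: "\<Psi> \<in> consistent T R (masked K b x)"
    note encs = consistentD(1)[OF \<Psi>]
    let ?G = "group_of \<Psi> Src" and ?G' = "group_of \<Psi> Tgt"
    let ?M = "if b then m1 else m0"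
    have M: "?M = \<Psi> Tgt (?hh b x mod q)"
    proof -
      have "f0 (masked K b x) = h0 x mod q" "f1 (masked K b x) = h1 x mod q"
        using h0(2) h1(2) depends_on_masked[OF elt1a_depends_on[OF h0(1) K]] depends_on_masked[OF elt1a_depends_on[OF h1(1) K]] by auto
      then show ?thesis using table_value(1)[OF invar m0 x \<Psi>] table_value(1)[OF invar m1 x \<Psi>] by auto
    qed
    let ?F = "\<lambda>z. guess t (answered c (?ans (map (\<lambda>(g, f). \<Psi> g (f (masked ?K b z))) ?fs))) \<Psi> (real_state ?K b z \<Psi>)"
    let ?ct = "\<lambda>H y. Ciphertext P (gmul ?G' ?M (gpow ?G' (\<Psi> Tgt (x Alpha)) (y CtS))) (gpow ?G (\<Psi> Src (x (Beta ?n))) (y CtS)) ?n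
      (map (\<lambda>(a, c). (gpow ?G (\<Psi> Src 1) c, gpow ?G (H a) c)) (shares (coefs y) P (y CtS)))"
    let ?h = "\<lambda>y1. hash_fun ?S (override_on x y1 ?V1) \<Psi>"
    have step: "guess t (answered c (Answer_CP (?ct (the \<circ> ?h y1) y2))) \<Psi> (real_state K b x \<Psi>\<lparr>ch_H := ?h y1, ch_policy := Some P\<rparr>) =
        ?F (override_on x (override_on y1 y2 ?V2) (?V1 \<union> ?V2))"
      if y: "y1 \<in> set_pmf (rand_asn ?V1)" "y2 \<in> set_pmf (rand_asn ?V2)" for y1 y2
    proof -
      define z where "z = override_on x (override_on y1 y2 ?V2) (?V1 \<union> ?V2)"
      have zD: "z \<in> asns" unfolding z_def by (rule asns_z[OF x y fin])
      have var_range: "z v \<in> {0..<q}" for v using asns_range[OF zD, of v] by simp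
      have zx: "z v = x v" if "v \<in> vars K" for v
        using that disj by (auto simp: z_def override_on_def)
      have ab: "Alpha \<in> vars K" "Beta ?n \<in> vars K" by (auto simp: vars_def)
      have z: "z Alpha = x Alpha" "z CtS = y2 CtS" "\<And>i. z (Beta i) = x (Beta i)"
        using zx[OF ab(1)] disj12 qvars_CtQ by (auto simp: z_def override_on_def)
      have zQ: "z v = y2 v" if "v \<in> qvars P" for v
        using that by (simp add: z_def override_on_def)
      have "z (Hsh a) = override_on x y1 ?V1 (Hsh a)" for a
        using qvars_CtQ by (fastforce simp: z_def override_on_def)
      then have h: "?h y1 = hash_fun ?S z \<Psi>" by (intro hash_fun_cong) simp
      have real_state: "real_state K b x \<Psi>\<lparr>ch_H := ?h y1, ch_policy := Some P\<rparr> = real_state ?K b z \<Psi>"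
        unfolding h using z(1,3) by (simp add: real_state_def Let_def cong: if_cong)
      have hz: "?hh b z = ?hh b x"
        by (rule depends_onD[OF elt1a_depends_on[OF hh K]]) (rule zx)
      have "gmul ?G' ?M (gpow ?G' (\<Psi> Tgt (x Alpha)) (y2 CtS)) = \<Psi> Tgt ((?hh b x + x Alpha * y2 CtS) mod q)"
        unfolding M using var_range[of Alpha] z(1)
        by (simp only: group_of_ops[of \<Psi> Tgt, OF encs] atLeastLessThan_iff mod_q simp_thms mod_add_eq)
      also have "\<dots> = \<Psi> Tgt (?fT (masked ?K b z))"
        using hz z(1,2) by (simp add: masked_def mod_add_right_eq)
      finally have T: "gmul ?G' ?M (gpow ?G' (\<Psi> Tgt (x Alpha)) (y2 CtS)) = \<Psi> Tgt (?fT (masked ?K b z))" .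
      have C: "gpow ?G (\<Psi> Src (x (Beta ?n))) (y2 CtS) = \<Psi> Src (?fC (masked ?K b z))"
        using var_range[of "Beta ?n"] z by (simp add: group_of_ops[of \<Psi> Src, OF encs] masked_other)
      let ?sh = "shares (coefs z) P (z CtS)"
      have sh: "shares (coefs y2) P (y2 CtS) = ?sh"
        unfolding z(2) by (rule shares_cong) (simp add: zQ)
      have leaf_share: "leaf_share P y (masked ?K b z) = snd (?sh ! y)" for y
        by (simp add: leaf_share_def masked_other)
      have leaves: "map (\<lambda>(a, c). (gpow ?G (\<Psi> Src 1) c, gpow ?G ((the \<circ> ?h y1) a) c)) ?sh =
          zip (map (\<lambda>y. \<Psi> Src (leaf_share P y (masked ?K b z))) [0..<?L]) (map (\<lambda>y. \<Psi> Src (?fy' y (masked ?K b z))) [0..<?L])"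
      proof (rule nth_equalityI)
        fix y assume "y < length (map (\<lambda>(a, c). (gpow ?G (\<Psi> Src 1) c, gpow ?G ((the \<circ> ?h y1) a) c)) ?sh)"
        then have y: "y < ?L" by simp
        obtain a v where av: "?sh ! y = (a, v)" by (cases "?sh ! y")
        have a: "a = ?as ! y" using fst_shares[OF y, of "coefs z" "z CtS"] av by simp
        have "(a, v) \<in> set ?sh" using av y by (metis length_shares nth_mem)
        then have v: "v \<in> {0..<q}" by (rule shares_range[OF var_range])
        have "a \<in> ?S" using a y by simp
        then have ha: "(the \<circ> ?h y1) a = \<Psi> Src (z (Hsh a))" unfolding h by (simp add: hash_fun_def)
        have 1: "gpow ?G (\<Psi> Src 1) v = \<Psi> Src v"
          using v p_gt2 by (simp add: group_of_ops[of \<Psi> Src, OF encs])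
        have 2: "gpow ?G (\<Psi> Src (z (Hsh a))) v = \<Psi> Src ((z (Hsh a) * v) mod q)"
          by (rule group_of_ops(3)[of \<Psi> Src, OF encs var_range var_range])
        show "map (\<lambda>(a, c). (gpow ?G (\<Psi> Src 1) c, gpow ?G ((the \<circ> ?h y1) a) c)) ?sh ! y =
          zip (map (\<lambda>y. \<Psi> Src (leaf_share P y (masked ?K b z))) [0..<?L]) (map (\<lambda>y. \<Psi> Src (?fy' y (masked ?K b z))) [0..<?L]) ! y"
          using y by (simp add: av 1 ha 2 leaf_share masked_other a[symmetric] del: o_apply)
      qed simp
      have ct: "Answer_CP (?ct (the \<circ> ?h y1) y2) = ?ans (map (\<lambda>(g, f). \<Psi> g (f (masked ?K b z))) ?fs)"
        unfolding T C sh leaves by (simp add: o_def)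
      show ?thesis
        unfolding z_def[symmetric] by (rule arg_cong2[where f = "\<lambda>a ch. guess t (answered c a) \<Psi> ch", OF ct real_state])
    qed
    have "respond (group_of \<Psi> Src) (group_of \<Psi> Tgt) (real_state K b x \<Psi>) (Challenge m0 m1 P) \<bind> (\<lambda>(a, ch'). guess t (answered c a) \<Psi> ch') =
      rand_asn ?V1 \<bind> (\<lambda>y1. rand_asn ?V2 \<bind> (\<lambda>y2. guess t (answered c (Answer_CP (?ct (the \<circ> ?h y1) y2))) \<Psi>
        (real_state K b x \<Psi>\<lparr>ch_H := ?h y1, ch_policy := Some P\<rparr>)))"
    proof -
      have "k_pol K = None \<and> wf_policy P \<and> (\<forall>\<gamma>\<in>set ` set (k_keys K). \<not> satisfies \<gamma> P) \<and>
         m0 \<in> gcarrier ?G' \<and> m1 \<in> gcarrier ?G' \<and> length m0 = length m1"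
        using pol wf unsat table_value(3)[OF invar m0 x \<Psi>] table_value(3)[OF invar m1 x \<Psi>] len by auto
      then show ?thesis
        unfolding respond.simps real_state_simps(4,5,6,7,8) hash_all_rand_asn
        by (simp add: encrypt_rand_asn[OF vald(1,2)] bind_return_pmf bind_assoc_pmf)
    qed
    also have "\<dots> = rand_asn ?V1 \<bind> (\<lambda>y1. rand_asn ?V2 \<bind> (\<lambda>y2. ?F (override_on x (override_on y1 y2 ?V2) (?V1 \<union> ?V2))))"
      by (intro bind_pmf_cong refl step)
    also have "\<dots> = rand_asn (?V1 \<union> ?V2) \<bind> (\<lambda>y. ?F (override_on x y (?V1 \<union> ?V2)))"
      unfolding rand_asn_union[OF fin disj12] bind_assoc_pmf bind_return_pmf ..
    finally show "respond (group_of \<Psi> Src) (group_of \<Psi> Tgt) (real_state K b x \<Psi>) (Challenge m0 m1 P) \<bind> (\<lambda>(a, ch'). guess t (answered c a) \<Psi> ch') =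
        rand_asn (?V1 \<union> ?V2) \<bind> (\<lambda>y. let z = override_on x y (?V1 \<union> ?V2) in ?F z)"
      unfolding Let_def .
  qed (use s L pol fin in simp_all)
qed

lemma q_Challenge:
  assumes "bound t" and invar: "invar K T R s" and s: "s + 4 * length (node_indices P) + 2 + 4 * t \<le> B"
  shows "query_goal t c K T R (Challenge m0 m1 P)"
proof (cases "k_pol K = None \<and> wf_policy P \<and> (\<forall>js\<in>set (k_keys K). \<not> satisfies (set js) P)")
  case False
  show ?thesis
    by (rule q_refused[OF assms(1) invar]) (use s False in \<open>auto simp: real_state_simps\<close>)
next
  case True
  show ?thesis
  proof (cases m0 T Tgt rule: table_cases)
    case 1
    show ?thesis unfolding query_goal_def
      by (rule refuse_step[OF assms(1) invar 1, where c = c]) (use s in \<open>auto simp: bind_return_pmf\<close>)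
  next
    case (2 f0)
    note m0 = this
    show ?thesis
    proof (cases m1 T Tgt rule: table_cases)
      case 1
      show ?thesis unfolding query_goal_def
        by (rule refuse_step[OF assms(1) invar 1, where c = c]) (use s in \<open>auto simp: bind_return_pmf\<close>)
    next
      case (2 f1)
      show ?thesis
        by (rule q_Challenge_ok[OF assms(1) invar s _ _ _ m0 2]) (use True in auto)
    qed
  qed
qed

text \<open>The sum in \<open>bound\<close> is a potential. A computation step may append a symbol
  but uses up a unit of \<open>t\<close>; a query empties the query tape, and the length released
  there pays for the growth of the symbolic state.\<close>

lemma bound_holds: "bound t"
proof (induction t)
  case 0
  show ?case unfolding bound_def
  proof (intro allI impI)
    fix c :: config and K T R s assume "invar K T R s" "s + 4 * length (c_query c) + 4 * 0 \<le> B"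
    then show "goal 0 c K T R" by (intro goal_0[of _ _ _ s]) auto
  qed
next
  case (Suc t)
  show ?case unfolding bound_def
  proof (intro allI impI)
    fix c :: config and K T R s assume invar: "invar K T R s" and s: "s + 4 * length (c_query c) + 4 * Suc t \<le> B"
    consider "halted c" | "\<not> halted c" "c_state c \<noteq> 1" | "\<not> halted c" "c_state c = 1" by blast
    then show "goal (Suc t) c K T R"
    proof cases
      case 1
      have "goal t c K T R" using Suc invar s unfolding bound_def by auto
      then show ?thesis unfolding goal_def guess_halted[OF 1] .
    next
      case 2
      have "goal t (machine_step A coin c) K T R" for coin
      proof -
        have "length (c_query (machine_step A coin c)) \<le> Suc (length (c_query c))"
          by (auto simp: machine_step_def Let_def split: prod.splits option.splits)
        then have "s + 4 * length (c_query (machine_step A coin c)) + 4 * t \<le> B" using s by (simp only: mult_Suc_right)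
        then show ?thesis using Suc invar unfolding bound_def by blast
      qed
      then show ?thesis
        unfolding goal_def guess_coin[OF 2] by (intro simulable_coin invarD(7)[OF invar])
    next
      case 3
      show ?thesis
      proof (cases "read_query (c_query c)")
        case None
        have "goal t (answered c Refused) K T R" by (rule goalI[OF Suc invar]) (use s in simp)
        then show ?thesis unfolding goal_def guess_None[OF 3 None] .
      next
        case (Some qu)
        have w: "c_query c = write_query qu"
          using Some by (auto simp: read_query_def f_inv_into_f split: if_splits)
        have "query_goal t c K T R qu"
        proof (cases qu)
          case (Mul0 a b)
          show ?thesis unfolding Mul0 by (rule q_Mul0[OF Suc invar]) (use s in simp)
        next
          case (Inv0 a)
          show ?thesis unfolding Inv0 by (rule q_Inv0[OF Suc invar]) (use s in simp)
        next
          case (Mul1 a b)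
          show ?thesis unfolding Mul1 by (rule q_Mul1[OF Suc invar]) (use s in simp)
        next
          case (Inv1 a)
          show ?thesis unfolding Inv1 by (rule q_Inv1[OF Suc invar]) (use s in simp)
        next
          case (Pairing a b)
          show ?thesis unfolding Pairing by (rule q_Pairing[OF Suc invar]) (use s in simp)
        next
          case (Hash a)
          show ?thesis unfolding Hash by (rule q_Hash[OF Suc invar]) (use s in simp)
        next
          case Update_EK
          show ?thesis unfolding Update_EK by (rule q_Update_EK[OF Suc invar]) (use s in simp)
        next
          case (Gen_DK js)
          have "length js \<le> length (c_query c)" using length_write_gen[of js] w Gen_DK by simp
          then have "s + 4 * length js + 2 + 4 * t \<le> B" using s by simp
          then show ?thesis unfolding Gen_DK by (rule q_Gen_DK[OF Suc invar])
        next
          case (Update_DK dk)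
          show ?thesis unfolding Update_DK by (rule q_Update_DK[OF Suc invar]) (use s in simp)
        next
          case (Update_CP ct)
          show ?thesis unfolding Update_CP by (rule q_Update_CP[OF Suc invar]) (use s in simp)
        next
          case (Challenge m0 m1 P)
          have "length (node_indices P) \<le> length (c_query c)"
            using length_write_challenge[of P m0 m1] w Challenge by simp
          then have "s + 4 * length (node_indices P) + 2 + 4 * t \<le> B" using s by simp
          then show ?thesis unfolding Challenge by (rule q_Challenge[OF Suc invar])
        qed
        then show ?thesis unfolding query_goal_def goal_def guess_Some[OF 3 Some] .
      qed
    qed
  qed
qed

end

section \<open>The advantage\<close>

lemma game_steps_add: "game_steps A G0 G1 (t + k) z = game_steps A G0 G1 t z \<bind> game_steps A G0 G1 k"
  by (induction t arbitrary: z) (auto simp: bind_return_pmf bind_assoc_pmf intro!: bind_pmf_cong)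

lemma game_steps_halted: "halted (fst z) \<Longrightarrow> game_steps A G0 G1 k z = return_pmf z"
  by (induction k) (auto simp: game_step_def bind_return_pmf split: prod.splits)

lemma respond_bit: "(a, ch') \<in> set_pmf (respond G0 G1 ch qu) \<Longrightarrow> ch_bit ch' = ch_bit ch"
  by (cases qu) (auto simp: Let_def split: if_splits)

lemma game_step_bit: "z' \<in> set_pmf (game_step A G0 G1 z) \<Longrightarrow> ch_bit (snd z') = ch_bit (snd z)"
  by (auto simp: game_step_def respond_bit split: prod.splits if_splits option.splits)

lemma game_steps_bit: "z' \<in> set_pmf (game_steps A G0 G1 t z) \<Longrightarrow> ch_bit (snd z') = ch_bit (snd z)"
  by (induction t arbitrary: z) (auto dest: game_step_bit)

definition start_state :: "nat \<Rightarrow> bool \<Rightarrow> enc_key \<Rightarrow> master_key \<Rightarrow> config \<times> challenger" where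
  "start_state \<kappa> b ek mk = (init_config \<kappa> (Answer_EK ek),
     \<lparr>ch_ek = ek, ch_mk = mk, ch_ucp = (\<lambda>_. 1), ch_udk = (\<lambda>_. 1), ch_H = Map.empty,
      ch_asked = {}, ch_policy = None, ch_bit = b\<rparr>)"

definition game_start :: "nat \<Rightarrow> nat \<Rightarrow> nat \<Rightarrow> (generic_group \<times> generic_group \<times> config \<times> challenger) pmf" where
  "game_start \<kappa> p m = do {
     G0 \<leftarrow> random_group p m;
     G1 \<leftarrow> random_group p m;
     (ek, mk) \<leftarrow> scheme_setup G0 G1;
     b \<leftarrow> bernoulli_pmf (1 / 2);
     return_pmf (G0, G1, start_state \<kappa> b ek mk)
   }"

lemma game_eq: "game A \<kappa> p m t = game_start \<kappa> p m \<bind> (\<lambda>(G0, G1, z). game_steps A G0 G1 t z)"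
  by (simp add: game_def game_start_def bind_assoc_pmf bind_return_pmf start_state_def case_prod_unfold)

lemma game_prob_mono:
  "measure_pmf.prob (game A \<kappa> p m t) {z. correct_guess z} \<le> measure_pmf.prob (game A \<kappa> p m (t + k)) {z. correct_guess z}"
proof -
  have step: "indicat_real {z. correct_guess z} z \<le> measure_pmf.prob (game_steps A G0 G1 k z) {z. correct_guess z}" for G0 G1 z
  proof (cases "correct_guess z")
    case True
    then have "halted (fst z)" by (auto simp: correct_guess_def halted_def split: prod.splits if_splits)
    then show ?thesis using True by (simp add: game_steps_halted)
  qed simp
  have "measure_pmf.prob (game_steps A G0 G1 t z) {z. correct_guess z} \<le>
      measure_pmf.prob (game_steps A G0 G1 (t + k) z) {z. correct_guess z}" for G0 G1 z
  proof -
    have "measure_pmf.prob (game_steps A G0 G1 t z) {z. correct_guess z} =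
        (\<integral>z. indicat_real {z. correct_guess z} z \<partial>measure_pmf (game_steps A G0 G1 t z))" by simp
    also have "\<dots> \<le> (\<integral>z. measure_pmf.prob (game_steps A G0 G1 k z) {z. correct_guess z} \<partial>measure_pmf (game_steps A G0 G1 t z))"
      by (intro integral_mono step measure_pmf.integrable_const_bound[where B = 1]) auto
    finally show ?thesis unfolding game_steps_add prob_bind_pmf .
  qed
  then show ?thesis
    unfolding game_eq prob_bind_pmf
    by (intro integral_mono measure_pmf.integrable_const_bound[where B = 1]) (auto split: prod.splits)
qed

lemma game_stable:
  assumes "\<forall>(c, ch)\<in>set_pmf (game A \<kappa> p m t). halted c"
  shows "game A \<kappa> p m (t + k) = game A \<kappa> p m t"
  unfolding game_eq
proof (intro bind_pmf_cong refl)
  fix w assume w: "w \<in> set_pmf (game_start \<kappa> p m)"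
  obtain G0 G1 z where wz: "w = (G0, G1, z)" by (cases w)
  have "halted (fst z')" if "z' \<in> set_pmf (game_steps A G0 G1 t z)" for z'
  proof -
    have "z' \<in> set_pmf (game A \<kappa> p m t)" unfolding game_eq set_bind_pmf
      by (rule UN_I[OF w]) (simp add: wz that)
    then show ?thesis using assms by auto
  qed
  then have "game_steps A G0 G1 t z \<bind> game_steps A G0 G1 k = game_steps A G0 G1 t z \<bind> return_pmf"
    by (intro bind_pmf_cong refl game_steps_halted)
  then show "(case w of (G0, G1, z) \<Rightarrow> game_steps A G0 G1 (t + k) z) = (case w of (G0, G1, z) \<Rightarrow> game_steps A G0 G1 t z)"
    by (simp add: wz game_steps_add bind_return_pmf')
qed

lemma success_prob_eq:
  assumes "\<forall>(c, ch)\<in>set_pmf (game A \<kappa> p m t). halted c"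
  shows "success_prob A \<kappa> p m = measure_pmf.prob (game A \<kappa> p m t) {z. correct_guess z}"
proof -
  have "measure_pmf.prob (game A \<kappa> p m t') {z. correct_guess z} \<le> measure_pmf.prob (game A \<kappa> p m t) {z. correct_guess z}" for t'
    using game_prob_mono[of A \<kappa> p m t' t] game_stable[OF assms, of t'] by (simp add: add.commute)
  then show ?thesis
    unfolding success_prob_def by (intro cSup_eq_maximum) auto
qed

section \<open>The start of the game and the averaging over the hidden bit\<close>

definition enc_pair :: "enc \<times> enc \<Rightarrow> grp \<Rightarrow> enc" where
  "enc_pair e g = (case g of Src \<Rightarrow> fst e | Tgt \<Rightarrow> snd e)"

context reduction
begin

text \<open>The message is a placeholder from \<open>elt1a\<close>, as \<open>state_ok\<close>
  demands one before the challenge too; it is overwritten when the challenge is made.\<close>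

definition K_init :: sym_state where
  "K_init = \<lparr>k_ver = 0, k_hashed = {}, k_keys = [], k_pol = None, k_msg = (\<lambda>_ x. x Alpha)\<rparr>"

lemma vars_init: "vars K_init = {Alpha, Beta 0}"
  by (auto simp: vars_def K_init_def polvars_def)

lemma invar_initial: "invar K_init (\<lambda>_. {}) (\<lambda>_. {}) 2"
  unfolding invar_def state_ok_def table_ok_def vars_init
  by (auto simp: K_init_def separated_def elt1a.alpha)

definition outcome :: "nat \<Rightarrow> nat \<Rightarrow> bool \<Rightarrow> asn \<Rightarrow> (grp \<Rightarrow> enc) \<Rightarrow> bool pmf" where
  "outcome t \<kappa> b x \<Psi> = guess t (init_config \<kappa> (Answer_EK (EncKey p (\<Psi> Src 1) (\<Psi> Src (x (Beta 0))) (\<Psi> Tgt (x Alpha)) 0))) \<Psi> (real_state K_init b x \<Psi>)"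

text \<open>The 5 consists of the two secrets \<open>Alpha\<close> and \<open>Beta 0\<close> and the
  three strings of the initial encryption key.\<close>

lemma simulable_start:
  assumes t: "5 + 4 * t \<le> B"
  shows "simulable \<epsilon> (masked K_init) {Alpha, Beta 0} (\<lambda>_. {}) (\<lambda>_. {}) (outcome t \<kappa>)"
  unfolding vars_init[symmetric]
proof (rule simulable_cong)
  let ?fs = "[(Src, \<lambda>x. 1), (Src, \<lambda>x. x (Beta 0)), (Tgt, \<lambda>x. x Alpha mod q)]"
  let ?\<Phi> = "\<lambda>ws b x \<Psi>. guess t (init_config \<kappa> (Answer_EK (EncKey p (ws ! 0) (ws ! 1) (ws ! 2) 0))) \<Psi> (real_state K_init b x \<Psi>)"
  show "simulable \<epsilon> (masked K_init) (vars K_init) (\<lambda>_. {}) (\<lambda>_. {}) (\<lambda>b x \<Psi>. ?\<Phi> (map (\<lambda>(g, f). \<Psi> g (f (masked K_init b x))) ?fs) b x \<Psi>)"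
  proof (rule insert_list_step[where \<Phi> = ?\<Phi>, OF invar_initial])
    show "elt_of K_init 2 g f" if "(g, f) \<in> set ?fs" for g f
      using that by (auto simp: elt_of_def intro!: elt0.base base.intros elt1_intros)
    show "2 + length ?fs \<le> B" using t by simp
    fix ws T' assume "invar K_init T' (\<lambda>_. {}) (2 + length ?fs)"
    then show "simulable \<epsilon> (masked K_init) (vars K_init) T' (\<lambda>_. {}) (?\<Phi> ws)"
      using bound_holds[of t] t unfolding bound_def goal_def by (auto simp: init_config_def)
  qed
  show "outcome t \<kappa> b x \<Psi> = ?\<Phi> (map (\<lambda>(g, f). \<Psi> g (f (masked K_init b x))) ?fs) b x \<Psi>"
    if "x \<in> set_pmf (rand_asn (vars K_init))" for b x \<Psi>
  proof -
    have "x Alpha mod q = x Alpha"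
      using asns_range[OF rand_asn_asns[OF _ that], of Alpha] by (simp add: vars_init)
    then show ?thesis by (simp add: outcome_def masked_other)
  qed
qed

lemma encs_eq: "random_encoding p m = pmf_of_set encs"
  by (simp add: random_encoding_def encs_def words_def)

lemma card_encs: "card encs = falling (2 ^ m) p"
  using card_encs_through[of "{}" "{}" p] by (simp add: encs_through_def)

lemma encs_nonempty: "encs \<noteq> {}"
  using card_encs falling_pos[of p "2 ^ m"] room by auto

lemma consistent_empty: "consistent (\<lambda>_. {}) (\<lambda>_. {}) x = enc_pair ` (encs \<times> encs)"
proof (intro equalityI subsetI)
  fix \<Psi> assume \<Psi>: "\<Psi> \<in> consistent (\<lambda>_. {}) (\<lambda>_. {}) x"
  have "\<Psi> = enc_pair (\<Psi> Src, \<Psi> Tgt)"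
    by (rule HOL.ext) (simp add: enc_pair_def split: grp.splits)
  moreover have "(\<Psi> Src, \<Psi> Tgt) \<in> encs \<times> encs" using consistentD(1)[OF \<Psi>, of Src] consistentD(1)[OF \<Psi>, of Tgt] by simp
  ultimately show "\<Psi> \<in> enc_pair ` (encs \<times> encs)" by (rule image_eqI)
next
  fix \<Psi> assume "\<Psi> \<in> enc_pair ` (encs \<times> encs)"
  then have "\<Psi> g \<in> encs" for g by (cases g) (auto simp: enc_pair_def)
  then show "\<Psi> \<in> consistent (\<lambda>_. {}) (\<lambda>_. {}) x" by (intro consistentI) auto
qed

lemma inj_enc_pair: "inj enc_pair"
proof (rule injI)
  fix e e' assume "enc_pair e = enc_pair e'"
  from fun_cong[OF this, of Src] fun_cong[OF this, of Tgt] show "e = e'"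
    by (simp add: enc_pair_def prod_eq_iff)
qed

definition run_bit :: "nat \<Rightarrow> nat \<Rightarrow> bool \<Rightarrow> bool pmf" where
  "run_bit t \<kappa> b = rand_asn {Alpha, Beta 0} \<bind> (\<lambda>x. pmf_of_set encs \<bind> (\<lambda>\<psi>0. pmf_of_set encs \<bind> (\<lambda>\<psi>1. outcome t \<kappa> b x (enc_pair (\<psi>0, \<psi>1)))))"

text \<open>For empty tables every pair of encodings is consistent and \<open>normalizer\<close> is
  the inverse of their number, so the weight is an honest probability.\<close>

lemma weight_run_bit:
  "weight (masked K_init b) {Alpha, Beta 0} (\<lambda>_. {}) (\<lambda>_. {}) (outcome t \<kappa> b) e = pmf (run_bit t \<kappa> b) e"
proof -
  let ?c = "real (card encs)"
  have c: "0 < ?c" using encs_nonempty by (simp add: card_gt_0_iff)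
  have "normalizer (\<lambda>_. {}) (\<lambda>_. {}) = 1 / ?c * (1 / ?c)"
    by (simp add: normalizer_def UNIV_grp card_encs)
  moreover have "(\<Sum>\<Psi>\<in>consistent (\<lambda>_. {}) (\<lambda>_. {}) (masked K_init b x). pmf (outcome t \<kappa> b x \<Psi>) e) =
      ?c * ?c * pmf (pmf_of_set encs \<bind> (\<lambda>\<psi>0. pmf_of_set encs \<bind> (\<lambda>\<psi>1. outcome t \<kappa> b x (enc_pair (\<psi>0, \<psi>1))))) e" for x
  proof -
    have "(\<Sum>\<Psi>\<in>consistent (\<lambda>_. {}) (\<lambda>_. {}) (masked K_init b x). pmf (outcome t \<kappa> b x \<Psi>) e) =
        (\<Sum>\<psi>0\<in>encs. \<Sum>\<psi>1\<in>encs. pmf (outcome t \<kappa> b x (enc_pair (\<psi>0, \<psi>1))) e)"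
      unfolding consistent_empty sum.reindex[OF inj_on_subset[OF inj_enc_pair subset_UNIV]]
      by (simp add: sum.cartesian_product case_prod_unfold)
    moreover have "pmf (pmf_of_set encs \<bind> (\<lambda>\<psi>0. pmf_of_set encs \<bind> (\<lambda>\<psi>1. outcome t \<kappa> b x (enc_pair (\<psi>0, \<psi>1))))) e =
        (\<Sum>\<psi>0\<in>encs. \<Sum>\<psi>1\<in>encs. pmf (outcome t \<kappa> b x (enc_pair (\<psi>0, \<psi>1))) e) / (?c * ?c)"
      unfolding pmf_bind using encs_nonempty
      by (simp add: integral_pmf_of_set sum_divide_distrib[symmetric])
    ultimately show ?thesis using c by simp
  qed
  ultimately show ?thesis
    unfolding weight_def run_bit_def pmf_bind[of "rand_asn _"] using c encs_nonempty by simp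
qed

lemma real_state_start:
  "start_state \<kappa> b (EncKey p (\<Psi> Src 1) (\<Psi> Src (x (Beta 0))) (\<Psi> Tgt (x Alpha)) 0) (MasterKey (x (Beta 0)) (\<Psi> Src (x Alpha)) 0) =
    (init_config \<kappa> (Answer_EK (EncKey p (\<Psi> Src 1) (\<Psi> Src (x (Beta 0))) (\<Psi> Tgt (x Alpha)) 0)), real_state K_init b x \<Psi>)"
  by (auto simp: start_state_def real_state_def K_init_def hash_fun_def fun_eq_iff)

lemma setup_rand_asn:
  assumes "\<Psi> Src \<in> encs" "\<Psi> Tgt \<in> encs"
  shows "scheme_setup (group_of \<Psi> Src) (group_of \<Psi> Tgt) = rand_asn {Alpha, Beta 0} \<bind> (\<lambda>x. return_pmf
    (EncKey p (\<Psi> Src 1) (\<Psi> Src (x (Beta 0))) (\<Psi> Tgt (x Alpha)) 0, MasterKey (x (Beta 0)) (\<Psi> Src (x Alpha)) 0))"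
proof -
  have rand_asn: "rand_asn {Alpha, Beta 0} = do {a \<leftarrow> var_pmf Alpha; c \<leftarrow> var_pmf (Beta 0); return_pmf ((\<lambda>_. 1)(Beta 0 := c, Alpha := a))}"
    using rand_asn_insert[of "{Beta 0}" Alpha] by (simp add: rand_asn_single bind_map_pmf)
  have gg: "pairing (group_of \<Psi> Src) (group_of \<Psi> Tgt) (ggen (group_of \<Psi> Src)) (ggen (group_of \<Psi> Src)) = \<Psi> Tgt 1"
    using group_of_pairing[of \<Psi> 1 1] assms p_gt2 by (simp add: ggen_def)
  have a: "gpow (group_of \<Psi> Tgt) (\<Psi> Tgt 1) a = \<Psi> Tgt a" "gpow (group_of \<Psi> Src) (ggen (group_of \<Psi> Src)) a = \<Psi> Src a"
    if "0 \<le> a" "a < q" for a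
    using that group_of_ops(3)[of \<Psi> Tgt 1 1 a] group_of_gpow_gen[of \<Psi> Src a] assms p_gt2 by simp_all
  show ?thesis
    unfolding scheme_setup_def Let_def gg
    by (auto simp: rand_asn bind_assoc_pmf bind_return_pmf scalar_var_pmf[of Alpha] nonzero_scalar_var_pmf[of 0] a ggen_def[of "group_of \<Psi> Src"]
      a(2)[unfolded ggen_def, simplified] intro!: bind_pmf_cong)
qed

text \<open>The encodings, the secrets and the hidden bit are independent, so the bit can be drawn
  before the others. The halting hypothesis turns not guessing 1 into guessing 0, so that
  correctness becomes equality of the guess and the bit.\<close>

lemma game_run_bit:
  assumes "\<forall>(c, ch)\<in>set_pmf (game A \<kappa> p m t). halted c"
  shows "map_pmf correct_guess (game A \<kappa> p m t) = bernoulli_pmf (1 / 2) \<bind> (\<lambda>b. map_pmf (\<lambda>s. s = b) (run_bit t \<kappa> b))"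
proof -
  have rg: "random_group p m = map_pmf (\<lambda>\<psi>. \<lparr>gorder = p, genc = \<psi>\<rparr>) (pmf_of_set encs)"
    by (simp add: random_group_def encs_eq)
  have group_of: "\<lparr>gorder = p, genc = \<psi>0\<rparr> = group_of (enc_pair (\<psi>0, \<psi>1)) Src" "\<lparr>gorder = p, genc = \<psi>1\<rparr> = group_of (enc_pair (\<psi>0, \<psi>1)) Tgt" for \<psi>0 \<psi>1
    by (simp_all add: group_of_def enc_pair_def)
  have setInj: "set_pmf (pmf_of_set encs) = encs" using encs_nonempty by simp
  have start: "game_start \<kappa> p m = pmf_of_set encs \<bind> (\<lambda>\<psi>0. pmf_of_set encs \<bind> (\<lambda>\<psi>1. rand_asn {Alpha, Beta 0} \<bind> (\<lambda>x.
      bernoulli_pmf (1 / 2) \<bind> (\<lambda>b. let \<Psi> = enc_pair (\<psi>0, \<psi>1) in return_pmf (group_of \<Psi> Src, group_of \<Psi> Tgt,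
        init_config \<kappa> (Answer_EK (EncKey p (\<Psi> Src 1) (\<Psi> Src (x (Beta 0))) (\<Psi> Tgt (x Alpha)) 0)), real_state K_init b x \<Psi>)))))"
    unfolding game_start_def rg bind_map_pmf
  proof (intro bind_pmf_cong refl)
    fix \<psi>0 \<psi>1 assume "\<psi>0 \<in> set_pmf (pmf_of_set encs)" "\<psi>1 \<in> set_pmf (pmf_of_set encs)"
    then have I: "enc_pair (\<psi>0, \<psi>1) Src \<in> encs" "enc_pair (\<psi>0, \<psi>1) Tgt \<in> encs" by (auto simp: setInj enc_pair_def)
    show "(do {(ek, mk) \<leftarrow> scheme_setup \<lparr>gorder = p, genc = \<psi>0\<rparr> \<lparr>gorder = p, genc = \<psi>1\<rparr>;
        b \<leftarrow> bernoulli_pmf (1 / 2);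
        return_pmf (\<lparr>gorder = p, genc = \<psi>0\<rparr>, \<lparr>gorder = p, genc = \<psi>1\<rparr>, start_state \<kappa> b ek mk)}) =
      rand_asn {Alpha, Beta 0} \<bind> (\<lambda>x.
      bernoulli_pmf (1 / 2) \<bind> (\<lambda>b. let \<Psi> = enc_pair (\<psi>0, \<psi>1) in return_pmf (group_of \<Psi> Src, group_of \<Psi> Tgt,
        init_config \<kappa> (Answer_EK (EncKey p (\<Psi> Src 1) (\<Psi> Src (x (Beta 0))) (\<Psi> Tgt (x Alpha)) 0)), real_state K_init b x \<Psi>)))"
      unfolding group_of(1)[of \<psi>0 \<psi>1] group_of(2)[of \<psi>1 \<psi>0] setup_rand_asn[OF I] bind_assoc_pmf bind_return_pmf Let_def prod.case
      by (intro bind_pmf_cong refl) (simp only: real_state_start)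
  qed
  have final: "map_pmf correct_guess (game_steps A (group_of \<Psi> Src) (group_of \<Psi> Tgt) t (c, real_state K_init b x \<Psi>)) = map_pmf (\<lambda>s. s = b) (guess t c \<Psi> (real_state K_init b x \<Psi>))"
    if "(group_of \<Psi> Src, group_of \<Psi> Tgt, c, real_state K_init b x \<Psi>) \<in> set_pmf (game_start \<kappa> p m)" for c b x \<Psi>
    unfolding guess_def map_pmf_comp
  proof (intro map_pmf_cong refl)
    fix z assume z: "z \<in> set_pmf (game_steps A (group_of \<Psi> Src) (group_of \<Psi> Tgt) t (c, real_state K_init b x \<Psi>))"
    have "z \<in> set_pmf (game A \<kappa> p m t)" unfolding game_eq set_bind_pmf
      by (rule UN_I[OF that]) (simp add: z)
    then have "halted (fst z)" using assms by auto
    moreover have "ch_bit (snd z) = b" using game_steps_bit[OF z] by (simp add: real_state_simps)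
    ultimately show "correct_guess z = ((c_state (fst z) = 4) = b)"
      by (auto simp: correct_guess_def halted_def split: prod.splits)
  qed
  have "map_pmf correct_guess (game A \<kappa> p m t) = pmf_of_set encs \<bind> (\<lambda>\<psi>0. pmf_of_set encs \<bind> (\<lambda>\<psi>1. rand_asn {Alpha, Beta 0} \<bind> (\<lambda>x.
      bernoulli_pmf (1 / 2) \<bind> (\<lambda>b. map_pmf (\<lambda>s. s = b) (outcome t \<kappa> b x (enc_pair (\<psi>0, \<psi>1)))))))"
    unfolding game_eq start map_bind_pmf bind_assoc_pmf Let_def bind_return_pmf prod.case outcome_def
    by (intro bind_pmf_cong refl final) (unfold start set_bind_pmf Let_def, force)
  also have "\<dots> = pmf_of_set encs \<bind> (\<lambda>\<psi>0. pmf_of_set encs \<bind> (\<lambda>\<psi>1. bernoulli_pmf (1 / 2) \<bind> (\<lambda>b.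
      rand_asn {Alpha, Beta 0} \<bind> (\<lambda>x. map_pmf (\<lambda>s. s = b) (outcome t \<kappa> b x (enc_pair (\<psi>0, \<psi>1)))))))"
    by (subst bind_commute_pmf) (rule refl)
  also have "\<dots> = bernoulli_pmf (1 / 2) \<bind> (\<lambda>b. pmf_of_set encs \<bind> (\<lambda>\<psi>0. pmf_of_set encs \<bind> (\<lambda>\<psi>1.
      rand_asn {Alpha, Beta 0} \<bind> (\<lambda>x. map_pmf (\<lambda>s. s = b) (outcome t \<kappa> b x (enc_pair (\<psi>0, \<psi>1)))))))"
    by (subst bind_commute_pmf[of "bernoulli_pmf (1 / 2)"], subst bind_commute_pmf[of "bernoulli_pmf (1 / 2)"]) (rule refl)
  also have "\<dots> = bernoulli_pmf (1 / 2) \<bind> (\<lambda>b. map_pmf (\<lambda>s. s = b) (run_bit t \<kappa> b))"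
    unfolding run_bit_def map_bind_pmf
    by (subst bind_commute_pmf[of "rand_asn _"], subst bind_commute_pmf[of "rand_asn _"]) (rule refl)
  finally show ?thesis .
qed

text \<open>The ideal probability \<open>w\<close> of guessing 1 is the same for both bits, so
  averaging \<open>w\<close> and \<open>1 - w\<close> gives at least
  \<open>(1 - \<epsilon>) / 2\<close> for success and likewise for failure. As these add up to 1,
  both are within \<open>\<epsilon> / 2\<close> of one half.\<close>

theorem advantage_bound:
  assumes halt: "\<forall>(c, ch)\<in>set_pmf (game A \<kappa> p m t). halted c" and t: "5 + 4 * t \<le> B"
  shows "\<bar>success_prob A \<kappa> p m - 1 / 2\<bar> \<le> \<epsilon> / 2"
proof -
  obtain w where w: "\<And>b e. (1 - \<epsilon>) * (if e then w else 1 - w) \<le> pmf (run_bit t \<kappa> b) e"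
    using simulable_start[OF t, of \<kappa>] unfolding simulable_def weight_run_bit by blast
  let ?M = "map_pmf correct_guess (game A \<kappa> p m t)"
  have pm: "pmf (map_pmf (\<lambda>s. s = b) M) e = pmf M (e = b)" for b e and M :: "bool pmf"
  proof -
    have "(\<lambda>s. s = b) -` {e} = {e = b}" by (cases b; cases e) auto
    then show ?thesis by (simp add: pmf_map pmf.rep_eq)
  qed
  have M: "pmf ?M e = (pmf (run_bit t \<kappa> True) e + pmf (run_bit t \<kappa> False) (\<not> e)) / 2" for e
    unfolding game_run_bit[OF halt] pmf_bind by (simp add: pm)
  have "(1 - \<epsilon>) / 2 \<le> pmf ?M e" for e
    unfolding M using w[of e True] w[of "\<not> e" False] by (cases e) (simp_all add: algebra_simps)
  from this[of True] this[of False] have "(1 - \<epsilon>) / 2 \<le> pmf ?M True" "(1 - \<epsilon>) / 2 \<le> pmf ?M False" .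
  moreover have "pmf ?M True + pmf ?M False = 1"
    using sum_pmf_eq_1[OF finite subset_UNIV, of ?M] by (simp add: UNIV_bool)
  moreover have "success_prob A \<kappa> p m = pmf ?M True"
    unfolding success_prob_eq[OF halt] by (simp add: pmf_map vimage_def)
  ultimately show ?thesis by (simp add: abs_le_iff field_simps)
qed

end

section \<open>Explicit and asymptotic bounds\<close>

lemma poly_nat_bound:
  fixes T :: "nat poly"
  assumes "1 \<le> k"
  shows "poly T k \<le> (\<Sum>i\<le>degree T. coeff T i) * k ^ degree T"
  unfolding poly_altdef sum_distrib_right
  using assms by (intro sum_mono mult_left_mono power_increasing) auto

lemma less_imp_div_less_inverse: "a * k < b \<Longrightarrow> 0 < b \<Longrightarrow> 0 < k \<Longrightarrow> a / b < 1 / (k :: real)"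
  by (simp add: field_simps)

text \<open>With \<open>B = 5 + 4 * t\<close> the collision term is
  \<open>16 * B ^ 3 * (B + 1) / (p - 1)\<close>, and the length of the encodings gives
  \<open>2 ^ m - p >= p * (p - 1)\<close>, so that the refused strings cost at most
  \<open>2 * B / (p - 1)\<close>; together this is below \<open>18 * (B + 1) ^ 4 / (p - 1)\<close>.
  The assumption \<open>small\<close> yields both \<open>\<epsilon> <= 1\<close> and
  \<open>B < p\<close>.\<close>

lemma concrete_bound:
  assumes "prime p" "2 < p" "3 * log 2 (real p) < real m"
    and halt: "\<forall>(c, ch)\<in>set_pmf (game A \<kappa> p m t). halted c"
    and small: "18 * (6 + 4 * real t) ^ 4 \<le> real (p - 1)"
  shows "\<bar>success_prob A \<kappa> p m - 1 / 2\<bar> \<le> 9 * (6 + 4 * real t) ^ 4 / real (p - 1)"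
proof -
  have p: "0 < real p" using assms(2) by simp
  have "real (p ^ 3) = 2 powr (3 * log 2 (real p))"
    using p by (simp add: powr_powr[symmetric] mult.commute[of 3] powr_log_cancel)
  also have "\<dots> \<le> 2 powr (real m)" using assms(3) by (intro powr_mono) auto
  finally have "real (p ^ 3) \<le> real (2 ^ m)" by (simp add: powr_realpow)
  then have m: "p ^ 3 \<le> 2 ^ m" by (simp only: of_nat_le_iff)
  interpret bilinear p m by standard (use assms m in auto)
  define B where "B = 5 + 4 * t"
  define \<epsilon> where "\<epsilon> = 18 * (6 + 4 * real t) ^ 4 / real (p - 1)"
  have pos: "0 < real (p - 1)" using assms(2) by simp
  have B1: "real B + 1 = 6 + 4 * real t" by (simp add: B_def)
  have pow: "real B + 1 \<le> (real B + 1) ^ 4" by (rule self_le_power) auto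
  have "real B < real p" using small pow pos unfolding B1[symmetric] by linarith
  then have "B < p" by simp
  moreover have "\<epsilon> \<le> 1" using small pos by (simp add: \<epsilon>_def)
  moreover have "2 * (real B * real B) * (real B * (2 * (4 + 4 * real B)) / (p - 1)) + 2 * (real p * (real B / real (2 ^ m - p))) \<le> \<epsilon>"
  proof -
    have "real p * real (p - 1) \<le> real (2 ^ m - p)"
    proof -
      have "p * (p - 1) + p = p * p" using assms(2) by (simp add: algebra_simps)
      also have "\<dots> \<le> p ^ 3" using assms(2) by (simp add: power3_eq_cube)
      finally have "p * (p - 1) \<le> 2 ^ m - p" using m by linarith
      then have "real (p * (p - 1)) \<le> real (2 ^ m - p)" by (simp only: of_nat_le_iff)
      then show ?thesis by simp
    qed
    moreover have "0 < real p * real (p - 1)" using p pos by (rule mult_pos_pos)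
    ultimately have "real p * (real B / real (2 ^ m - p)) \<le> real p * (real B / (real p * real (p - 1)))"
      using p by (intro mult_left_mono divide_left_mono mult_pos_pos) (use pos in linarith)+
    also have "\<dots> = real B / real (p - 1)" using p by simp
    finally have 1: "real p * (real B / real (2 ^ m - p)) \<le> real B / real (p - 1)" .
    have "2 * (real B * real B) * (real B * (2 * (4 + 4 * real B))) + 2 * real B \<le> 18 * (real B + 1) ^ 4"
      by (simp add: power4_eq_xxxx algebra_simps)
    then have "(2 * (real B * real B) * (real B * (2 * (4 + 4 * real B))) + 2 * real B) / real (p - 1) \<le> \<epsilon>"
      unfolding \<epsilon>_def B1[symmetric] using pos by (intro divide_right_mono) auto
    then show ?thesis using 1 by (simp add: add_divide_distrib)
  qed
  ultimately interpret reduction p m A B \<epsilon> by unfold_locales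
  show ?thesis
    using advantage_bound[OF halt] by (simp add: B_def \<epsilon>_def)
qed

theorem theorem1:
  fixes p m :: "nat \<Rightarrow> nat" and A :: machine
  assumes "bilinear_params p m" and "ppt A p m"
  shows "negligible_fun (advantage A p m)"
proof -
  obtain T :: "nat poly" where T: "\<And>\<kappa>. 2 \<le> \<kappa> \<Longrightarrow> \<forall>(c, ch)\<in>set_pmf (game A \<kappa> (p \<kappa>) (m \<kappa>) (poly T \<kappa>)). halted c"
    using assms(2) unfolding ppt_def by blast
  define d where "d = degree T"
  \<comment> \<open>The constant 6 is absorbed into the coefficient by means of
    \<open>1 <= \<kappa> ^ d\<close>.\<close>
  define C where "C = 6 + 4 * real (\<Sum>i\<le>degree T. coeff T i)"
  have C: "6 + 4 * real (poly T \<kappa>) \<le> C * real \<kappa> ^ d" if "1 \<le> \<kappa>" for \<kappa>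
  proof -
    have "real (poly T \<kappa>) \<le> real ((\<Sum>i\<le>degree T. coeff T i) * \<kappa> ^ d)"
      unfolding d_def of_nat_le_iff by (rule poly_nat_bound[OF that])
    moreover have "1 \<le> real \<kappa> ^ d" using that by simp
    ultimately show ?thesis unfolding C_def by (simp add: algebra_simps)
  qed
  show ?thesis
    unfolding negligible_fun_def
  proof
    fix c :: nat
    \<comment> \<open>A single limit serves twice: the factor 18 is what \<open>small\<close> in
      \<open>concrete_bound\<close> asks for, and the bound itself needs only 9.\<close>
    have "(\<lambda>\<kappa>. 18 * C ^ 4 * real \<kappa> ^ (4 * d + c) / (2 ^ (\<kappa> - 1) - 1)) \<longlonglongrightarrow> 0"
      by real_asymp
    then have "\<forall>\<^sub>F \<kappa> in sequentially. 18 * C ^ 4 * real \<kappa> ^ (4 * d + c) / (2 ^ (\<kappa> - 1) - 1) < 1"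
      by (rule order_tendstoD) simp
    then show "\<forall>\<^sub>F \<kappa> in sequentially. \<bar>advantage A p m \<kappa>\<bar> < 1 / real \<kappa> ^ c"
      using eventually_ge_at_top[of 3]
    proof eventually_elim
      case (elim \<kappa>)
      have par: "prime (p \<kappa>)" "2 ^ (\<kappa> - 1) \<le> p \<kappa>" "3 * log 2 (real (p \<kappa>)) < real (m \<kappa>)"
        using assms(1) elim(2) unfolding bilinear_params_def by auto
      \<comment> \<open>From \<open>\<kappa> = 3\<close> on the order is at least 4, as the
        assumption \<open>2 < p\<close> requires; for \<open>\<kappa> = 2\<close> the prime could be
        2.\<close>
      have "(2 :: nat) ^ 2 \<le> 2 ^ (\<kappa> - 1)" using elim(2) by (intro power_increasing) auto
      then have p4: "4 \<le> p \<kappa>" using par(2) by simp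
      let ?X = "(6 + 4 * real (poly T \<kappa>)) ^ 4"
      have X: "?X \<le> C ^ 4 * real \<kappa> ^ (4 * d)"
      proof -
        have "?X \<le> (C * real \<kappa> ^ d) ^ 4" using C[of \<kappa>] elim(2) by (intro power_mono) auto
        then show ?thesis by (simp add: power_mult_distrib power_mult[symmetric] mult.commute)
      qed
      have kpos: "1 \<le> real \<kappa> ^ c" using elim(2) by simp
      have "real (2 ^ (\<kappa> - 1)) \<le> real (p \<kappa>)" using par(2) by (simp only: of_nat_le_iff)
      then have denom: "0 < (2 :: real) ^ (\<kappa> - 1) - 1" "2 ^ (\<kappa> - 1) - 1 \<le> real (p \<kappa> - 1)"
        using \<open>(2 :: nat) ^ 2 \<le> 2 ^ (\<kappa> - 1)\<close> p4 elim(2) by (auto simp: of_nat_diff)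
      have "18 * C ^ 4 * real \<kappa> ^ (4 * d + c) < 2 ^ (\<kappa> - 1) - 1"
        using elim(1) denom(1) by (simp add: field_simps)
      then have "18 * (C ^ 4 * real \<kappa> ^ (4 * d)) * real \<kappa> ^ c < real (p \<kappa> - 1)"
        using denom(2) by (simp add: power_add mult.assoc)
      moreover have "18 * ?X * real \<kappa> ^ c \<le> 18 * (C ^ 4 * real \<kappa> ^ (4 * d)) * real \<kappa> ^ c"
        using X kpos by (intro mult_right_mono mult_left_mono) auto
      ultimately have less: "18 * ?X * real \<kappa> ^ c < real (p \<kappa> - 1)" by linarith
      have "18 * ?X * 1 \<le> 18 * ?X * real \<kappa> ^ c" using kpos by (intro mult_left_mono) auto
      then have "18 * ?X \<le> real (p \<kappa> - 1)" using less by linarith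
      from concrete_bound[OF par(1) _ par(3) T this]
      have adv: "\<bar>advantage A p m \<kappa>\<bar> \<le> 9 * ?X / real (p \<kappa> - 1)"
        using p4 elim(2) by (simp add: advantage_def)
      also have "\<dots> < 1 / real \<kappa> ^ c"
      proof -
        have "9 * ?X * real \<kappa> ^ c \<le> 18 * ?X * real \<kappa> ^ c" using kpos by (intro mult_right_mono) auto
        then have "9 * ?X * real \<kappa> ^ c < real (p \<kappa> - 1)" using less by linarith
        moreover have "0 < real (p \<kappa> - 1)" using p4 by simp
        ultimately show ?thesis using kpos by (intro less_imp_div_less_inverse) linarith+
      qed
      finally show ?case .
    qed
  qed
qed

end
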